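(* Let $N\ge1$ and $\beta\in\mathbb C$ with $\beta^4=(-1)^N$. Then $\hat Q_\zeta=Q$; that is, the quasi-triangular quasi-bialgebra $Q=Q(N,\beta)$ is obtained from the quasi-triangular quasi-bialgebra $\hat Q=\hat Q(N,\beta)$ by twisting via $\zeta$: one has $\zeta\,\hat\Delta(x)\,\zeta^{-1}=\Delta(x)$ for all $x$, $\zeta_{21}\,\hat R\,\zeta^{-1}=R$, and $(\zeta\otimes1)\,(\hat\Delta\otimes\mathrm{id})(\zeta)\,\hat\Phi\,(\mathrm{id}\otimes\hat\Delta)(\zeta^{-1})\,(1\otimes\zeta^{-1})=\Phi$.
   Context: $Q$ and $\hat Q$ have the same underlying algebra and counit: the unital associative $\mathbb C$-algebra generated by $K$, $f_i^\pm$ ($1\le i\le N$) with relations $\{f_i^\pm,K\}=0$, $\{f_i^+,f_j^-\}=\delta_{ij}e_1$, $\{f_i^\pm,f_j^\pm\}=0$, $K^4=1$, where $\{x,y\}=xy+yx$, $e_0=\frac12(1+K^2)$, $e_1=\frac12(1-K^2)$; $\varepsilon(K)=1$, $\varepsilon(f_i^\pm)=0$. Put $\omega_\pm=(e_0\pm ie_1)K$. **Structure of $Q$:** $\Delta(K)=K\otimes K-(1+(-1)^N)(e_1\otimes e_1)(K\otimes K)$, $\Delta(f_i^\pm)=f_i^\pm\otimes1+\omega_\pm\otimes f_i^\pm$; $\Phi=1\otimes1\otimes1+e_1\otimes e_1\otimes\{(K^N-1)e_0+(\beta^2(iK)^N-1)e_1\}$; $R=\big(\sum_{n,m\in\{0,1\}}\beta^{nm}\rho_{n,m}\,e_n\otimes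 e_m\big)\prod_{k=1}^N(1\otimes1-2f_k^-\omega_-\otimes f_k^+)$, $\rho_{n,m}=\frac12\sum_{p,q=0}^1(-1)^{pq}i^{-pn+qm}K^p\otimes K^q$. **Structure of $\hat Q$:** $\hat\Delta(K)=K\otimes K-(1+(-1)^N)(e_1\otimes e_1)(K\otimes K)$, $\hat\Delta(f_i^\pm)=f_i^\pm\otimes1+K^{-1}\otimes f_i^\pm-(1+(-1)^N)(e_1\otimes e_1)(K^{-1}\otimes f_i^\pm)$. Coassociator: $\hat\Phi=\sum_{a,b,c\in\{0,1\}}\hat\Phi^{abc}\,(e_a\otimes e_b\otimes e_c)$ with $\hat\Phi^{abc}=1\otimes1\otimes1$ except $\hat\Phi^{010}=\prod_{k=1}^N\hat\Phi^{010}_{(k)}$, $\hat\Phi^{101}=\big((-K)^{N-1}\otimes K^{N-1}\otimes1\big)\big(\prod_k\hat\Phi^{101}_{(k)}\big)\big(K^{N-1}\otimes K\otimes1\big)$, $\hat\Phi^{111}=-i^N\beta^2\big(K^{N-1}\otimes1\otimes1\big)\big(\prod_k\hat\Phi^{111}_{(k)}\big)\big(K^{N-1}\otimes K^N\otimes1\big)$, where (writing $\mathbb 1=1\otimes1\otimes1$, $f^\pm=f^\pm_k$) $\hat\Phi^{010}_{(k)}=\big(\mathbb 1+(1+i)f^+K\otimes K\otimes f^-\big)\big(\mathbb 1+(1-i)f^-K\otimes K\otimes f^+\big)$, $\hat\Phi^{101}_{(k)}=\big(\mathbb 1+(1+i)1\otimes f^+K\otimes f^-+(1-i)f^-K\otimes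 f^+\otimes1\big)\big(\mathbb 1+(1+i)f^+K\otimes f^-\otimes1+(1-i)1\otimes f^-K\otimes f^+\big)$, $\hat\Phi^{111}_{(k)}=\big(\mathbb 1+(i-1)(1\otimes f^+K\otimes f^-+f^+K\otimes K\otimes f^--f^+K\otimes f^-\otimes1+1\otimes f^-f^+\otimes1)\big)\cdot\big(\mathbb 1-(i-1)(1\otimes f^-K\otimes f^++f^-K\otimes K\otimes f^+-f^-K\otimes f^+\otimes1-1\otimes f^-f^+\otimes1)\big)\cdot\big(\mathbb 1-2\cdot1\otimes f^-f^+\otimes1\big)$. R-matrix: $\hat R=\sum_{a,b}\hat R^{ab}\,(e_a\otimes e_b)$. With $\omega=(e_0-ie_1)K$ and $\rho(K)=\frac12(1\otimes1+\omega\otimes1+1\otimes\omega-\omega\otimes\omega)$: $\hat R^{0b}=\rho(K)\prod_k\hat R^{0b}_{(k)}$ ($b=0,1$), $\hat R^{10}=\rho(K)\big(\prod_k\hat R^{10}_{(k)}\big)(1\otimes K)$, $\hat R^{11}=(-1)^Ni\beta\,\rho(K)(1\otimes K^{N-1})\big(\prod_k\hat R^{11}_{(k)}\big)(K^N\otimes1)$, where $\hat R^{00}_{(k)}=1\otimes1-2f^-K\otimes f^+$, $\hat R^{01}_{(k)}=1\otimes1-(1+i)f^-K\otimes f^+-(1+i)f^+K\otimes f^-+(1-i)f^-f^+\otimes1+2i\,f^-f^+\otimes f^-f^+$, $\hat R^{10}_{(k)}=1\otimes1+(1+i)f^-K\otimes f^++(1+i)f^+K\otimes f^-+(1+i)1\otimes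 f^-f^+-2i\,f^-f^+\otimes f^-f^+$, $\hat R^{11}_{(k)}=1\otimes1-2i\,f^-K\otimes f^++(i-1)1\otimes f^-f^+-(1+i)f^-f^+\otimes1+2f^-f^+\otimes f^-f^+$. **Twist:** $\zeta=e_0\otimes1+\zeta^{10}(e_1\otimes e_0)+\zeta^{11}(e_1\otimes e_1)$ with $\zeta^{10}=\big(\prod_k\zeta^{10}_{(k)}\big)(1\otimes K)$, $\zeta^{11}=\big(\prod_k\zeta^{11}_{(k)}\big)(1\otimes K^{N-1})$, $\zeta^{10}_{(k)}=1\otimes1+(1-i)1\otimes f^+f^-+(1-i)f^-K\otimes f^++(1+i)f^+K\otimes f^--2f^+f^-\otimes f^+f^-$, $\zeta^{11}_{(k)}=1\otimes1-(1+i)1\otimes f^+f^-$ (again $f^\pm=f^\pm_k$). It is invertible with $(\varepsilon\otimes\mathrm{id})(\zeta)=1=(\mathrm{id}\otimes\varepsilon)(\zeta)$. *)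

theory Defs
  imports Complex_Main "HOL-Library.Cardinality"
begin

section \<open>Unital associative complex algebras\<close>

class scaleC =
  fixes scaleC :: "complex \<Rightarrow> 'a \<Rightarrow> 'a"  (infixr "*\<^sub>C" 75)

(* The library class ring_1 also demands 0 \<noteq> 1; this is deliberately not asked for here,
   so that algebras given by generators and relations, and tensor products, are instances. *)
class complex_algebra = ring + monoid_mult + scaleC +
  assumes scaleC_add_right: "c *\<^sub>C (x + y) = c *\<^sub>C x + c *\<^sub>C y"
    and scaleC_add_left: "(c + d) *\<^sub>C x = c *\<^sub>C x + d *\<^sub>C x"
    and scaleC_scaleC: "c *\<^sub>C d *\<^sub>C x = (c * d) *\<^sub>C x"
    and scaleC_one: "1 *\<^sub>C x = x"
    and scaleC_mult_left: "(c *\<^sub>C x) * y = c *\<^sub>C (x * y)"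
    and scaleC_mult_right: "x * (c *\<^sub>C y) = c *\<^sub>C (x * y)"
begin

lemma scaleC_zero_left [simp]: "0 *\<^sub>C x = 0"
  using scaleC_add_left[of 0 0 x] by simp

lemma scaleC_zero_right [simp]: "c *\<^sub>C 0 = 0"
  using scaleC_add_right[of c 0 0] by simp

lemma scaleC_minus_left: "(- c) *\<^sub>C x = - (c *\<^sub>C x)"
  using scaleC_add_left[of "- c" c x] by (simp add: eq_neg_iff_add_eq_0)

lemma scaleC_minus_right: "c *\<^sub>C (- x) = - (c *\<^sub>C x)"
  using scaleC_add_right[of c "- x" x] by (simp add: eq_neg_iff_add_eq_0)

lemma scaleC_diff_left: "(c - d) *\<^sub>C x = c *\<^sub>C x - d *\<^sub>C x"
  using scaleC_add_left[of c "- d" x] by (simp add: scaleC_minus_left)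

lemma scaleC_diff_right: "c *\<^sub>C (x - y) = c *\<^sub>C x - c *\<^sub>C y"
  using scaleC_add_right[of c x "- y"] by (simp add: scaleC_minus_right)

end

instantiation complex :: complex_algebra
begin

definition scaleC_complex :: "complex \<Rightarrow> complex \<Rightarrow> complex" where
  "scaleC_complex c x = c * x"

instance
  by standard (simp_all add: scaleC_complex_def algebra_simps)

end

definition clinear :: "('a::complex_algebra \<Rightarrow> 'b::complex_algebra) \<Rightarrow> bool" where
  "clinear f \<longleftrightarrow> (\<forall>x y. f (x + y) = f x + f y) \<and> (\<forall>c x. f (c *\<^sub>C x) = c *\<^sub>C f x)"

definition alg_hom :: "('a::complex_algebra \<Rightarrow> 'b::complex_algebra) \<Rightarrow> bool" where
  "alg_hom f \<longleftrightarrow> clinear f \<and> f 1 = 1 \<and> (\<forall>x y. f (x * y) = f x * f y)"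

lemma alg_homD:
  assumes "alg_hom f"
  shows "f (x + y) = f x + f y" "f (c *\<^sub>C x) = c *\<^sub>C f x" "f 1 = 1" "f (x * y) = f x * f y"
  using assms by (simp_all add: alg_hom_def clinear_def)

definition is_inverse :: "'a::monoid_mult \<Rightarrow> 'a \<Rightarrow> bool" where
  "is_inverse x y \<longleftrightarrow> x * y = 1 \<and> y * x = 1"

(* Only meaningful when a two-sided inverse exists (it is then unique). *)
definition unit_inv :: "'a::monoid_mult \<Rightarrow> 'a" where
  "unit_inv x = (THE y. is_inverse x y)"

lemma unit_inv_eq: "is_inverse x y \<Longrightarrow> unit_inv x = y"
  unfolding unit_inv_def is_inverse_def
  by (rule the_equality) (auto, metis mult.assoc mult_1_left mult_1_right)


section \<open>Tensor products over the complex numbers\<close>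

(* Elements of the tensor product are finite formal sums of pairs, written as lists, modulo the
   congruence generated by commutativity of the sum and bilinearity.  Scalars need no place of
   their own, since c(a\<otimes>b) = (ca)\<otimes>b. *)
inductive tensor_eq ::
  "('a::complex_algebra \<times> 'b::complex_algebra) list \<Rightarrow> ('a \<times> 'b) list \<Rightarrow> bool" where
  t_refl: "tensor_eq xs xs"
| t_sym: "tensor_eq xs ys \<Longrightarrow> tensor_eq ys xs"
| t_trans: "tensor_eq xs ys \<Longrightarrow> tensor_eq ys zs \<Longrightarrow> tensor_eq xs zs"
| t_append: "tensor_eq xs xs' \<Longrightarrow> tensor_eq ys ys' \<Longrightarrow> tensor_eq (xs @ ys) (xs' @ ys')"
| t_commute: "tensor_eq (xs @ ys) (ys @ xs)"
| t_zero: "tensor_eq [(0, b)] []"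
| t_add_left: "tensor_eq [(a + a', b)] [(a, b), (a', b)]"
| t_add_right: "tensor_eq [(a, b + b')] [(a, b), (a, b')]"
| t_scale: "tensor_eq [(c *\<^sub>C a, b)] [(a, c *\<^sub>C b)]"

quotient_type (overloaded) ('a, 'b) tensor (infixr "\<otimes>" 71)
    = "('a::complex_algebra \<times> 'b::complex_algebra) list" / tensor_eq
  by (rule equivpI)
    (auto intro!: reflpI sympI transpI intro: tensor_eq.t_refl tensor_eq.t_sym tensor_eq.t_trans)

(* Binds more loosely than multiplication and tighter than addition:
   a * b \<otimes> c + d  is  ((a * b) \<otimes> c) + d. *)
lift_definition tensor_pure :: "'a::complex_algebra \<Rightarrow> 'b::complex_algebra \<Rightarrow> 'a \<otimes> 'b"
    (infixr "\<otimes>" 68)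
  is "\<lambda>a b. [(a, b)]" .

lemma tensor_eq_minus:
  "tensor_eq xs ys \<Longrightarrow> tensor_eq (map (\<lambda>(a, b). (- a, b)) xs) (map (\<lambda>(a, b). (- a, b)) ys)"
proof (induction rule: tensor_eq.induct)
  case (t_add_left a a' b)
  show ?case using tensor_eq.t_add_left[of "- a" "- a'" b] by simp
next
  case (t_scale c a b)
  show ?case using tensor_eq.t_scale[of c "- a" b] by (simp add: scaleC_minus_right)
qed (auto intro: tensor_eq.intros)

lemma tensor_eq_minus_cancel: "tensor_eq (map (\<lambda>(a, b). (- a, b)) xs @ xs) []"
proof (induction xs)
  case Nil
  show ?case by (simp add: tensor_eq.t_refl)
next
  case (Cons p xs)
  obtain a b where p: "p = (a, b)" by fastforce
  let ?m = "map (\<lambda>(a, b). (- a, b)) xs"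
  have "tensor_eq ([(- a, b)] @ (?m @ [(a, b)]) @ xs) ([(- a, b)] @ ([(a, b)] @ ?m) @ xs)"
    by (intro tensor_eq.t_append tensor_eq.t_refl tensor_eq.t_commute)
  moreover have "tensor_eq [(- a, b), (a, b)] []"
    using tensor_eq.t_add_left[of "- a" a b] tensor_eq.t_zero[of b]
    by (auto intro: tensor_eq.t_sym tensor_eq.t_trans)
  then have "tensor_eq ([(- a, b), (a, b)] @ (?m @ xs)) ([] @ [])"
    using Cons by (rule tensor_eq.t_append)
  ultimately show ?case
    unfolding p by (auto intro: tensor_eq.t_trans)
qed

instantiation tensor :: (complex_algebra, complex_algebra) ab_group_add
begin

lift_definition zero_tensor :: "'a \<otimes> 'b" is "[]" .

lift_definition plus_tensor :: "'a \<otimes> 'b \<Rightarrow> 'a \<otimes> 'b \<Rightarrow> 'a \<otimes> 'b" is append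
  by (rule tensor_eq.t_append)

lift_definition uminus_tensor :: "'a \<otimes> 'b \<Rightarrow> 'a \<otimes> 'b" is "map (\<lambda>(a, b). (- a, b))"
  by (rule tensor_eq_minus)

definition minus_tensor :: "'a \<otimes> 'b \<Rightarrow> 'a \<otimes> 'b \<Rightarrow> 'a \<otimes> 'b" where
  "minus_tensor x y = x + (- y)"

instance
proof
  fix x y z :: "'a \<otimes> 'b"
  show "x + y + z = x + (y + z)" by transfer (simp add: tensor_eq.t_refl)
  show "x + y = y + x" by transfer (rule tensor_eq.t_commute)
  show "0 + x = x" by transfer (simp add: tensor_eq.t_refl)
  show "- x + x = 0" by transfer (rule tensor_eq_minus_cancel)
  show "x - y = x + - y" by (rule minus_tensor_def)
qed

end

lemma tensor_add_left: "(a + a') \<otimes> b = a \<otimes> b + a' \<otimes> b"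
  by transfer (simp add: tensor_eq.t_add_left)

lemma tensor_add_right: "a \<otimes> (b + b') = a \<otimes> b + a \<otimes> b'"
  by transfer (simp add: tensor_eq.t_add_right)

lemma tensor_balanced: "(c *\<^sub>C a) \<otimes> b = a \<otimes> (c *\<^sub>C b)"
  by transfer (rule tensor_eq.t_scale)

lemma tensor_zero_left [simp]: "0 \<otimes> b = 0"
  by transfer (rule tensor_eq.t_zero)

lemma tensor_zero_right [simp]: "a \<otimes> 0 = 0"
  using tensor_add_right[of a 0 0] by simp

lemma abs_tensor_sum: "abs_tensor xs = (\<Sum>(a, b)\<leftarrow>xs. a \<otimes> b)"
proof (induction xs)
  case Nil
  show ?case by (simp add: zero_tensor_def)
next
  case (Cons p xs)
  have "abs_tensor (p # xs) = abs_tensor [p] + abs_tensor xs"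
    by (simp add: plus_tensor.abs_eq)
  then show ?case using Cons by (cases p) (simp add: tensor_pure.abs_eq)
qed

lemma tensor_induct [case_names zero pure add, induct type: tensor]:
  assumes "P 0" "\<And>a b. P (a \<otimes> b)" "\<And>x y. P x \<Longrightarrow> P y \<Longrightarrow> P (x + y)"
  shows "P x"
proof -
  obtain xs where x: "x = abs_tensor xs" by (metis Quotient_abs_rep[OF Quotient_tensor])
  have "P (\<Sum>(a, b)\<leftarrow>xs. a \<otimes> b)"
    by (induction xs) (auto intro: assms)
  then show ?thesis by (simp add: x abs_tensor_sum)
qed

definition bilinear_balanced ::
  "('a::complex_algebra \<Rightarrow> 'b::complex_algebra \<Rightarrow> 'c::ab_group_add) \<Rightarrow> bool" where
  "bilinear_balanced h \<longleftrightarrow>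
     (\<forall>a a' b. h (a + a') b = h a b + h a' b) \<and> (\<forall>a b b'. h a (b + b') = h a b + h a b') \<and>
     (\<forall>c a b. h (c *\<^sub>C a) b = h a (c *\<^sub>C b))"

(* The additive map out of the tensor product induced by h.  For balanced h it does not depend on
   the chosen representative (tensor_lift_abs). *)
definition tensor_lift ::
  "('a::complex_algebra \<Rightarrow> 'b::complex_algebra \<Rightarrow> 'c::ab_group_add) \<Rightarrow> 'a \<otimes> 'b \<Rightarrow> 'c" where
  "tensor_lift h x = (\<Sum>(a, b)\<leftarrow>rep_tensor x. h a b)"

lemma tensor_lift_abs:
  assumes "bilinear_balanced h"
  shows "tensor_lift h (abs_tensor xs) = (\<Sum>(a, b)\<leftarrow>xs. h a b)"
proof -
  have add: "h (a + a') b = h a b + h a' b" for a a' b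
    using assms by (simp add: bilinear_balanced_def)
  have "tensor_eq xs ys \<Longrightarrow> (\<Sum>(a, b)\<leftarrow>xs. h a b) = (\<Sum>(a, b)\<leftarrow>ys. h a b)" for xs ys
  proof (induction rule: tensor_eq.induct)
    case (t_zero b)
    show ?case using add[of 0 0 b] by simp
  qed (use assms in \<open>auto simp: bilinear_balanced_def add.commute\<close>)
  moreover have "tensor_eq (rep_tensor (abs_tensor xs)) xs"
    by (simp add: Quotient3_rep_abs[OF Quotient3_tensor] tensor_eq.t_refl)
  ultimately show ?thesis by (simp add: tensor_lift_def)
qed

lemma tensor_lift_pure: "bilinear_balanced h \<Longrightarrow> tensor_lift h (a \<otimes> b) = h a b"
  by (simp add: tensor_pure.abs_eq tensor_lift_abs)

lemma tensor_lift_zero: "bilinear_balanced h \<Longrightarrow> tensor_lift h 0 = 0"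
  by (simp add: zero_tensor_def tensor_lift_abs)

lemma tensor_lift_add:
  assumes "bilinear_balanced h"
  shows "tensor_lift h (x + y) = tensor_lift h x + tensor_lift h y"
proof -
  obtain xs ys where "x = abs_tensor xs" "y = abs_tensor ys"
    by (metis Quotient_abs_rep[OF Quotient_tensor])
  then show ?thesis using assms by (simp add: plus_tensor.abs_eq tensor_lift_abs)
qed

lemma tensor_lift_fun_add:
  "tensor_lift (\<lambda>a b. g a b + h a b) x = tensor_lift g x + tensor_lift h x"
  by (simp add: tensor_lift_def sum_list_addf case_prod_unfold)

lemmas tensor_lift_simps = tensor_lift_pure tensor_lift_zero tensor_lift_add

lemma bilinear_balanced_mult_pure:
  "bilinear_balanced (\<lambda>c d. (a * c) \<otimes> (b * d))"
  by (simp add: bilinear_balanced_def distrib_left tensor_add_left tensor_add_right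
      scaleC_mult_right tensor_balanced)

lemma bilinear_balanced_scale: "bilinear_balanced (\<lambda>a b. (c *\<^sub>C a) \<otimes> b)"
  by (simp add: bilinear_balanced_def tensor_add_left tensor_add_right scaleC_add_right
      tensor_balanced scaleC_scaleC mult.commute)

lemma bilinear_balanced_mult:
  "bilinear_balanced (\<lambda>a b. tensor_lift (\<lambda>c d. (a * c) \<otimes> (b * d)) y)"
  by (simp add: bilinear_balanced_def distrib_right tensor_add_left tensor_add_right
      tensor_lift_fun_add scaleC_mult_left scaleC_mult_right tensor_balanced)

lemma bilinear_balanced_mult_pure_left:
  "bilinear_balanced (\<lambda>a b. (a * c) \<otimes> (b * d))"
  by (simp add: bilinear_balanced_def distrib_right tensor_add_left tensor_add_right
      scaleC_mult_left tensor_balanced)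

instantiation tensor :: (complex_algebra, complex_algebra) complex_algebra
begin

definition one_tensor :: "'a \<otimes> 'b" where
  "one_tensor = 1 \<otimes> 1"

definition times_tensor :: "'a \<otimes> 'b \<Rightarrow> 'a \<otimes> 'b \<Rightarrow> 'a \<otimes> 'b" where
  "times_tensor x y = tensor_lift (\<lambda>a b. tensor_lift (\<lambda>c d. (a * c) \<otimes> (b * d)) y) x"

definition scaleC_tensor :: "complex \<Rightarrow> 'a \<otimes> 'b \<Rightarrow> 'a \<otimes> 'b" where
  "scaleC_tensor c x = tensor_lift (\<lambda>a b. (c *\<^sub>C a) \<otimes> b) x"

instance
proof
  fix x y z :: "'a \<otimes> 'b" and c d :: complex
  have mpure: "(a \<otimes> b) * (a' \<otimes> b') = (a * a') \<otimes> (b * b')" for a a' :: 'a and b b' :: 'b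
    by (simp add: times_tensor_def tensor_lift_pure bilinear_balanced_mult_pure
        bilinear_balanced_mult_pure_left)
  have spure: "s *\<^sub>C (a \<otimes> b) = (s *\<^sub>C a) \<otimes> b" for s and a :: 'a and b :: 'b
    by (simp add: scaleC_tensor_def tensor_lift_pure bilinear_balanced_scale)
  have dr: "(u + v) * w = u * w + v * w" for u v w :: "'a \<otimes> 'b"
    by (simp add: times_tensor_def tensor_lift_add bilinear_balanced_mult)
  have z: "0 * w = 0" for w :: "'a \<otimes> 'b"
    by (simp add: times_tensor_def tensor_lift_zero bilinear_balanced_mult)
  have dl: "w * (u + v) = w * u + w * v" for u v w :: "'a \<otimes> 'b"
  proof (induction w rule: tensor_induct)
    case (pure a b)
    show ?case
      by (simp add: times_tensor_def tensor_lift_pure tensor_lift_add[OF bilinear_balanced_mult_pure]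
          tensor_lift_fun_add bilinear_balanced_mult)
  qed (simp_all add: z dr add_ac)
  have zr: "w * 0 = 0" for w :: "'a \<otimes> 'b"
    using dl[of w 0 0] by simp
  have sadd: "s *\<^sub>C (u + v) = s *\<^sub>C u + s *\<^sub>C v" for s and u v :: "'a \<otimes> 'b"
    by (simp add: scaleC_tensor_def tensor_lift_add bilinear_balanced_scale)
  have sz: "s *\<^sub>C (0 :: 'a \<otimes> 'b) = 0" for s
    by (simp add: scaleC_tensor_def tensor_lift_zero bilinear_balanced_scale)
  show "(x + y) * z = x * z + y * z" by (rule dr)
  show "x * (y + z) = x * y + x * z" by (rule dl)
  show "1 * x = x"
    by (induction x rule: tensor_induct) (simp_all add: one_tensor_def mpure zr dl)
  show "x * 1 = x"
    by (induction x rule: tensor_induct) (simp_all add: one_tensor_def mpure z dr)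
  show "c *\<^sub>C (x + y) = c *\<^sub>C x + c *\<^sub>C y" by (rule sadd)
  show "(c + d) *\<^sub>C x = c *\<^sub>C x + d *\<^sub>C x"
    by (induction x rule: tensor_induct)
      (simp_all add: sadd sz spure scaleC_add_left tensor_add_left add_ac)
  show "c *\<^sub>C d *\<^sub>C x = (c * d) *\<^sub>C x"
    by (induction x rule: tensor_induct) (simp_all add: sadd sz spure scaleC_scaleC)
  show "1 *\<^sub>C x = x"
    by (induction x rule: tensor_induct) (simp_all add: sadd sz spure scaleC_one)
  have p: "(a \<otimes> b) * y * z = (a \<otimes> b) * (y * z)" for a b and y z :: "'a \<otimes> 'b"
  proof (induction y rule: tensor_induct)
    case (pure a' b')
    show ?case
      by (induction z rule: tensor_induct)
        (simp_all add: mpure zr dl mult.assoc)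
  qed (simp_all add: z zr dl dr)
  show "x * y * z = x * (y * z)"
    by (induction x rule: tensor_induct) (simp_all add: z dr p)
  show "(c *\<^sub>C x) * y = c *\<^sub>C (x * y)"
  proof (induction x rule: tensor_induct)
    case (pure a b)
    show ?case
      by (induction y rule: tensor_induct)
        (simp_all add: mpure spure sadd sz zr dl scaleC_mult_left)
  qed (simp_all add: z dr sz sadd)
  show "x * (c *\<^sub>C y) = c *\<^sub>C (x * y)"
  proof (induction x rule: tensor_induct)
    case (pure a b)
    show ?case
      by (induction y rule: tensor_induct)
        (simp_all add: mpure spure sadd sz zr dl scaleC_mult_right)
  qed (simp_all add: z dr sz sadd)
qed

end

lemma tensor_mult: "(a \<otimes> b) * (c \<otimes> d) = (a * c) \<otimes> (b * d)"
  by (simp add: times_tensor_def tensor_lift_pure bilinear_balanced_mult_pure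
      bilinear_balanced_mult_pure_left)

lemma tensor_scaleC_left: "(c *\<^sub>C a) \<otimes> b = c *\<^sub>C (a \<otimes> b)"
  by (simp add: scaleC_tensor_def tensor_lift_pure bilinear_balanced_scale)

lemma tensor_scaleC_right: "a \<otimes> (c *\<^sub>C b) = c *\<^sub>C (a \<otimes> b)"
  by (simp add: tensor_balanced[symmetric] tensor_scaleC_left)

lemma tensor_minus_left: "(- a) \<otimes> b = - (a \<otimes> b)"
  using tensor_add_left[of "- a" a b] by (simp add: eq_neg_iff_add_eq_0)

lemma tensor_minus_right: "a \<otimes> (- b) = - (a \<otimes> b)"
  using tensor_add_right[of a "- b" b] by (simp add: eq_neg_iff_add_eq_0)

lemma tensor_diff_left: "(a - a') \<otimes> b = a \<otimes> b - a' \<otimes> b"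
  using tensor_add_left[of a "- a'" b] by (simp add: tensor_minus_left)

lemma tensor_diff_right: "a \<otimes> (b - b') = a \<otimes> b - a \<otimes> b'"
  using tensor_add_right[of a b "- b'"] by (simp add: tensor_minus_right)

definition tensor_map ::
  "('a::complex_algebra \<Rightarrow> 'c::complex_algebra) \<Rightarrow> ('b::complex_algebra \<Rightarrow> 'd::complex_algebra) \<Rightarrow>
   'a \<otimes> 'b \<Rightarrow> 'c \<otimes> 'd" where
  "tensor_map f g = tensor_lift (\<lambda>a b. f a \<otimes> g b)"

definition tensor_flip :: "'a::complex_algebra \<otimes> 'b::complex_algebra \<Rightarrow> 'b \<otimes> 'a" where
  "tensor_flip = tensor_lift (\<lambda>a b. b \<otimes> a)"

(* Threefold tensor products are taken in the form A \<otimes> (B \<otimes> C). *)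
definition tensor_assoc ::
  "('a::complex_algebra \<otimes> 'b::complex_algebra) \<otimes> 'c::complex_algebra \<Rightarrow> 'a \<otimes> 'b \<otimes> 'c" where
  "tensor_assoc = tensor_lift (\<lambda>x c. tensor_lift (\<lambda>a b. a \<otimes> b \<otimes> c) x)"

lemma bilinear_balanced_map:
  "clinear f \<Longrightarrow> clinear g \<Longrightarrow> bilinear_balanced (\<lambda>a b. f a \<otimes> g b)"
  by (simp add: bilinear_balanced_def clinear_def tensor_add_left tensor_add_right tensor_balanced)

lemma tensor_map_pure: "clinear f \<Longrightarrow> clinear g \<Longrightarrow> tensor_map f g (a \<otimes> b) = f a \<otimes> g b"
  by (simp add: tensor_map_def tensor_lift_pure bilinear_balanced_map)

lemma tensor_map_add:
  "clinear f \<Longrightarrow> clinear g \<Longrightarrow> tensor_map f g (x + y) = tensor_map f g x + tensor_map f g y"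
  by (simp add: tensor_map_def tensor_lift_add bilinear_balanced_map)

lemma bilinear_balanced_flip: "bilinear_balanced (\<lambda>a b. b \<otimes> a)"
  by (simp add: bilinear_balanced_def tensor_add_left tensor_add_right tensor_balanced)

lemma tensor_flip_pure: "tensor_flip (a \<otimes> b) = b \<otimes> a"
  by (simp add: tensor_flip_def tensor_lift_pure bilinear_balanced_flip)

lemma tensor_flip_add: "tensor_flip (x + y) = tensor_flip x + tensor_flip y"
  by (simp add: tensor_flip_def tensor_lift_add bilinear_balanced_flip)

lemma bilinear_balanced_assoc_inner: "bilinear_balanced (\<lambda>a b. a \<otimes> b \<otimes> c)"
  by (simp add: bilinear_balanced_def tensor_add_left tensor_add_right tensor_scaleC_left
      tensor_scaleC_right)

lemma bilinear_balanced_assoc: "bilinear_balanced (\<lambda>x c. tensor_lift (\<lambda>a b. a \<otimes> b \<otimes> c) x)"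
proof -
  note l = tensor_lift_simps[OF bilinear_balanced_assoc_inner]
  have 1: "tensor_lift (\<lambda>a b. a \<otimes> b \<otimes> (c + c')) x =
      tensor_lift (\<lambda>a b. a \<otimes> b \<otimes> c) x + tensor_lift (\<lambda>a b. a \<otimes> b \<otimes> c') x" for x c c'
    by (simp add: tensor_add_right tensor_lift_fun_add)
  have 2: "tensor_lift (\<lambda>a b. a \<otimes> b \<otimes> c) (s *\<^sub>C x) = tensor_lift (\<lambda>a b. a \<otimes> b \<otimes> (s *\<^sub>C c)) x"
    for x s c
    by (induction x rule: tensor_induct)
      (simp_all add: l scaleC_add_right tensor_scaleC_left[symmetric], simp add: tensor_scaleC_left
        tensor_scaleC_right)
  show ?thesis by (simp add: bilinear_balanced_def l 1 2)
qed

lemma tensor_assoc_pure: "tensor_assoc ((a \<otimes> b) \<otimes> c) = a \<otimes> b \<otimes> c"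
  by (simp add: tensor_assoc_def tensor_lift_pure bilinear_balanced_assoc
      bilinear_balanced_assoc_inner)

lemma tensor_assoc_add: "tensor_assoc (x + y) = tensor_assoc x + tensor_assoc y"
  by (simp add: tensor_assoc_def tensor_lift_add bilinear_balanced_assoc)


section \<open>The algebra\<close>

(* Generators and relations: terms over the generators and the complex scalars, modulo the least
   congruence containing the laws of a unital associative complex algebra (first group) and the
   defining relations (second group).  The index type 'n plays the role of {1..N}, so that
   N = CARD('n); an empty index set is excluded automatically. *)
datatype 'n sf_term =
    TK | TFp 'n | TFm 'n | TScal complex
  | TSum "'n sf_term" "'n sf_term" | TProd "'n sf_term" "'n sf_term"

abbreviation TAnti :: "'n sf_term \<Rightarrow> 'n sf_term \<Rightarrow> 'n sf_term" where
  "TAnti x y \<equiv> TSum (TProd x y) (TProd y x)"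

inductive sf_eq :: "'n sf_term \<Rightarrow> 'n sf_term \<Rightarrow> bool" where
  s_refl: "sf_eq x x"
| s_sym: "sf_eq x y \<Longrightarrow> sf_eq y x"
| s_trans: "sf_eq x y \<Longrightarrow> sf_eq y z \<Longrightarrow> sf_eq x z"
| s_sum_cong: "sf_eq x x' \<Longrightarrow> sf_eq y y' \<Longrightarrow> sf_eq (TSum x y) (TSum x' y')"
| s_prod_cong: "sf_eq x x' \<Longrightarrow> sf_eq y y' \<Longrightarrow> sf_eq (TProd x y) (TProd x' y')"
| s_sum_assoc: "sf_eq (TSum (TSum x y) z) (TSum x (TSum y z))"
| s_sum_commute: "sf_eq (TSum x y) (TSum y x)"
| s_sum_zero: "sf_eq (TSum (TScal 0) x) x"
| s_sum_minus: "sf_eq (TSum (TProd (TScal (- 1)) x) x) (TScal 0)"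
| s_prod_assoc: "sf_eq (TProd (TProd x y) z) (TProd x (TProd y z))"
| s_prod_one: "sf_eq (TProd (TScal 1) x) x"
| s_distrib_right: "sf_eq (TProd (TSum x y) z) (TSum (TProd x z) (TProd y z))"
| s_distrib_left: "sf_eq (TProd x (TSum y z)) (TSum (TProd x y) (TProd x z))"
| s_scal_sum: "sf_eq (TScal (c + d)) (TSum (TScal c) (TScal d))"
| s_scal_prod: "sf_eq (TScal (c * d)) (TProd (TScal c) (TScal d))"
| s_scal_central: "sf_eq (TProd x (TScal c)) (TProd (TScal c) x)"

| s_anti_Fp_K: "sf_eq (TAnti (TFp i) TK) (TScal 0)"
| s_anti_Fm_K: "sf_eq (TAnti (TFm i) TK) (TScal 0)"
| s_anti_Fp_Fm: "sf_eq (TAnti (TFp i) (TFm i))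
    (TProd (TScal (1 / 2)) (TSum (TScal 1) (TProd (TScal (- 1)) (TProd TK TK))))"
| s_anti_Fp_Fm_distinct: "i \<noteq> j \<Longrightarrow> sf_eq (TAnti (TFp i) (TFm j)) (TScal 0)"
| s_anti_Fp_Fp: "sf_eq (TAnti (TFp i) (TFp j)) (TScal 0)"
| s_anti_Fm_Fm: "sf_eq (TAnti (TFm i) (TFm j)) (TScal 0)"
| s_K_power_4: "sf_eq (TProd TK (TProd TK (TProd TK TK))) (TScal 1)"

quotient_type 'n sf = "'n sf_term" / sf_eq
  by (rule equivpI) (auto intro!: reflpI sympI transpI intro: sf_eq.s_refl sf_eq.s_sym sf_eq.s_trans)

instantiation sf :: (type) complex_algebra
begin

lift_definition zero_sf :: "'a sf" is "TScal 0" .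
lift_definition one_sf :: "'a sf" is "TScal 1" .
lift_definition plus_sf :: "'a sf \<Rightarrow> 'a sf \<Rightarrow> 'a sf" is TSum by (rule sf_eq.s_sum_cong)
lift_definition times_sf :: "'a sf \<Rightarrow> 'a sf \<Rightarrow> 'a sf" is TProd by (rule sf_eq.s_prod_cong)
lift_definition scaleC_sf :: "complex \<Rightarrow> 'a sf \<Rightarrow> 'a sf" is "\<lambda>c. TProd (TScal c)"
  by (rule sf_eq.s_prod_cong[OF sf_eq.s_refl])
lift_definition uminus_sf :: "'a sf \<Rightarrow> 'a sf" is "TProd (TScal (- 1))"
  by (rule sf_eq.s_prod_cong[OF sf_eq.s_refl])
definition minus_sf :: "'a sf \<Rightarrow> 'a sf \<Rightarrow> 'a sf" where "minus_sf x y = x + (- y)"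

instance
proof
  fix x y z :: "'a sf" and c d :: complex
  show "x + y + z = x + (y + z)" by transfer (rule sf_eq.s_sum_assoc)
  show "x + y = y + x" by transfer (rule sf_eq.s_sum_commute)
  show "0 + x = x" by transfer (rule sf_eq.s_sum_zero)
  show "- x + x = 0" by transfer (rule sf_eq.s_sum_minus)
  show "x - y = x + - y" by (rule minus_sf_def)
  show "x * y * z = x * (y * z)" by transfer (rule sf_eq.s_prod_assoc)
  show "1 * x = x" by transfer (rule sf_eq.s_prod_one)
  show "x * 1 = x" by transfer (rule sf_eq.s_trans[OF sf_eq.s_scal_central sf_eq.s_prod_one])
  show "(x + y) * z = x * z + y * z" by transfer (rule sf_eq.s_distrib_right)
  show "x * (y + z) = x * y + x * z" by transfer (rule sf_eq.s_distrib_left)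
  show "c *\<^sub>C (x + y) = c *\<^sub>C x + c *\<^sub>C y" by transfer (rule sf_eq.s_distrib_left)
  show "(c + d) *\<^sub>C x = c *\<^sub>C x + d *\<^sub>C x"
    by transfer (meson sf_eq.s_prod_cong sf_eq.s_refl sf_eq.s_trans sf_eq.s_scal_sum sf_eq.s_distrib_right)
  show "c *\<^sub>C d *\<^sub>C x = (c * d) *\<^sub>C x"
    by transfer (meson sf_eq.s_prod_cong sf_eq.s_refl sf_eq.s_sym sf_eq.s_trans sf_eq.s_scal_prod
        sf_eq.s_prod_assoc)
  show "1 *\<^sub>C x = x" by transfer (rule sf_eq.s_prod_one)
  show "(c *\<^sub>C x) * y = c *\<^sub>C (x * y)" by transfer (rule sf_eq.s_prod_assoc)
  show "x * (c *\<^sub>C y) = c *\<^sub>C (x * y)"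
    by transfer (meson sf_eq.s_prod_cong sf_eq.s_refl sf_eq.s_sym sf_eq.s_trans sf_eq.s_scal_central
        sf_eq.s_prod_assoc)
qed

end

lift_definition K :: "'n sf" is TK .
lift_definition fp :: "'n \<Rightarrow> 'n sf" is TFp .
lift_definition fm :: "'n \<Rightarrow> 'n sf" is TFm .

definition anticomm :: "'a::complex_algebra \<Rightarrow> 'a \<Rightarrow> 'a" where
  "anticomm x y = x * y + y * x"

definition sf_rel ::
  "'a::complex_algebra \<Rightarrow> ('n \<Rightarrow> 'a) \<Rightarrow> ('n \<Rightarrow> 'a) \<Rightarrow> bool" where
  "sf_rel k p m \<longleftrightarrow>
     (\<forall>i. anticomm (p i) k = 0) \<and> (\<forall>i. anticomm (m i) k = 0) \<and>
     (\<forall>i j. anticomm (p i) (m j) = (if i = j then (1 / 2) *\<^sub>C (1 - k\<^sup>2) else 0)) \<and>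
     (\<forall>i j. anticomm (p i) (p j) = 0) \<and> (\<forall>i j. anticomm (m i) (m j) = 0) \<and> k ^ 4 = 1"

lemma sf_rel_generators: "sf_rel K fp fm"
proof -
  have e: "(1 / 2) *\<^sub>C (1 - K\<^sup>2) = (1 / 2) *\<^sub>C (1 + (- 1) *\<^sub>C (K * K :: 'n sf))"
    by (simp add: power2_eq_square scaleC_minus_left scaleC_one)
  have 1: "anticomm (fp i) K = 0" for i :: 'n
    unfolding anticomm_def by transfer (rule sf_eq.s_anti_Fp_K)
  have 2: "anticomm (fm i) K = 0" for i :: 'n
    unfolding anticomm_def by transfer (rule sf_eq.s_anti_Fm_K)
  have 3: "anticomm (fp i) (fm i) = (1 / 2) *\<^sub>C (1 - K\<^sup>2)" for i :: 'n
    unfolding anticomm_def e by transfer (rule sf_eq.s_anti_Fp_Fm)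
  have 4: "i \<noteq> j \<Longrightarrow> anticomm (fp i) (fm j) = 0" for i j :: 'n
    unfolding anticomm_def by transfer (rule sf_eq.s_anti_Fp_Fm_distinct)
  have 5: "anticomm (fp i) (fp j) = 0" for i j :: 'n
    unfolding anticomm_def by transfer (rule sf_eq.s_anti_Fp_Fp)
  have 6: "anticomm (fm i) (fm j) = 0" for i j :: 'n
    unfolding anticomm_def by transfer (rule sf_eq.s_anti_Fm_Fm)
  have "K * (K * (K * K)) = (1 :: 'n sf)"
    by transfer (rule sf_eq.s_K_power_4)
  then have 7: "K ^ 4 = (1 :: 'n sf)"
    by (simp add: eval_nat_numeral mult.assoc)
  show ?thesis unfolding sf_rel_def using 1 2 3 4 5 6 7 by auto
qed

primrec sf_eval ::
  "'a::complex_algebra \<Rightarrow> ('n \<Rightarrow> 'a) \<Rightarrow> ('n \<Rightarrow> 'a) \<Rightarrow> 'n sf_term \<Rightarrow> 'a" where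
  "sf_eval k p m TK = k"
| "sf_eval k p m (TFp i) = p i"
| "sf_eval k p m (TFm i) = m i"
| "sf_eval k p m (TScal c) = c *\<^sub>C 1"
| "sf_eval k p m (TSum x y) = sf_eval k p m x + sf_eval k p m y"
| "sf_eval k p m (TProd x y) = sf_eval k p m x * sf_eval k p m y"

(* The algebra map with prescribed values on the generators; it is one by alg_hom_sf_lift
   whenever these values satisfy the relations. *)
definition sf_lift ::
  "'a::complex_algebra \<Rightarrow> ('n \<Rightarrow> 'a) \<Rightarrow> ('n \<Rightarrow> 'a) \<Rightarrow> 'n sf \<Rightarrow> 'a" where
  "sf_lift k p m x = sf_eval k p m (rep_sf x)"

lemma sf_eval_cong:
  assumes "sf_rel k p m" "sf_eq x y"
  shows "sf_eval k p m x = sf_eval k p m y"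
  using assms(2)
proof (induction rule: sf_eq.induct)
  case (s_anti_Fp_Fm i)
  show ?case
    using assms(1) by (simp add: sf_rel_def anticomm_def power2_eq_square scaleC_minus_left
        scaleC_one scaleC_mult_left)
next
  case s_K_power_4
  show ?case
    using assms(1) by (simp add: sf_rel_def eval_nat_numeral mult.assoc scaleC_one)
qed (use assms(1) in \<open>simp_all add: sf_rel_def anticomm_def add_ac mult.assoc ring_distribs
    scaleC_one scaleC_add_left scaleC_minus_left scaleC_mult_left scaleC_mult_right scaleC_scaleC
    mult.commute[of c d for c d :: complex]\<close>)

lemma sf_lift_abs: "sf_rel k p m \<Longrightarrow> sf_lift k p m (abs_sf x) = sf_eval k p m x"
  unfolding sf_lift_def
  by (rule sf_eval_cong) (simp_all add: Quotient3_rep_abs[OF Quotient3_sf] sf_eq.s_refl)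

lemma sf_lift_generators:
  assumes "sf_rel k p m"
  shows "sf_lift k p m K = k" "sf_lift k p m (fp i) = p i" "sf_lift k p m (fm i) = m i"
  using assms by (simp_all add: K_def fp.abs_eq fm.abs_eq sf_lift_abs)

lemma alg_hom_sf_lift:
  assumes "sf_rel k p m"
  shows "alg_hom (sf_lift k p m)"
proof -
  have ex: "\<exists>t. x = abs_sf t" for x :: "'b sf"
    by (metis Quotient_abs_rep[OF Quotient_sf])
  have 1: "sf_lift k p m (x + y) = sf_lift k p m x + sf_lift k p m y" for x y
    using ex[of x] ex[of y] assms by (auto simp: plus_sf.abs_eq sf_lift_abs)
  have 2: "sf_lift k p m (x * y) = sf_lift k p m x * sf_lift k p m y" for x y
    using ex[of x] ex[of y] assms by (auto simp: times_sf.abs_eq sf_lift_abs)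
  have 3: "sf_lift k p m (c *\<^sub>C x) = c *\<^sub>C sf_lift k p m x" for c x
    using ex[of x] assms by (auto simp: scaleC_sf.abs_eq sf_lift_abs scaleC_mult_left)
  have 4: "sf_lift k p m 1 = 1"
    using assms by (simp add: one_sf_def sf_lift_abs scaleC_one)
  show ?thesis by (simp add: alg_hom_def clinear_def 1 2 3 4)
qed

(* Only the two idempotents e 0 and e 1 are used. *)
definition e :: "nat \<Rightarrow> 'n sf" where
  "e n = (1 / 2) *\<^sub>C (1 + (- 1) ^ n *\<^sub>C K\<^sup>2)"

definition omega_p :: "'n sf" where "omega_p = (e 0 + \<i> *\<^sub>C e 1) * K"
definition omega_m :: "'n sf" where "omega_m = (e 0 - \<i> *\<^sub>C e 1) * K"

abbreviation Kinv :: "'n sf" where "Kinv \<equiv> K ^ 3"  (* K^4 = 1 *)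

definition counit :: "'n sf \<Rightarrow> complex" where
  "counit = sf_lift 1 (\<lambda>_. 0) (\<lambda>_. 0)"


section \<open>The coproducts\<close>

definition Delta_K :: "'n sf \<otimes> 'n sf" where
  "Delta_K = K \<otimes> K - (1 + (- 1) ^ CARD('n)) *\<^sub>C ((e 1 \<otimes> e 1) * (K \<otimes> K))"

definition Delta_fp :: "'n \<Rightarrow> 'n sf \<otimes> 'n sf" where
  "Delta_fp i = fp i \<otimes> 1 + omega_p \<otimes> fp i"

definition Delta_fm :: "'n \<Rightarrow> 'n sf \<otimes> 'n sf" where
  "Delta_fm i = fm i \<otimes> 1 + omega_m \<otimes> fm i"

definition Delta_hat_fp :: "'n \<Rightarrow> 'n sf \<otimes> 'n sf" where
  "Delta_hat_fp i =
     fp i \<otimes> 1 + Kinv \<otimes> fp i - (1 + (- 1) ^ CARD('n)) *\<^sub>C ((e 1 \<otimes> e 1) * (Kinv \<otimes> fp i))"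

definition Delta_hat_fm :: "'n \<Rightarrow> 'n sf \<otimes> 'n sf" where
  "Delta_hat_fm i =
     fm i \<otimes> 1 + Kinv \<otimes> fm i - (1 + (- 1) ^ CARD('n)) *\<^sub>C ((e 1 \<otimes> e 1) * (Kinv \<otimes> fm i))"

definition Delta :: "'n sf \<Rightarrow> 'n sf \<otimes> 'n sf" where
  "Delta = sf_lift Delta_K Delta_fp Delta_fm"

definition Delta_hat :: "'n sf \<Rightarrow> 'n sf \<otimes> 'n sf" where
  "Delta_hat = sf_lift Delta_K Delta_hat_fp Delta_hat_fm"


lemma sf_rules:
  "fp i * K = - (K * fp i)" "fm i * K = - (K * fm i)"
  "fp i * fp j + fp j * fp i = 0" "fm i * fm j + fm j * fm i = 0"
  "fp i * fm j + fm j * fp i = (if i = j then e 1 else 0)" "K ^ 4 = (1 :: 'n sf)"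
  for i j :: 'n
proof -
  have "sf_rel K fp (fm :: 'n \<Rightarrow> 'n sf)" by (rule sf_rel_generators)
  then show "fp i * K = - (K * fp i)" "fm i * K = - (K * fm i)"
    "fp i * fp j + fp j * fp i = 0" "fm i * fm j + fm j * fm i = 0"
    "fp i * fm j + fm j * fp i = (if i = j then e 1 else 0)" "K ^ 4 = (1 :: 'n sf)"
    by (simp_all add: sf_rel_def anticomm_def e_def eq_neg_iff_add_eq_0 scaleC_minus_left scaleC_one)
qed

lemma sf_K2: "fp i * K\<^sup>2 = K\<^sup>2 * fp i" "fm i * K\<^sup>2 = K\<^sup>2 * fm i"
  by (simp_all add: power2_eq_square mult.assoc[symmetric] sf_rules(1,2))
    (simp_all add: mult.assoc sf_rules(1,2))

lemma sf_K2_K2: "K\<^sup>2 * K\<^sup>2 = (1 :: 'n sf)"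
  using sf_rules(6) by (simp add: power_add[symmetric])

lemma sf_e_comm:
  "fp i * e n = e n * fp i" "fm i * e n = e n * fm i" "K * e n = e n * (K :: 'n sf)"
  by (simp_all add: e_def ring_distribs scaleC_mult_left scaleC_mult_right sf_K2)
    (simp add: power2_eq_square mult.assoc)

lemma sf_e1_idem: "e 1 * e 1 = (e 1 :: 'n sf)"
proof -
  have "(1 - K\<^sup>2) * (1 - K\<^sup>2) = 2 *\<^sub>C (1 - K\<^sup>2 :: 'n sf)"
    using scaleC_add_left[of 1 1 "1 - K\<^sup>2 :: 'n sf"]
    by (simp add: ring_distribs sf_K2_K2 scaleC_one sf_rules(6))
  then show ?thesis
    by (simp add: e_def scaleC_mult_left scaleC_mult_right scaleC_scaleC scaleC_minus_left scaleC_one)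
qed

lemma tensor_e1_involution:
  assumes "s = 0 \<or> s = 2"
  shows "(1 - s *\<^sub>C (e 1 \<otimes> e 1)) * (1 - s *\<^sub>C (e 1 \<otimes> e 1)) = (1 :: 'n sf \<otimes> 'n sf)"
  using assms
proof
  assume s: "s = 2"
  show ?thesis
    using scaleC_add_left[of 2 2 "e 1 \<otimes> e 1 :: 'n sf \<otimes> 'n sf"]
    by (simp add: s ring_distribs scaleC_mult_left scaleC_mult_right scaleC_scaleC scaleC_diff_right
        tensor_mult sf_e1_idem del: One_nat_def)
qed simp

(* The relations of the coproducts, uniformly: u = 1 for Delta and, for Delta_hat,
   u = 1 - (1 + (-1)^N) e 1 \<otimes> e 1. *)
lemma anticomm_coproduct:
  fixes f g w v :: "'a::complex_algebra"
  assumes "f * v = - (v * f)" "g * w = - (w * g)" "w * v = v * w" "u * u = 1"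
    and "u * (f \<otimes> 1) = (f \<otimes> 1) * u" "u * (g \<otimes> 1) = (g \<otimes> 1) * u"
    and "u * (w \<otimes> f) = (w \<otimes> f) * u" "u * (v \<otimes> g) = (v \<otimes> g) * u"
  shows "anticomm (f \<otimes> 1 + u * (w \<otimes> f)) (g \<otimes> 1 + u * (v \<otimes> g)) =
    anticomm f g \<otimes> 1 + (w * v) \<otimes> anticomm f g"
proof -
  have u: "u * x * (u * y) = x * y" if "u * x = x * u" for x y
    by (metis that assms(4) mult.assoc mult_1_right)
  have 1: "(f \<otimes> 1) * (u * (v \<otimes> g)) + u * (v \<otimes> g) * (f \<otimes> 1) = 0"
  proof -
    have "(f \<otimes> 1) * (u * (v \<otimes> g)) = u * ((f \<otimes> 1) * (v \<otimes> g))"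
      by (metis assms(5) mult.assoc)
    then show ?thesis
      by (simp add: mult.assoc tensor_mult assms(1) tensor_minus_left)
  qed
  have 2: "u * (w \<otimes> f) * (g \<otimes> 1) + (g \<otimes> 1) * (u * (w \<otimes> f)) = 0"
  proof -
    have "(g \<otimes> 1) * (u * (w \<otimes> f)) = u * ((g \<otimes> 1) * (w \<otimes> f))"
      by (metis assms(6) mult.assoc)
    then show ?thesis
      by (simp add: mult.assoc tensor_mult assms(2) tensor_minus_left)
  qed
  have "anticomm (f \<otimes> 1 + u * (w \<otimes> f)) (g \<otimes> 1 + u * (v \<otimes> g)) =
    (f \<otimes> 1) * (g \<otimes> 1) + (g \<otimes> 1) * (f \<otimes> 1) +
    ((f \<otimes> 1) * (u * (v \<otimes> g)) + u * (v \<otimes> g) * (f \<otimes> 1)) +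
    (u * (w \<otimes> f) * (g \<otimes> 1) + (g \<otimes> 1) * (u * (w \<otimes> f))) +
    (u * (w \<otimes> f) * (u * (v \<otimes> g)) + u * (v \<otimes> g) * (u * (w \<otimes> f)))"
    by (simp add: anticomm_def ring_distribs add_ac)
  also have "\<dots> = anticomm f g \<otimes> 1 + (w * v) \<otimes> anticomm f g"
    unfolding 1 2 u[OF assms(7)] u[OF assms(8)]
    by (simp add: tensor_mult anticomm_def tensor_add_left tensor_add_right assms(3))
  finally show ?thesis .
qed

lemma anticomm_coproduct_K:
  fixes f w k :: "'a::complex_algebra"
  assumes "f * k = - (k * f)" "w * k = k * w"
    and "u * (f \<otimes> 1) = (f \<otimes> 1) * u" "u * (u' * (w \<otimes> f)) = u' * (w \<otimes> f) * u"
    and "u' * (k \<otimes> k) = (k \<otimes> k) * u'"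
  shows "anticomm (f \<otimes> 1 + u' * (w \<otimes> f)) (u * (k \<otimes> k)) = 0"
proof -
  let ?x = "f \<otimes> 1 + u' * (w \<otimes> f)"
  have "?x * u = u * ?x"
    using assms(3,4) by (simp add: ring_distribs)
  then have 1: "?x * (u * (k \<otimes> k)) = u * (?x * (k \<otimes> k))"
    by (simp only: mult.assoc[symmetric])
  have "(k \<otimes> k) * (u' * (w \<otimes> f)) = u' * ((k \<otimes> k) * (w \<otimes> f))"
    by (simp only: assms(5) mult.assoc[symmetric])
  then have 2: "?x * (k \<otimes> k) = - ((k \<otimes> k) * ?x)"
    by (simp add: ring_distribs mult.assoc tensor_mult assms(1,2) tensor_minus_left
        tensor_minus_right)
  show ?thesis
    unfolding anticomm_def 1 2 by (simp add: mult.assoc)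
qed

lemma coproduct_rel:
  fixes wp wm :: "'n sf" and s t :: complex
  defines "u \<equiv> \<lambda>s. 1 - s *\<^sub>C (e 1 \<otimes> e 1) :: 'n sf \<otimes> 'n sf"
  assumes st: "s = 0 \<or> s = 2" "t = 0 \<or> t = 2"
    and w: "wp * e 1 = e 1 * wp" "wm * e 1 = e 1 * wm" "wp * K = K * wp" "wm * K = K * wm"
      "\<And>i. fp i * wp = - (wp * fp i)" "\<And>i. fm i * wp = - (wp * fm i)"
      "\<And>i. fp i * wm = - (wm * fp i)" "\<And>i. fm i * wm = - (wm * fm i)"
      "wp * wm = K\<^sup>2" "wm * wp = K\<^sup>2"
  shows "sf_rel (u s * (K \<otimes> K)) (\<lambda>i. fp i \<otimes> 1 + u t * (wp \<otimes> fp i))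
    (\<lambda>i. fm i \<otimes> 1 + u t * (wm \<otimes> fm i))"
proof -
  have u: "u r * (a \<otimes> b) = (a \<otimes> b) * u r" if "a * e 1 = e 1 * a" "b * e 1 = e 1 * b" for a b r
    using that by (simp add: u_def ring_distribs scaleC_mult_left scaleC_mult_right tensor_mult)
  have uu: "u r * u r' = u r' * u r" for r r'
    by (simp add: u_def ring_distribs scaleC_mult_left scaleC_mult_right scaleC_scaleC
        scaleC_diff_right mult.commute[of r r'] diff_diff_eq2 add_ac diff_diff_eq)
  have uu1: "u r * (u r' * (a \<otimes> b)) = u r' * (a \<otimes> b) * u r"
    if "a * e 1 = e 1 * a" "b * e 1 = e 1 * b" for a b r r'
    using u[OF that, of r] uu[of r r'] mult.assoc by metis
  have inv: "u s * u s = 1" "u t * u t = 1"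
    using st unfolding u_def by (simp_all only: tensor_e1_involution)
  note c = sf_e_comm w
  have sq: "(u s * (K \<otimes> K))\<^sup>2 = K\<^sup>2 \<otimes> K\<^sup>2"
  proof -
    have "(u s * (K \<otimes> K))\<^sup>2 = u s * ((K \<otimes> K) * u s) * (K \<otimes> K)"
      by (simp add: power2_eq_square mult.assoc)
    also have "\<dots> = u s * u s * ((K \<otimes> K) * (K \<otimes> K))"
      by (simp only: u[OF sf_e_comm(3) sf_e_comm(3), symmetric] mult.assoc)
    finally show ?thesis by (simp add: inv tensor_mult power2_eq_square)
  qed
  have "(u s * (K \<otimes> K)) ^ 4 = (u s * (K \<otimes> K))\<^sup>2 * (u s * (K \<otimes> K))\<^sup>2"
    by (simp only: power_add[symmetric]) simp
  then have K4: "(u s * (K \<otimes> K)) ^ 4 = 1"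
    by (simp only: sq tensor_mult sf_K2_K2 one_tensor_def)
  have e1: "e 1 \<otimes> 1 + K\<^sup>2 \<otimes> e 1 = (1 / 2) *\<^sub>C (1 - (u s * (K \<otimes> K))\<^sup>2)"
    unfolding sq
    by (simp add: e_def scaleC_minus_left scaleC_one tensor_scaleC_left tensor_scaleC_right
        one_tensor_def tensor_diff_left tensor_diff_right scaleC_diff_right)
  have a: "anticomm (fp i) (fp j) = 0" "anticomm (fm i) (fm j) = 0"
    "anticomm (fp i) (fm j) = (if i = j then e 1 else 0)" for i j :: 'n
    by (simp_all only: anticomm_def sf_rules)
  have pp: "anticomm (fp i \<otimes> 1 + u t * (wp \<otimes> fp i)) (fp j \<otimes> 1 + u t * (wp \<otimes> fp j)) = 0" for i j
    by (rule trans[OF anticomm_coproduct])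
      (simp_all only: c u inv a mult_1_left mult_1_right tensor_zero_left tensor_zero_right add_0)
  have mm: "anticomm (fm i \<otimes> 1 + u t * (wm \<otimes> fm i)) (fm j \<otimes> 1 + u t * (wm \<otimes> fm j)) = 0" for i j
    by (rule trans[OF anticomm_coproduct])
      (simp_all only: c u inv a mult_1_left mult_1_right tensor_zero_left tensor_zero_right add_0)
  have pm: "anticomm (fp i \<otimes> 1 + u t * (wp \<otimes> fp i)) (fm j \<otimes> 1 + u t * (wm \<otimes> fm j)) =
      (if i = j then e 1 \<otimes> 1 + K\<^sup>2 \<otimes> e 1 else 0)" for i j
    by (rule trans[OF anticomm_coproduct])
      (simp_all only: c u inv a mult_1_left mult_1_right tensor_zero_left tensor_zero_right add_0
        if_False if_True split: if_split, simp_all)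
  have pk: "anticomm (fp i \<otimes> 1 + u t * (wp \<otimes> fp i)) (u s * (K \<otimes> K)) = 0" for i
    by (rule anticomm_coproduct_K[OF _ _ _ uu1])
      (simp_all only: c u sf_rules mult_1_left mult_1_right)
  have mk: "anticomm (fm i \<otimes> 1 + u t * (wm \<otimes> fm i)) (u s * (K \<otimes> K)) = 0" for i
    by (rule anticomm_coproduct_K[OF _ _ _ uu1])
      (simp_all only: c u sf_rules mult_1_left mult_1_right)
  show ?thesis
    unfolding sf_rel_def using pp mm pm[unfolded e1] pk mk K4 by blast
qed

lemma sf_e0: "e 0 = (1 - e 1 :: 'n sf)"
proof -
  have "(1 / 2) *\<^sub>C 1 + (1 / 2) *\<^sub>C 1 = (1 :: 'n sf)"
    by (simp add: scaleC_one flip: scaleC_add_left)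
  then show ?thesis
    by (simp add: e_def scaleC_minus_left scaleC_one scaleC_add_right scaleC_diff_right eq_diff_eq)
qed

lemma omega_alt:
  "omega_p = (1 - (1 - \<i>) *\<^sub>C e 1) * (K :: 'n sf)" "omega_m = (1 - (1 + \<i>) *\<^sub>C e 1) * (K :: 'n sf)"
  by (simp_all add: omega_p_def omega_m_def sf_e0 scaleC_diff_left scaleC_add_left scaleC_one
      algebra_simps)

lemma omega_mult: "omega_p * omega_m = (K\<^sup>2 :: 'n sf)" "omega_m * omega_p = (K\<^sup>2 :: 'n sf)"
proof -
  have *: "(1 - c *\<^sub>C e 1) * K * ((1 - d *\<^sub>C e 1) * K) = (K\<^sup>2 :: 'n sf)" if cd: "c * d = c + d" for c d
  proof -
    have "(1 - c *\<^sub>C e 1) * K * ((1 - d *\<^sub>C e 1) * K) =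
        (1 - c *\<^sub>C e 1) * (K * (1 - d *\<^sub>C e 1)) * (K :: 'n sf)"
      by (simp only: mult.assoc)
    also have "K * (1 - d *\<^sub>C e 1) = (1 - d *\<^sub>C e 1) * (K :: 'n sf)"
      by (simp add: ring_distribs scaleC_mult_left scaleC_mult_right sf_e_comm)
    also have "(1 - c *\<^sub>C e 1) * ((1 - d *\<^sub>C e 1) * K) * K =
        ((1 - c *\<^sub>C e 1) * (1 - d *\<^sub>C e 1)) * (K\<^sup>2 :: 'n sf)"
      by (simp only: mult.assoc power2_eq_square)
    also have "(1 - c *\<^sub>C e 1) * (1 - d *\<^sub>C e 1) = (1 - c *\<^sub>C e 1 - d *\<^sub>C e 1 + (c * d) *\<^sub>C e 1 :: 'n sf)"
      by (simp only: ring_distribs scaleC_mult_left scaleC_mult_right scaleC_scaleC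
          scaleC_diff_right sf_e1_idem mult_1_left mult_1_right) (simp add: mult.commute[of d c])
    also have "\<dots> = 1"
      by (simp add: cd scaleC_add_left)
    finally show ?thesis by simp
  qed
  show "omega_p * omega_m = (K\<^sup>2 :: 'n sf)" "omega_m * omega_p = (K\<^sup>2 :: 'n sf)"
    unfolding omega_alt by (rule *, simp add: algebra_simps)+
qed

lemma omega_comm:
  "omega_p * e 1 = e 1 * (omega_p :: 'n sf)" "omega_m * e 1 = e 1 * (omega_m :: 'n sf)"
  "omega_p * K = K * (omega_p :: 'n sf)" "omega_m * K = K * (omega_m :: 'n sf)"
  "fp i * omega_p = - (omega_p * fp i)" "fm i * omega_p = - (omega_p * fm i)"
  "fp i * omega_m = - (omega_m * fp i)" "fm i * omega_m = - (omega_m * fm i)"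
  for i :: 'n
proof -
  have KK: "K * (e n * x) = e n * (K * x)" for n and x :: "'n sf"
    by (simp only: sf_e_comm mult.assoc[symmetric])
  have F: "fp i * (e n * x) = e n * (fp i * x)" "fm i * (e n * x) = e n * (fm i * x)"
    for n and x :: "'n sf"
    by (simp_all only: sf_e_comm mult.assoc[symmetric])
  show "omega_p * e 1 = e 1 * (omega_p :: 'n sf)" "omega_m * e 1 = e 1 * (omega_m :: 'n sf)"
    "omega_p * K = K * (omega_p :: 'n sf)" "omega_m * K = K * (omega_m :: 'n sf)"
    "fp i * omega_p = - (omega_p * fp i)" "fm i * omega_p = - (omega_p * fm i)"
    "fp i * omega_m = - (omega_m * fp i)" "fm i * omega_m = - (omega_m * fm i)"
    by (simp_all add: omega_alt ring_distribs mult.assoc scaleC_mult_left scaleC_mult_right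
        sf_e_comm KK F sf_rules(1,2) scaleC_minus_right del: One_nat_def)
qed

lemma Kinv_comm:
  "Kinv * e 1 = e 1 * (Kinv :: 'n sf)" "Kinv * K = K * (Kinv :: 'n sf)"
  "fp i * Kinv = - (Kinv * fp i)" "fm i * Kinv = - (Kinv * fm i)" "Kinv * Kinv = (K\<^sup>2 :: 'n sf)"
  for i :: 'n
proof -
  have 3: "Kinv = K\<^sup>2 * (K :: 'n sf)" by (simp add: eval_nat_numeral mult.assoc)
  have "(K\<^sup>2 * K) * (K\<^sup>2 * K) = K\<^sup>2 * (K\<^sup>2 * (K\<^sup>2 :: 'n sf))"
    by (simp add: power2_eq_square mult.assoc)
  then show "Kinv * Kinv = (K\<^sup>2 :: 'n sf)" by (simp only: 3 sf_K2_K2 mult_1_right)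
  show "Kinv * K = K * (Kinv :: 'n sf)" by (rule power_commutes)
  have "K * (K * (K * e 1)) = e 1 * (K * (K * (K :: 'n sf)))"
    by (metis sf_e_comm(3) mult.assoc)
  then show "Kinv * e 1 = e 1 * (Kinv :: 'n sf)"
    by (simp add: eval_nat_numeral mult.assoc)
  show "fp i * Kinv = - (Kinv * fp i)" "fm i * Kinv = - (Kinv * fm i)"
    by (simp_all add: 3 mult.assoc[symmetric] sf_K2) (simp_all add: mult.assoc sf_rules(1,2))
qed

lemma one_plus_sign: "1 + (- 1) ^ n = (0 :: complex) \<or> 1 + (- 1) ^ n = (2 :: complex)"
  by (cases "even n") auto

lemma sf_rel_Delta: "sf_rel Delta_K Delta_fp Delta_fm"
  using coproduct_rel[OF one_plus_sign[of "CARD('n)"] disjI1[OF refl] omega_comm omega_mult]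
  by (simp add: Delta_K_def[abs_def] Delta_fp_def[abs_def] Delta_fm_def[abs_def] left_diff_distrib
      scaleC_mult_left)

lemma sf_rel_Delta_hat: "sf_rel Delta_K Delta_hat_fp Delta_hat_fm"
  using coproduct_rel[OF one_plus_sign[of "CARD('n)"] one_plus_sign[of "CARD('n)"]
      Kinv_comm(1,1,2,2,3,4,3,4,5,5)]
  by (simp add: Delta_K_def[abs_def] Delta_hat_fp_def[abs_def] Delta_hat_fm_def[abs_def]
      left_diff_distrib scaleC_mult_left add_diff_eq)

lemma sf_rel_counit: "sf_rel (1 :: complex) (\<lambda>_. 0) (\<lambda>_. 0)"
  by (simp add: sf_rel_def anticomm_def)

lemma alg_hom_Delta: "alg_hom Delta"
  unfolding Delta_def by (rule alg_hom_sf_lift[OF sf_rel_Delta])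

lemma Delta_generators:
  "Delta K = Delta_K" "Delta (fp i) = Delta_fp i" "Delta (fm i) = Delta_fm i"
  unfolding Delta_def by (rule sf_lift_generators[OF sf_rel_Delta])+

lemma alg_hom_Delta_hat: "alg_hom Delta_hat"
  unfolding Delta_hat_def by (rule alg_hom_sf_lift[OF sf_rel_Delta_hat])

lemma Delta_hat_generators:
  "Delta_hat K = Delta_K" "Delta_hat (fp i) = Delta_hat_fp i" "Delta_hat (fm i) = Delta_hat_fm i"
  unfolding Delta_hat_def by (rule sf_lift_generators[OF sf_rel_Delta_hat])+

lemma alg_hom_counit: "alg_hom counit"
  unfolding counit_def by (rule alg_hom_sf_lift[OF sf_rel_counit])

lemma counit_generators: "counit K = 1" "counit (fp i) = 0" "counit (fm i) = 0"
  unfolding counit_def by (rule sf_lift_generators[OF sf_rel_counit])+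

lemma sf_nontrivial: "(0 :: 'n sf) \<noteq> 1"
proof
  assume "(0 :: 'n sf) = 1"
  moreover have "counit (0 :: 'n sf) = 0"
    using alg_homD(1)[OF alg_hom_counit, of "0 :: 'n sf" 0] by simp
  ultimately show False
    using alg_homD(3)[OF alg_hom_counit] by (metis zero_neq_one)
qed


section \<open>Coassociators and R-matrices\<close>

(* Product over the index set in increasing order, i.e. over k = 1, ..., N. *)
definition oprod :: "('n::{finite,linorder} \<Rightarrow> 'a::monoid_mult) \<Rightarrow> 'a" where
  "oprod g = prod_list (map g (sorted_list_of_set UNIV))"

definition Phi :: "complex \<Rightarrow> 'n sf \<otimes> 'n sf \<otimes> 'n sf" where
  "Phi \<beta> = 1 + e 1 \<otimes> e 1 \<otimes>
     ((K ^ CARD('n) - 1) * e 0 + (\<beta>\<^sup>2 *\<^sub>C (\<i> *\<^sub>C K) ^ CARD('n) - 1) * e 1)"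

definition rho :: "nat \<Rightarrow> nat \<Rightarrow> 'n sf \<otimes> 'n sf" where
  "rho n m = (1 / 2) *\<^sub>C (\<Sum>p\<in>{0,1}. \<Sum>q\<in>{0,1}.
     ((- 1) ^ (p * q) * \<i> powi (int q * int m - int p * int n)) *\<^sub>C (K ^ p \<otimes> K ^ q))"

definition R_mat :: "complex \<Rightarrow> 'n::{finite,linorder} sf \<otimes> 'n sf" where
  "R_mat \<beta> =
     (\<Sum>n\<in>{0,1}. \<Sum>m\<in>{0,1}. \<beta> ^ (n * m) *\<^sub>C (rho n m * (e n \<otimes> e m))) *
     oprod (\<lambda>k. 1 - 2 *\<^sub>C (fm k * omega_m \<otimes> fp k))"

definition Phi_hat_010 :: "'n::{finite,linorder} sf \<otimes> 'n sf \<otimes> 'n sf" where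
  "Phi_hat_010 = oprod (\<lambda>k.
     (1 + (1 + \<i>) *\<^sub>C (fp k * K \<otimes> K \<otimes> fm k)) *
     (1 + (1 - \<i>) *\<^sub>C (fm k * K \<otimes> K \<otimes> fp k)))"

definition Phi_hat_101 :: "'n::{finite,linorder} sf \<otimes> 'n sf \<otimes> 'n sf" where
  "Phi_hat_101 =
     ((- K) ^ (CARD('n) - 1) \<otimes> K ^ (CARD('n) - 1) \<otimes> 1) *
     oprod (\<lambda>k.
       (1 + (1 + \<i>) *\<^sub>C (1 \<otimes> fp k * K \<otimes> fm k) + (1 - \<i>) *\<^sub>C (fm k * K \<otimes> fp k \<otimes> 1)) *
       (1 + (1 + \<i>) *\<^sub>C (fp k * K \<otimes> fm k \<otimes> 1) + (1 - \<i>) *\<^sub>C (1 \<otimes> fm k * K \<otimes> fp k))) *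
     (K ^ (CARD('n) - 1) \<otimes> K \<otimes> 1)"

definition Phi_hat_111 :: "complex \<Rightarrow> 'n::{finite,linorder} sf \<otimes> 'n sf \<otimes> 'n sf" where
  "Phi_hat_111 \<beta> = (- (\<i> ^ CARD('n)) * \<beta>\<^sup>2) *\<^sub>C (
     (K ^ (CARD('n) - 1) \<otimes> 1 \<otimes> 1) *
     oprod (\<lambda>k.
       (1 + (\<i> - 1) *\<^sub>C (1 \<otimes> fp k * K \<otimes> fm k + fp k * K \<otimes> K \<otimes> fm k
                         - fp k * K \<otimes> fm k \<otimes> 1 + 1 \<otimes> fm k * fp k \<otimes> 1)) *
       (1 - (\<i> - 1) *\<^sub>C (1 \<otimes> fm k * K \<otimes> fp k + fm k * K \<otimes> K \<otimes> fp k
                         - fm k * K \<otimes> fp k \<otimes> 1 - 1 \<otimes> fm k * fp k \<otimes> 1)) *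
       (1 - 2 *\<^sub>C (1 \<otimes> fm k * fp k \<otimes> 1))) *
     (K ^ (CARD('n) - 1) \<otimes> K ^ CARD('n) \<otimes> 1))"

definition Phi_hat_comp ::
  "complex \<Rightarrow> nat \<Rightarrow> nat \<Rightarrow> nat \<Rightarrow> 'n::{finite,linorder} sf \<otimes> 'n sf \<otimes> 'n sf" where
  "Phi_hat_comp \<beta> a b c =
     (if (a, b, c) = (0, 1, 0) then Phi_hat_010
      else if (a, b, c) = (1, 0, 1) then Phi_hat_101
      else if (a, b, c) = (1, 1, 1) then Phi_hat_111 \<beta>
      else 1)"

definition Phi_hat :: "complex \<Rightarrow> 'n::{finite,linorder} sf \<otimes> 'n sf \<otimes> 'n sf" where
  "Phi_hat \<beta> = (\<Sum>a\<in>{0,1}. \<Sum>b\<in>{0,1}. \<Sum>c\<in>{0,1}. Phi_hat_comp \<beta> a b c * (e a \<otimes> e b \<otimes> e c))"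

(* The element written rho(K), with omega = omega_m. *)
definition rho_K :: "'n sf \<otimes> 'n sf" where
  "rho_K = (1 / 2) *\<^sub>C (1 \<otimes> 1 + omega_m \<otimes> 1 + 1 \<otimes> omega_m - omega_m \<otimes> omega_m)"

definition R_hat_00 :: "'n::{finite,linorder} sf \<otimes> 'n sf" where
  "R_hat_00 = rho_K * oprod (\<lambda>k. 1 - 2 *\<^sub>C (fm k * K \<otimes> fp k))"

definition R_hat_01 :: "'n::{finite,linorder} sf \<otimes> 'n sf" where
  "R_hat_01 = rho_K * oprod (\<lambda>k.
     1 - (1 + \<i>) *\<^sub>C (fm k * K \<otimes> fp k) - (1 + \<i>) *\<^sub>C (fp k * K \<otimes> fm k)
       + (1 - \<i>) *\<^sub>C (fm k * fp k \<otimes> 1) + (2 * \<i>) *\<^sub>C (fm k * fp k \<otimes> fm k * fp k))"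

definition R_hat_10 :: "'n::{finite,linorder} sf \<otimes> 'n sf" where
  "R_hat_10 = rho_K * oprod (\<lambda>k.
     1 + (1 + \<i>) *\<^sub>C (fm k * K \<otimes> fp k) + (1 + \<i>) *\<^sub>C (fp k * K \<otimes> fm k)
       + (1 + \<i>) *\<^sub>C (1 \<otimes> fm k * fp k) - (2 * \<i>) *\<^sub>C (fm k * fp k \<otimes> fm k * fp k)) *
     (1 \<otimes> K)"

definition R_hat_11 :: "complex \<Rightarrow> 'n::{finite,linorder} sf \<otimes> 'n sf" where
  "R_hat_11 \<beta> = ((- 1) ^ CARD('n) * \<i> * \<beta>) *\<^sub>C (
     rho_K * (1 \<otimes> K ^ (CARD('n) - 1)) *
     oprod (\<lambda>k.
       1 - (2 * \<i>) *\<^sub>C (fm k * K \<otimes> fp k) + (\<i> - 1) *\<^sub>C (1 \<otimes> fm k * fp k)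
         - (1 + \<i>) *\<^sub>C (fm k * fp k \<otimes> 1) + 2 *\<^sub>C (fm k * fp k \<otimes> fm k * fp k)) *
     (K ^ CARD('n) \<otimes> 1))"

definition R_hat :: "complex \<Rightarrow> 'n::{finite,linorder} sf \<otimes> 'n sf" where
  "R_hat \<beta> = R_hat_00 * (e 0 \<otimes> e 0) + R_hat_01 * (e 0 \<otimes> e 1)
     + R_hat_10 * (e 1 \<otimes> e 0) + R_hat_11 \<beta> * (e 1 \<otimes> e 1)"


section \<open>The twist\<close>

definition zeta_10 :: "'n::{finite,linorder} sf \<otimes> 'n sf" where
  "zeta_10 = oprod (\<lambda>k.
     1 + (1 - \<i>) *\<^sub>C (1 \<otimes> fp k * fm k) + (1 - \<i>) *\<^sub>C (fm k * K \<otimes> fp k)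
       + (1 + \<i>) *\<^sub>C (fp k * K \<otimes> fm k) - 2 *\<^sub>C (fp k * fm k \<otimes> fp k * fm k)) *
     (1 \<otimes> K)"

definition zeta_11 :: "'n::{finite,linorder} sf \<otimes> 'n sf" where
  "zeta_11 = oprod (\<lambda>k. 1 - (1 + \<i>) *\<^sub>C (1 \<otimes> fp k * fm k)) * (1 \<otimes> K ^ (CARD('n) - 1))"

definition zeta :: "'n::{finite,linorder} sf \<otimes> 'n sf" where
  "zeta = e 0 \<otimes> 1 + zeta_10 * (e 1 \<otimes> e 0) + zeta_11 * (e 1 \<otimes> e 1)"

(* (counit \<otimes> id) and (id \<otimes> counit), followed by the identification of \<complex> \<otimes> A and A \<otimes> \<complex> with A. *)
definition counit_id :: "'n sf \<otimes> 'n sf \<Rightarrow> 'n sf" where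
  "counit_id = tensor_lift (\<lambda>a b. counit a *\<^sub>C b)"

definition id_counit :: "'n sf \<otimes> 'n sf \<Rightarrow> 'n sf" where
  "id_counit = tensor_lift (\<lambda>a b. counit b *\<^sub>C a)"

definition is_twist :: "'n sf \<otimes> 'n sf \<Rightarrow> bool" where
  "is_twist F \<longleftrightarrow> (\<exists>G. is_inverse F G) \<and> counit_id F = 1 \<and> id_counit F = 1"

end

theory Submission
  imports Defs
begin

text \<open>Multiplying by the central idempotents \<open>e\<^sub>a \<otimes> e\<^sub>b \<otimes> e\<^sub>c\<close> splits every identity into sectors, in which
  \<open>K\<^sup>2\<close> is a sign in each tensor factor.  The letters \<open>f\<^sub>k \<otimes> 1 \<otimes> 1\<close>, \<open>K \<otimes> f\<^sub>k \<otimes> 1\<close> and \<open>K \<otimes> K \<otimes> f\<^sub>k\<close> generate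
  a Clifford algebra, so even polynomials in the letters of different sites \<open>k\<close> commute.  In a sector,
  all elements involved are products over \<open>k\<close> of one even polynomial, times a monomial in the \<open>K\<close> of
  the tensor factors.  Moving such a monomial past the product only changes signs of letters,
  depending on the parity of \<open>N\<close>.  Hence each identity follows from an identity in a Clifford algebra
  on at most six generators, which is decided by computing normal forms, and from a comparison of the
  monomials in \<open>K\<close>.\<close>

section \<open>Algebra homomorphisms of tensor products\<close>

text \<open>The three identities are proved in inverse-free form, as in
  \<open>zeta * Delta_hat x = Delta x * zeta\<close>; an inverse of \<open>zeta\<close> is exhibited
  once, and algebra maps carry it to the tensor cube. The obstacle in the R-matrix is
  \<open>rho_K\<close>: in a sector it is a sum of four monomials in \<open>K\<close>, not a product
  over sites times one monomial. It can be split off on the left of both R-matrices, and since it is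
  an involution, moving it past the flipped twist amounts to a conjugation, which takes letters to
  multiples of letters. Every occurrence of the twist is the image of \<open>zeta\<close> under an
  algebra map, so one computation from the images of its quadratic terms serves them all. The sign
  changes of letters depend on \<open>N\<close> only through its parity, so finitely many polynomial
  checks cover every \<open>N\<close>. The local coefficients are Gaussian integers, which makes
  evaluation exact; \<open>\<beta>\<close> and the scalars depending on \<open>N\<close> stay with
  the monomial and are compared arithmetically.\<close>

lemmas alg_hom_clinear = alg_hom_def[THEN iffD1, THEN conjunct1]

lemma clinear_0: "clinear f \<Longrightarrow> f 0 = 0"
  unfolding clinear_def by (metis scaleC_zero_left)

lemma clinear_diff:
  assumes "clinear f"
  shows "f (x - y) = f x - f y"
proof -
  have "f (x - y) + f y = f x"
    using assms unfolding clinear_def by (metis diff_add_cancel)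
  then show ?thesis by (simp add: eq_diff_eq)
qed

text \<open>Pure tensors span additively, so two nested inductions extend multiplicativity from them
  to all elements.\<close>

lemma alg_hom_tensorI:
  assumes add: "\<And>x y. h (x + y) = h x + h y"
    and scale: "\<And>c a b. h (c *\<^sub>C (a \<otimes> b)) = c *\<^sub>C h (a \<otimes> b)"
    and mult: "\<And>a b c d. h ((a \<otimes> b) * (c \<otimes> d)) = h (a \<otimes> b) * h (c \<otimes> d)"
    and one: "h (1 \<otimes> 1) = 1"
  shows "alg_hom h"
proof -
  have zero: "h 0 = 0" using add[of 0 0] by simp
  have "h (c *\<^sub>C x) = c *\<^sub>C h x" for c x
    by (induction x rule: tensor_induct) (simp_all add: zero scale add scaleC_add_right)
  moreover have "h (x * y) = h x * h y" for x y
  proof (induction x rule: tensor_induct)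
    case (pure a b)
    show ?case
      by (induction y rule: tensor_induct) (simp_all add: zero mult add distrib_left)
  qed (simp_all add: zero add distrib_right)
  ultimately show ?thesis
    using add one by (simp add: alg_hom_def clinear_def one_tensor_def)
qed

lemma alg_hom_id: "alg_hom id"
  by (simp add: alg_hom_def clinear_def)

lemma alg_hom_comp: "alg_hom f \<Longrightarrow> alg_hom g \<Longrightarrow> alg_hom (\<lambda>x. f (g x))"
  by (simp add: alg_hom_def clinear_def)

lemma alg_hom_tensor_map: "alg_hom f \<Longrightarrow> alg_hom g \<Longrightarrow> alg_hom (tensor_map f g)"
  by (rule alg_hom_tensorI)
    (simp_all add: tensor_map_add tensor_map_pure tensor_mult alg_hom_clinear alg_homD
      one_tensor_def flip: tensor_scaleC_left)

lemma alg_hom_tensor_flip: "alg_hom tensor_flip"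
  by (rule alg_hom_tensorI)
    (simp_all add: tensor_flip_add tensor_flip_pure tensor_mult one_tensor_def
      flip: tensor_scaleC_left, simp add: tensor_scaleC_left tensor_scaleC_right tensor_flip_pure)

lemma alg_hom_tensor_left: "alg_hom (\<lambda>x. x \<otimes> 1)"
  by (simp add: alg_hom_def clinear_def tensor_add_left tensor_scaleC_left one_tensor_def tensor_mult)

lemma alg_hom_tensor_right: "alg_hom (\<lambda>x. 1 \<otimes> x)"
  by (simp add: alg_hom_def clinear_def tensor_add_right tensor_scaleC_right one_tensor_def tensor_mult)

text \<open>Homogeneity is isolated with the third factor fixed, because a pure tensor of the outer
  product still has an arbitrary sum in its left factor.\<close>

lemma clinear_assoc_pure:
  fixes c :: "'c::complex_algebra"
  shows "clinear (\<lambda>x :: 'a::complex_algebra \<otimes> 'b::complex_algebra. tensor_assoc (x \<otimes> c))"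
proof -
  have s: "tensor_assoc ((s *\<^sub>C x) \<otimes> c) = s *\<^sub>C tensor_assoc (x \<otimes> c)"
    for s and x :: "'a \<otimes> 'b"
  proof (induction x rule: tensor_induct)
    case zero
    have "tensor_assoc (0 :: ('a \<otimes> 'b) \<otimes> 'c) = 0" using tensor_assoc_add[of 0 0] by simp
    then show ?case by simp
  qed (simp_all add: tensor_assoc_pure tensor_assoc_add tensor_add_left scaleC_add_right
      flip: tensor_scaleC_left)
  then show ?thesis by (simp add: clinear_def tensor_add_left tensor_assoc_add)
qed

lemma alg_hom_tensor_assoc:
  "alg_hom (tensor_assoc :: ('a::complex_algebra \<otimes> 'b::complex_algebra) \<otimes> 'c::complex_algebra \<Rightarrow> _)"
proof (rule alg_hom_tensorI)
  have zero: "tensor_assoc (0 :: ('a \<otimes> 'b) \<otimes> 'c) = 0" using tensor_assoc_add[of 0 0] by simp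
  show "tensor_assoc ((x \<otimes> c) * (y \<otimes> d)) = tensor_assoc (x \<otimes> c) * tensor_assoc (y \<otimes> d)"
    for x y :: "'a \<otimes> 'b" and c d :: 'c
  proof (induction x rule: tensor_induct)
    case (pure a b)
    show ?case
      by (induction y rule: tensor_induct)
        (simp_all add: zero tensor_mult tensor_assoc_pure tensor_add_left tensor_assoc_add distrib_left)
  qed (simp_all add: zero tensor_add_left distrib_right tensor_assoc_add)
  show "tensor_assoc (s *\<^sub>C (x \<otimes> c)) = s *\<^sub>C tensor_assoc (x \<otimes> c)"
    for s and x :: "'a \<otimes> 'b" and c :: 'c
    unfolding tensor_scaleC_left[symmetric] using clinear_assoc_pure unfolding clinear_def by blast
qed (simp_all add: tensor_assoc_add tensor_assoc_pure one_tensor_def)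

lemma alg_hom_power: "alg_hom h \<Longrightarrow> h (x ^ n) = h x ^ n"
  by (induction n) (simp_all add: alg_homD)

lemma alg_hom_prod_list: "alg_hom h \<Longrightarrow> h (prod_list xs) = prod_list (map h xs)"
  by (induction xs) (simp_all add: alg_homD)

lemma alg_hom_oprod: "alg_hom h \<Longrightarrow> h (oprod g) = oprod (\<lambda>k. h (g k))"
  by (simp add: oprod_def alg_hom_prod_list comp_def)

lemma tensor_power: "(a \<otimes> b) ^ n = a ^ n \<otimes> b ^ n"
  by (induction n) (simp_all add: one_tensor_def tensor_mult)

lemma scaleC_power: "(c *\<^sub>C x) ^ n = c ^ n *\<^sub>C x ^ n" for x :: "'a::complex_algebra"
  by (induction n) (simp_all add: scaleC_one scaleC_mult_left scaleC_mult_right scaleC_scaleC mult.commute)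

text \<open>Scaling is not a separate case: it is multiplication by
  \<open>c *\<^sub>C 1\<close>.\<close>

lemma sf_induct [case_names K fp fm scal add mult]:
  fixes P :: "'n sf \<Rightarrow> bool"
  assumes "P K" "\<And>i. P (fp i)" "\<And>i. P (fm i)" "\<And>c. P (c *\<^sub>C 1)"
    "\<And>x y. P x \<Longrightarrow> P y \<Longrightarrow> P (x + y)" "\<And>x y. P x \<Longrightarrow> P y \<Longrightarrow> P (x * y)"
  shows "P x"
proof -
  obtain t where t: "x = abs_sf t"
    by (metis Quotient_abs_rep[OF Quotient_sf])
  have "P (abs_sf t)"
  proof (induction t)
    case (TScal c)
    have "c *\<^sub>C 1 = (abs_sf (TScal c) :: 'n sf)"
      unfolding one_sf_def scaleC_sf.abs_eq
      by (metis s_scal_prod s_sym mult.right_neutral sf.abs_eq_iff)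
    then show ?case using assms(4) by metis
  qed (use assms in \<open>auto simp flip: K_def fp.abs_eq fm.abs_eq plus_sf.abs_eq times_sf.abs_eq\<close>)
  then show ?thesis by (simp add: t)
qed

section \<open>Central idempotents\<close>

text \<open>\<open>e n\<close> is a polynomial in the square of \<open>K\<close>, and two
  anticommutations of \<open>K\<close> past a generator cancel.\<close>

lemma e_central: "e n * x = x * e n" for x :: "'n sf"
proof (induction x rule: sf_induct)
  case (mult x y)
  then show ?case by (metis mult.assoc)
qed (simp_all add: sf_e_comm scaleC_mult_left scaleC_mult_right distrib_left distrib_right)

lemma tensor_central:
  assumes "\<And>x. c * x = x * c" "\<And>y. d * y = y * d"
  shows "(c \<otimes> d) * z = z * (c \<otimes> d)"
  by (induction z rule: tensor_induct) (simp_all add: tensor_mult assms distrib_left distrib_right)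

text \<open>Boolean indices let evaluation enumerate all sectors in the checks further
  below.\<close>

abbreviation eb :: "bool \<Rightarrow> 'n sf" where "eb a \<equiv> e (of_bool a)"

abbreviation sgb :: "bool \<Rightarrow> 'a::ring_1" where "sgb a \<equiv> (if a then - 1 else 1)"

lemma e_mult: "eb a * eb b = (if a = b then eb a else 0 :: 'n sf)"
  by (cases a; cases b)
    (simp_all add: sf_e0 sf_e1_idem left_diff_distrib right_diff_distrib flip: One_nat_def)

lemma e_mult_nat: "a < 2 \<Longrightarrow> e a * eb b = (if a = of_bool b then eb b else 0 :: 'n sf)"
  using e_mult[of "a = 1" b] by (cases b; cases "a = 0") (auto simp: less_2_cases_iff)

lemma K2_e: "K * K * eb a = (sgb a *\<^sub>C eb a :: 'n sf)"
proof -
  have "K\<^sup>2 * e 0 = (e 0 :: 'n sf)" "K\<^sup>2 * e 1 = (- e 1 :: 'n sf)"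
    by (simp_all add: e_def scaleC_mult_right distrib_left right_diff_distrib sf_K2_K2 sf_rules(6)
        scaleC_one scaleC_minus_left add.commute flip: scaleC_minus_right)
  then show ?thesis by (cases a) (simp_all add: scaleC_one scaleC_minus_left power2_eq_square)
qed

lemma sum_e: "eb False + eb True = (1 :: 'n sf)"
  by (simp add: sf_e0)

text \<open>The four idempotents sum to \<open>1\<close>, so an equation may be tested on each of
  them.\<close>

lemma tensor_sector_eqI:
  assumes "\<And>a b. X * (eb a \<otimes> eb b) = Y * (eb a \<otimes> eb b :: 'n sf \<otimes> 'n sf)"
  shows "X = Y"
proof -
  have "1 = (\<Sum>a\<in>UNIV. \<Sum>b\<in>UNIV. eb a \<otimes> eb b :: 'n sf \<otimes> 'n sf)"
    unfolding one_tensor_def sum_e[symmetric] by (simp add: UNIV_bool tensor_add_left tensor_add_right add_ac)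
  then show ?thesis
    by (metis (no_types, lifting) assms mult.right_neutral sum_distrib_left sum.cong)
qed

lemma tensor3_sector_eqI:
  assumes "\<And>a b c. X * (eb a \<otimes> eb b \<otimes> eb c) = Y * (eb a \<otimes> eb b \<otimes> eb c :: 'n sf \<otimes> 'n sf \<otimes> 'n sf)"
  shows "X = Y"
proof -
  have "1 = (\<Sum>a\<in>UNIV. \<Sum>b\<in>UNIV. \<Sum>c\<in>UNIV. eb a \<otimes> eb b \<otimes> eb c :: 'n sf \<otimes> 'n sf \<otimes> 'n sf)"
    unfolding one_tensor_def sum_e[symmetric] by (simp add: UNIV_bool tensor_add_left tensor_add_right add_ac)
  then show ?thesis
    by (metis (no_types, lifting) assms mult.right_neutral sum_distrib_left sum.cong)
qed

section \<open>Normal forms in Clifford algebras\<close>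

(* Noncommutative polynomials with Gaussian integer coefficients (a, b) = a + i b, as lists of terms;
   on closed polynomials all operations below can be carried out by rewriting. *)
type_synonym gauss = "int \<times> int"
type_synonym cpoly = "(gauss \<times> nat list) list"

definition gval :: "gauss \<Rightarrow> complex" where
  "gval c = of_int (fst c) + \<i> * of_int (snd c)"

definition gadd :: "gauss \<Rightarrow> gauss \<Rightarrow> gauss" where
  "gadd c d = (fst c + fst d, snd c + snd d)"

definition gmul :: "gauss \<Rightarrow> gauss \<Rightarrow> gauss" where
  "gmul c d = (fst c * fst d - snd c * snd d, fst c * snd d + snd c * fst d)"

lemma gval_simps:
  "gval (gadd c d) = gval c + gval d" "gval (gmul c d) = gval c * gval d" "gval (0, 0) = 0"
  by (simp_all add: gval_def gadd_def gmul_def algebra_simps complex_eq_iff)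

definition ev :: "(nat \<Rightarrow> 'a::complex_algebra) \<Rightarrow> cpoly \<Rightarrow> 'a" where
  "ev x p = (\<Sum>(c, w)\<leftarrow>p. gval c *\<^sub>C prod_list (map x w))"

lemma ev_simps:
  "ev x [] = 0" "ev x ((c, w) # p) = gval c *\<^sub>C prod_list (map x w) + ev x p"
  "ev x (p @ r) = ev x p + ev x r"
  by (simp_all add: ev_def)

primrec insert_term :: "gauss \<times> nat list \<Rightarrow> cpoly \<Rightarrow> cpoly" where
  "insert_term t [] = [t]"
| "insert_term t (s # p) =
    (if snd t = snd s then (gadd (fst t) (fst s), snd s) # p else s # insert_term t p)"

definition collect :: "cpoly \<Rightarrow> cpoly" where
  "collect p = filter (\<lambda>t. fst t \<noteq> (0, 0)) (fold insert_term p [])"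

lemma ev_insert_term: "ev x (insert_term t p) = ev x [t] + ev x p"
  by (cases t; induction p) (auto simp: ev_simps gval_simps scaleC_add_left)

lemma ev_collect: "ev x (collect p) = ev x p"
proof -
  have "ev x (filter (\<lambda>t. fst t \<noteq> (0, 0)) r) = ev x r" for r
    by (induction r) (auto simp: ev_simps gval_simps)
  moreover have "ev x (fold insert_term p r) = ev x p + ev x r" for r
    by (induction p arbitrary: r) (auto simp: ev_simps ev_insert_term)
  ultimately show ?thesis by (simp add: collect_def ev_simps)
qed

definition scale_poly :: "gauss \<Rightarrow> cpoly \<Rightarrow> cpoly" where
  "scale_poly c p = map (\<lambda>(d, w). (gmul c d, w)) p"

lemma ev_scale_poly: "ev x (scale_poly c p) = gval c *\<^sub>C ev x p"
  by (induction p)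
    (auto simp: scale_poly_def ev_simps gval_simps scaleC_add_right scaleC_scaleC)

(* Letters 2m and 2m+1 are the two conjugate generators of mode m; their anticommutator is the
   m-th entry of the list q, and all other pairs anticommute.  Words are sorted increasingly. *)
primrec entry :: "int list \<Rightarrow> nat \<Rightarrow> int" where
  "entry [] m = 0"
| "entry (a # q) m = (if m = 0 then a else entry q (m - 1))"

definition pairing :: "int list \<Rightarrow> nat \<Rightarrow> nat \<Rightarrow> int" where
  "pairing q l m = (if l \<noteq> m \<and> l div 2 = m div 2 then entry q (l div 2) else 0)"

text \<open>Normal ordering of a letter times a sorted word: \<open>l\<close> moves right past
  smaller letters, each exchange leaving a contraction term and a sign. Meeting itself it gives
  \<open>0\<close>, since letters square to zero.\<close>

primrec letter_word :: "int list \<Rightarrow> nat \<Rightarrow> nat list \<Rightarrow> cpoly" where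
  "letter_word q l [] = [((1, 0), [l])]"
| "letter_word q l (m # w) =
    (if l < m then [((1, 0), l # m # w)] else if l = m then [] else
      ((pairing q l m, 0), w) # map (\<lambda>(c, v). (gmul (- 1, 0) c, m # v)) (letter_word q l w))"

definition letter_poly :: "int list \<Rightarrow> nat \<Rightarrow> cpoly \<Rightarrow> cpoly" where
  "letter_poly q l p = collect (concat (map (\<lambda>(c, w). scale_poly c (letter_word q l w)) p))"

definition mult_poly :: "int list \<Rightarrow> cpoly \<Rightarrow> cpoly \<Rightarrow> cpoly" where
  "mult_poly q p r =
     collect (concat (map (\<lambda>(c, w). scale_poly c (foldr (letter_poly q) w r)) p))"

definition poly_eq :: "cpoly \<Rightarrow> cpoly \<Rightarrow> bool" where
  "poly_eq p r \<longleftrightarrow> collect (p @ scale_poly (- 1, 0) r) = []"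

text \<open>Collecting equal words uses no relation between letters, so this holds for every
  assignment \<open>x\<close>; the Clifford relations are spent in \<open>mult_poly\<close>.\<close>

lemma ev_poly_eq: "poly_eq p r \<Longrightarrow> ev x p = ev x r"
  using ev_collect[of x "p @ scale_poly (- 1, 0) r"]
  by (simp add: poly_eq_def ev_simps ev_scale_poly gval_def scaleC_minus_left scaleC_one)

lemma double_eq_0: "x + x = 0 \<Longrightarrow> x = 0" for x :: "'a::complex_algebra"
proof -
  assume "x + x = 0"
  then have "(1 / 2) *\<^sub>C x + (1 / 2) *\<^sub>C x = 0"
    by (simp flip: scaleC_add_right)
  then show ?thesis by (simp add: scaleC_one flip: scaleC_add_left)
qed

text \<open>The relations are stated after multiplication by \<open>E\<close> because
  \<open>fp k * fm k + fm k * fp k\<close> is the element \<open>e 1\<close>, which becomes a number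
  only in a sector.\<close>

locale clifford =
  fixes E :: "'a::complex_algebra" and q :: "int list" and x :: "nat \<Rightarrow> 'a"
  assumes central: "E * X = X * E"
    and anticomm: "(x l * x m + x m * x l) * E = of_int (pairing q l m) *\<^sub>C E"
begin

text \<open>A letter has pairing \<open>0\<close> with itself, so twice its square vanishes in the
  sector.\<close>

lemma square_0: "x l * x l * E = 0"
proof -
  have "x l * x l * E + x l * x l * E = 0"
    using anticomm[of l l] by (simp add: pairing_def distrib_right)
  then show ?thesis by (rule double_eq_0)
qed

lemma swap: "x l * (x m * X) * E = of_int (pairing q l m) *\<^sub>C (X * E) - x m * (x l * X) * E"
proof -
  have "x l * (x m * X) * E + x m * (x l * X) * E = (x l * x m + x m * x l) * E * X"
    by (simp add: distrib_right mult.assoc central[of X])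
  also have "\<dots> = of_int (pairing q l m) *\<^sub>C (X * E)"
    by (simp add: anticomm scaleC_mult_left central[of X])
  finally show ?thesis by (simp add: eq_diff_eq)
qed

lemma ev_prepend: "ev x (map (\<lambda>(c, v). (gmul d c, m # v)) p) = gval d *\<^sub>C (x m * ev x p)"
  by (induction p)
    (auto simp: ev_simps gval_simps scaleC_mult_right distrib_left scaleC_add_right scaleC_scaleC)

lemma ev_letter_word: "ev x (letter_word q l w) * E = x l * prod_list (map x w) * E"
proof (induction w)
  case (Cons m w)
  let ?W = "prod_list (map x w)"
  have "gval (pairing q l m, 0) *\<^sub>C ?W * E + gval (- 1, 0) *\<^sub>C (x m * ev x (letter_word q l w)) * E
      = x l * (x m * ?W) * E"
    using Cons by (subst swap) (simp add: gval_def scaleC_minus_left scaleC_one scaleC_mult_left mult.assoc)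
  moreover have "x l * (x l * ?W) * E = 0"
  proof -
    have "x l * (x l * ?W) * E = x l * x l * E * ?W"
      by (simp add: mult.assoc central)
    then show ?thesis by (simp add: square_0)
  qed
  ultimately show ?case
    by (auto simp: ev_simps ev_prepend gval_def[of "(1, 0)"] scaleC_one distrib_right)
qed (simp add: ev_simps gval_def scaleC_one)

lemma ev_letter_poly: "ev x (letter_poly q l p) * E = x l * ev x p * E"
proof -
  have "ev x (concat (map (\<lambda>(c, w). scale_poly c (letter_word q l w)) p)) * E = x l * ev x p * E"
    by (induction p)
      (auto simp: ev_simps ev_scale_poly scaleC_mult_left scaleC_mult_right distrib_left
        distrib_right ev_letter_word)
  then show ?thesis by (simp add: letter_poly_def ev_collect)
qed

lemma ev_mult_poly: "ev x (mult_poly q p r) * E = ev x p * ev x r * E"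
proof -
  have w: "ev x (foldr (letter_poly q) w r) * E = prod_list (map x w) * ev x r * E" for w
    by (induction w) (simp_all add: ev_letter_poly mult.assoc)
  have "ev x (concat (map (\<lambda>(c, w). scale_poly c (foldr (letter_poly q) w r)) p)) * E =
      ev x p * ev x r * E"
    by (induction p)
      (auto simp: ev_simps ev_scale_poly scaleC_mult_left distrib_right w)
  then show ?thesis by (simp add: mult_poly_def ev_collect)
qed

end

section \<open>Ordered products over the index set\<close>

lemma oprod_one: "oprod (\<lambda>k. 1) = 1"
proof -
  have "prod_list (map (\<lambda>k. 1) ks) = 1" for ks :: "'c list" by (induction ks) auto
  then show ?thesis by (simp add: oprod_def)
qed

lemma oprod_conj:
  assumes "\<And>k. y * g k = h k * y"
  shows "y * oprod g = oprod h * y"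
proof -
  have "y * prod_list (map g ks) = prod_list (map h ks) * y" for ks
    by (induction ks) (simp_all, metis assms mult.assoc)
  then show ?thesis by (simp add: oprod_def)
qed

text \<open>Each \<open>h k\<close> moves left past the factors of \<open>g\<close> at later sites,
  which differ from \<open>k\<close> because every site occurs once.\<close>

lemma oprod_mult:
  assumes "\<And>j k. j \<noteq> k \<Longrightarrow> g j * h k = h k * g j"
  shows "oprod g * oprod h = oprod (\<lambda>k. g k * h k)"
proof -
  have "distinct ks \<Longrightarrow>
      prod_list (map g ks) * prod_list (map h ks) = prod_list (map (\<lambda>k. g k * h k) ks)" for ks
  proof (induction ks)
    case (Cons k ks)
    have "k \<notin> set js \<Longrightarrow> prod_list (map g js) * h k = h k * prod_list (map g js)" for js
      by (induction js) (simp_all, metis assms mult.assoc)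
    then have "prod_list (map g ks) * (h k * prod_list (map h ks)) =
        h k * (prod_list (map g ks) * prod_list (map h ks))"
      using Cons.prems by (metis distinct.simps(2) mult.assoc)
    with Cons show ?case by (simp add: mult.assoc)
  qed simp
  then show ?thesis by (simp add: oprod_def)
qed

text \<open>A single central \<open>E\<close> can be carried along the product and used to rewrite
  each factor in turn.\<close>

lemma oprod_cong_mod:
  fixes E :: "'a::monoid_mult"
  assumes "\<And>X. E * X = X * E" "\<And>k. g k * E = h k * E"
  shows "oprod g * E = oprod h * E"
proof -
  have "prod_list (map g ks) * E = prod_list (map h ks) * E" for ks
  proof (induction ks)
    case (Cons k ks)
    then have "g k * prod_list (map g ks) * E = g k * E * prod_list (map h ks)"
      by (metis assms(1) mult.assoc)
    then show ?case by (simp add: assms mult.assoc)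
  qed simp
  then show ?thesis by (simp add: oprod_def)
qed

(* Only the factor at site i moves z past the product. *)
lemma oprod_intertwine:
  fixes E :: "'a::monoid_mult"
  assumes "\<And>X. E * X = X * E"
    and "\<And>k. k \<noteq> i \<Longrightarrow> g k * y = y * g k" "g i * y * E = z * g i * E"
    and "\<And>k. k \<noteq> i \<Longrightarrow> g k * z = z * g k"
  shows "oprod g * y * E = z * oprod g * E"
proof -
  have "i \<notin> set ks \<Longrightarrow> prod_list (map g ks) * y = y * prod_list (map g ks)" for ks
    by (induction ks) (simp_all, metis assms(2) mult.assoc)
  then have "distinct ks \<Longrightarrow> i \<in> set ks \<Longrightarrow> prod_list (map g ks) * y * E = z * prod_list (map g ks) * E"
    for ks
  proof (induction ks)
    case (Cons k ks)
    show ?case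
    proof (cases "k = i")
      case True
      then have "prod_list (map g ks) * y = y * prod_list (map g ks)" using Cons by simp
      then have "prod_list (map g ks) * (y * E) = y * (prod_list (map g ks) * E)"
        by (metis mult.assoc)
      then have "g k * prod_list (map g ks) * y * E = g i * y * E * prod_list (map g ks)"
        by (simp only: mult.assoc assms(1)[of "prod_list (map g ks)"] True)
      also have "\<dots> = z * (g k * prod_list (map g ks)) * E"
        by (simp only: assms(3)) (simp only: mult.assoc assms(1)[of "prod_list (map g ks)"] True)
      finally show ?thesis by simp
    next
      case False
      then have "g k * (prod_list (map g ks) * y * E) = g k * (z * prod_list (map g ks) * E)"
        using Cons by simp
      then show ?thesis by (simp add: mult.assoc) (metis False assms(4) mult.assoc)
    qed
  qed simp
  then show ?thesis by (simp add: oprod_def)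
qed

section \<open>Parity of word lengths\<close>

definition parity_poly :: "bool \<Rightarrow> cpoly \<Rightarrow> bool" where
  "parity_poly b p \<longleftrightarrow> (\<forall>w\<in>snd ` set p. even (length w) = b)"

abbreviation even_poly :: "cpoly \<Rightarrow> bool" where
  "even_poly \<equiv> parity_poly True"

lemma set_insert_term: "snd ` set (insert_term t p) \<subseteq> snd ` set (t # p)"
  by (induction p) auto

lemma set_collect: "snd ` set (collect p) \<subseteq> snd ` set p"
proof -
  have "snd ` set (fold insert_term p r) \<subseteq> snd ` set p \<union> snd ` set r" for r
  proof (induction p arbitrary: r)
    case (Cons t p)
    have "snd ` set (fold insert_term (t # p) r) \<subseteq> snd ` set p \<union> snd ` set (insert_term t r)"
      using Cons[of "insert_term t r"] by simp
    also have "\<dots> \<subseteq> snd ` set p \<union> snd ` set (t # r)"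
      by (rule Un_mono[OF subset_refl set_insert_term])
    finally show ?case by simp
  qed simp
  from this[of "[]"] have "snd ` set (fold insert_term p []) \<subseteq> snd ` set p" by simp
  moreover have "set (collect p) \<subseteq> set (fold insert_term p [])" by (simp add: collect_def)
  ultimately show ?thesis by blast
qed

lemma parity_collect: "parity_poly b p \<Longrightarrow> parity_poly b (collect p)"
  using set_collect[of p] unfolding parity_poly_def by blast

lemma parity_scale_poly: "parity_poly b p \<Longrightarrow> parity_poly b (scale_poly c p)"
  unfolding parity_poly_def scale_poly_def by auto

lemma parity_concat:
  assumes "\<And>c w. (c, w) \<in> set p \<Longrightarrow> parity_poly b (f w)"
  shows "parity_poly b (concat (map (\<lambda>(c, w). scale_poly c (f w)) p))"
  using assms
proof (induction p)
  case (Cons t p)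
  obtain c w where t: "t = (c, w)" by fastforce
  have "parity_poly b (scale_poly c (f w))"
    using Cons.prems[of c w] by (intro parity_scale_poly) (simp add: t)
  moreover have "parity_poly b (concat (map (\<lambda>(c, w). scale_poly c (f w)) p))"
    using Cons.prems by (intro Cons.IH) (metis list.set_intros(2))
  ultimately show ?case unfolding t parity_poly_def by auto
qed (simp add: parity_poly_def)

text \<open>Inserting the letter lengthens a word by one and a contraction shortens it by one;
  either way the parity changes.\<close>

lemma parity_letter_word: "parity_poly (odd (length w)) (letter_word q l w)"
  by (induction w) (auto simp: parity_poly_def image_image)

lemma parity_letter_poly:
  assumes "parity_poly b p"
  shows "parity_poly (\<not> b) (letter_poly q l p)"
  unfolding letter_poly_def
proof (intro parity_collect parity_concat)
  fix c w assume "(c, w) \<in> set p"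
  then have "even (length w) = b" using assms by (force simp: parity_poly_def)
  then show "parity_poly (\<not> b) (letter_word q l w)" using parity_letter_word[of w q l] by simp
qed

lemma parity_mult_poly:
  assumes "parity_poly b p" "parity_poly b' r"
  shows "parity_poly (b = b') (mult_poly q p r)"
  unfolding mult_poly_def
proof (intro parity_collect parity_concat)
  have *: "parity_poly (even (length w) = b') (foldr (letter_poly q) w r)" for w
  proof (induction w)
    case (Cons l w)
    have "(\<not> (even (length w) = b')) = (even (length (l # w)) = b')" by auto
    with parity_letter_poly[OF Cons, of q l] show ?case by simp
  qed (simp add: assms)
  fix c w assume "(c, w) \<in> set p"
  then have "even (length w) = b" using assms(1) by (force simp: parity_poly_def)
  then show "parity_poly (b = b') (foldr (letter_poly q) w r)" using *[of w] by simp
qed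

lemmas even_mult_poly = parity_mult_poly[of True _ True, simplified]

lemma parity_append: "parity_poly b (p @ r) \<longleftrightarrow> parity_poly b p \<and> parity_poly b r"
  by (auto simp: parity_poly_def)

lemma commute_left: "a * b = b * a \<Longrightarrow> a * (b * c) = b * (a * c)" for a :: "'a::semigroup_mult"
  by (metis mult.assoc)

section \<open>Sign changes of letters under monomials in \<open>K\<close>\<close>

definition flipped :: "bool \<Rightarrow> bool \<Rightarrow> bool \<Rightarrow> nat \<Rightarrow> bool" where
  "flipped b0 b1 b2 l \<longleftrightarrow> (if l div 2 = 0 then b0 else if l div 2 = 1 then b1 else l div 2 = 2 \<and> b2)"

text \<open>The effect of conjugating by a monomial in \<open>K\<close> whose exponents in the three
  tensor factors have parities \<open>b0\<close>, \<open>b1\<close>, \<open>b2\<close>: each letter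
  of a mode with odd exponent changes sign.\<close>

definition flip_poly :: "bool \<Rightarrow> bool \<Rightarrow> bool \<Rightarrow> cpoly \<Rightarrow> cpoly" where
  "flip_poly b0 b1 b2 p =
    map (\<lambda>(c, w). (if even (length (filter (flipped b0 b1 b2) w)) then c else gmul (- 1, 0) c, w)) p"

lemma even_flip_poly: "even_poly p \<Longrightarrow> even_poly (flip_poly b0 b1 b2 p)"
  by (auto simp: parity_poly_def flip_poly_def)

definition one_poly :: cpoly where
  "one_poly = [((1, 0), [])]"

lemma one_poly: "even_poly one_poly" "ev x one_poly = 1"
  by (simp_all add: one_poly_def parity_poly_def ev_simps gval_def scaleC_one)

text \<open>The letters of all sites anticommute, so even polynomials at different sites commute.  The
  elements \<open>kk m\<close>, which stand for \<open>K\<close> in the \<open>m\<close>-th tensor factor, change the signs of the letters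
  of mode \<open>m\<close>.  Relations within one site hold only modulo the annihilator of \<open>E\<close>.\<close>

locale sector =
  fixes E :: "'a::complex_algebra" and q :: "int list" and kap :: "int list"
    and x :: "'n::{finite,linorder} \<Rightarrow> nat \<Rightarrow> 'a" and kk :: "nat \<Rightarrow> 'a"
  assumes cliff: "clifford E q (x k)"
    and distinct: "j \<noteq> k \<Longrightarrow> x j l * x k m = - (x k m * x j l)"
    and kk_x: "kk m * x k l = (if l div 2 = m then - (x k l * kk m) else x k l * kk m)"
    and kk_kk: "kk m * kk n = kk n * kk m"
    and kk_square: "m < 3 \<Longrightarrow> kk m * kk m * E = of_int (kap ! m) *\<^sub>C E"
begin

lemmas central = clifford.central[OF cliff]
lemmas ev_mult = clifford.ev_mult_poly[OF cliff]

definition mono :: "complex \<Rightarrow> nat \<Rightarrow> nat \<Rightarrow> nat \<Rightarrow> 'a" where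
  "mono c t0 t1 t2 = c *\<^sub>C (kk 0 ^ t0 * kk 1 ^ t1 * kk 2 ^ t2)"

lemma kk_power_commute: "kk m ^ s * kk n ^ t = kk n ^ t * kk m ^ s"
proof -
  have "kk m * kk n ^ t = kk n ^ t * kk m" by (rule power_commuting_commutes[symmetric]) (rule kk_kk)
  then show ?thesis by (rule power_commuting_commutes)
qed

lemma mono_mult: "mono c t0 t1 t2 * mono d u0 u1 u2 = mono (c * d) (t0 + u0) (t1 + u1) (t2 + u2)"
proof -
  have "kk 0 ^ t0 * kk 1 ^ t1 * kk 2 ^ t2 * (kk 0 ^ u0 * kk 1 ^ u1 * kk 2 ^ u2) =
      kk 0 ^ t0 * kk 0 ^ u0 * (kk 1 ^ t1 * kk 1 ^ u1) * (kk 2 ^ t2 * kk 2 ^ u2)"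
    by (simp only: mult.assoc kk_power_commute[of 2 t2 0 u0, THEN commute_left]
        kk_power_commute[of 1 t1 0 u0, THEN commute_left] kk_power_commute[of 2 t2 1 u1, THEN commute_left])
  then show ?thesis
    by (simp add: mono_def power_add scaleC_mult_left scaleC_mult_right scaleC_scaleC mult.commute[of d])
qed

lemma mono_power: "mono c t0 t1 t2 ^ n = mono (c ^ n) (n * t0) (n * t1) (n * t2)"
  by (induction n) (simp_all add: mono_mult, simp add: mono_def scaleC_one)

lemma kk_power_x:
  "kk m ^ t * x k l = (if l div 2 = m \<and> odd t then - (x k l * kk m ^ t) else x k l * kk m ^ t)"
proof (induction t)
  case (Suc t)
  have "kk m ^ Suc t * x k l = kk m * (kk m ^ t * x k l)" by (simp add: mult.assoc)
  then show ?case using Suc by (auto simp: kk_x mult.assoc[symmetric])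
qed simp

lemma mono_x:
  "mono c t0 t1 t2 * x k l = (if flipped (odd t0) (odd t1) (odd t2) l then - 1 else 1) *\<^sub>C
     (x k l * mono c t0 t1 t2)"
proof -
  have *: "kk m ^ t * (x k l * X) = (if l div 2 = m \<and> odd t then - 1 else 1) *\<^sub>C (x k l * (kk m ^ t * X))"
    for m t X
    using kk_power_x[of m t k l]
    by (auto simp: mult.assoc[symmetric] scaleC_minus_left scaleC_one)
  show ?thesis
    using *[of 2 t2 1]
    by (auto simp: mono_def flipped_def mult.assoc * scaleC_mult_left scaleC_mult_right scaleC_scaleC
        scaleC_minus_left scaleC_minus_right scaleC_one)
qed

lemma mono_ev: "mono c t0 t1 t2 * ev (x k) p =
    ev (x k) (flip_poly (odd t0) (odd t1) (odd t2) p) * mono c t0 t1 t2"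
proof -
  let ?M = "mono c t0 t1 t2" and ?f = "flipped (odd t0) (odd t1) (odd t2)"
  have w: "?M * prod_list (map (x k) w) =
      (if even (length (filter ?f w)) then 1 else - 1) *\<^sub>C (prod_list (map (x k) w) * ?M)" for w
  proof (induction w)
    case (Cons l w)
    have "?M * prod_list (map (x k) (l # w)) =
        (if ?f l then - 1 else 1) *\<^sub>C (x k l * (?M * prod_list (map (x k) w)))"
      by (simp add: mult.assoc[symmetric] mono_x scaleC_mult_left)
    then show ?case unfolding Cons by (simp add: scaleC_mult_right scaleC_scaleC mult.assoc)
  qed (simp add: scaleC_one)
  show ?thesis
    by (induction p)
      (auto simp: flip_poly_def ev_simps distrib_left distrib_right scaleC_mult_left scaleC_mult_right w
        gval_simps gval_def[of "(- 1, 0)"] scaleC_minus_left scaleC_minus_right scaleC_one scaleC_scaleC)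
qed

lemma x_word: "j \<noteq> k \<Longrightarrow> prod_list (map (x k) w) * x j l =
    (if even (length w) then 1 else - 1) *\<^sub>C (x j l * prod_list (map (x k) w))"
proof (induction w)
  case (Cons m w)
  have "prod_list (map (x k) (m # w)) * x j l =
      (if even (length w) then 1 else - 1) *\<^sub>C (x k m * x j l * prod_list (map (x k) w))"
    using Cons by (simp add: mult.assoc scaleC_mult_right)
  then show ?case
    using distinct[of k j m l] Cons.prems by (simp add: scaleC_minus_left scaleC_minus_right mult.assoc)
qed (simp add: scaleC_one)

lemma even_x: "even_poly p \<Longrightarrow> j \<noteq> k \<Longrightarrow> ev (x k) p * x j l = x j l * ev (x k) p"
  by (induction p)
    (auto simp: parity_poly_def ev_simps distrib_left distrib_right scaleC_mult_left scaleC_mult_right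
      x_word scaleC_one)

lemma even_ev: "even_poly p \<Longrightarrow> j \<noteq> k \<Longrightarrow> ev (x k) p * ev (x j) r = ev (x j) r * ev (x k) p"
proof -
  assume a: "even_poly p" "j \<noteq> k"
  have w: "ev (x k) p * prod_list (map (x j) w) = prod_list (map (x j) w) * ev (x k) p" for w
  proof (induction w)
    case (Cons l w)
    have "ev (x k) p * prod_list (map (x j) (l # w)) = x j l * (ev (x k) p * prod_list (map (x j) w))"
      by (simp add: mult.assoc[symmetric] even_x[OF a])
    then show ?case unfolding Cons by (simp add: mult.assoc)
  qed simp
  show ?thesis
    by (induction r)
      (auto simp: ev_simps distrib_left distrib_right scaleC_mult_left scaleC_mult_right w)
qed

(* Modulo the annihilator of E, X is the product over all sites of the same even polynomial in the
   letters of the site, times a monomial in the kk m.  Such elements are closed under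
   multiplication (rep_mult), which reduces identities between them to a single site. *)
definition rep :: "'a \<Rightarrow> cpoly \<Rightarrow> complex \<Rightarrow> nat \<Rightarrow> nat \<Rightarrow> nat \<Rightarrow> bool" where
  "rep X P c t0 t1 t2 \<longleftrightarrow>
     even_poly P \<and> X * E = oprod (\<lambda>k. ev (x k) P) * mono c t0 t1 t2 * E"

text \<open>The left monomial passes the right product and flips its letters. The two products then
  interleave, as even factors at different sites commute, and \<open>mult_poly\<close> multiplies
  the factors at each site.\<close>

lemma rep_mult:
  assumes "rep X P c t0 t1 t2" "rep Y Q d u0 u1 u2"
  shows "rep (X * Y) (mult_poly q P (flip_poly (odd t0) (odd t1) (odd t2) Q))
    (c * d) (t0 + u0) (t1 + u1) (t2 + u2)"
proof -
  let ?Q = "flip_poly (odd t0) (odd t1) (odd t2) Q"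
  have P: "even_poly P" and Q: "even_poly ?Q"
    using assms by (auto simp: rep_def even_flip_poly)
  let ?A = "oprod (\<lambda>k. ev (x k) P)" and ?M = "mono c t0 t1 t2" and ?N = "mono d u0 u1 u2"
  have X: "X * E = ?A * ?M * E" and Y: "Y * E = oprod (\<lambda>k. ev (x k) Q) * ?N * E"
    using assms by (simp_all add: rep_def)
  have conj: "?M * oprod (\<lambda>k. ev (x k) Q) = oprod (\<lambda>k. ev (x k) ?Q) * ?M"
    by (rule oprod_conj) (rule mono_ev)
  have merge: "?A * oprod (\<lambda>k. ev (x k) ?Q) = oprod (\<lambda>k. ev (x k) P * ev (x k) ?Q)"
    by (rule oprod_mult) (auto intro: even_ev[OF P])
  have cong: "oprod (\<lambda>k. ev (x k) P * ev (x k) ?Q) * E = oprod (\<lambda>k. ev (x k) (mult_poly q P ?Q)) * E"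
    by (rule oprod_cong_mod) (rule central, rule ev_mult[symmetric])
  have "X * Y * E = X * E * Y"
    by (simp only: mult.assoc central[of Y])
  also have "\<dots> = ?A * ?M * (Y * E)"
    unfolding X by (simp only: mult.assoc central[of Y])
  also have "\<dots> = ?A * (?M * oprod (\<lambda>k. ev (x k) Q)) * ?N * E"
    unfolding Y by (simp only: mult.assoc)
  also have "\<dots> = ?A * oprod (\<lambda>k. ev (x k) ?Q) * (?M * ?N) * E"
    unfolding conj by (simp only: mult.assoc)
  also have "\<dots> = oprod (\<lambda>k. ev (x k) P * ev (x k) ?Q) * E * (?M * ?N)"
    unfolding merge by (simp only: mult.assoc central[of "?M * ?N"])
  also have "\<dots> = oprod (\<lambda>k. ev (x k) (mult_poly q P ?Q)) * (?M * ?N) * E"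
    unfolding cong by (simp only: mult.assoc central[of "?M * ?N"])
  finally show ?thesis
    by (simp only: rep_def even_mult_poly[OF P Q] mono_mult simp_thms)
qed

lemma rep_mono: "X * E = mono c t0 t1 t2 * E \<Longrightarrow> rep X one_poly c t0 t1 t2"
  by (simp add: rep_def one_poly oprod_one)

lemma rep_one: "X * E = E \<Longrightarrow> rep X one_poly 1 0 0 0"
  by (rule rep_mono) (simp add: mono_def scaleC_one)

lemma rep_oprod:
  assumes "\<And>k. g k * E = ev (x k) P * E" "even_poly P"
  shows "rep (oprod g) P 1 0 0 0"
  using oprod_cong_mod[OF central assms(1)] assms(2) by (simp add: rep_def mono_def scaleC_one)

lemma rep_scale: "rep X P c t0 t1 t2 \<Longrightarrow> rep (s *\<^sub>C X) P (s * c) t0 t1 t2"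
  by (simp add: rep_def mono_def scaleC_mult_left scaleC_mult_right flip: scaleC_scaleC)

lemma rep_cong: "X * E = Y * E \<Longrightarrow> rep X P c t0 t1 t2 = rep Y P c t0 t1 t2"
  by (simp add: rep_def)

text \<open>\<open>E\<close> is central, so its annihilator is a two-sided ideal and congruence
  modulo it respects products.\<close>

lemma mod_mult:
  assumes X: "X * E = X' * E" and Y: "Y * E = Y' * E"
  shows "X * Y * E = X' * Y' * E"
proof -
  have "X * Y * E = X * E * Y" by (simp only: mult.assoc central[of Y])
  also have "\<dots> = X' * (Y * E)" unfolding X by (simp only: mult.assoc central[of Y])
  finally show ?thesis unfolding Y by (simp only: mult.assoc)
qed

lemma mod_power: "X * E = X' * E \<Longrightarrow> X ^ n * E = X' ^ n * E"
  by (induction n) (simp, unfold power_Suc, rule mod_mult)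

lemma rep_mult_mono:
  assumes "rep X P c t0 t1 t2" "Y * E = mono d u0 u1 u2 * E"
  shows "rep (X * Y) P (c * d) (t0 + u0) (t1 + u1) (t2 + u2)"
proof -
  have "X * Y * E = oprod (\<lambda>k. ev (x k) P) * mono c t0 t1 t2 * mono d u0 u1 u2 * E"
    using assms by (intro mod_mult) (simp_all add: rep_def)
  then show ?thesis using assms(1) by (simp add: rep_def mult.assoc mono_mult)
qed

text \<open>Next to \<open>E\<close> each square of \<open>kk m\<close> is the number
  \<open>kap ! m\<close>, so only the parities of the exponents remain.\<close>

lemma mono_reduce: "mono c t0 t1 t2 * E =
    mono (c * of_int ((kap ! 0) ^ (t0 div 2) * (kap ! 1) ^ (t1 div 2) * (kap ! 2) ^ (t2 div 2)))
      (t0 mod 2) (t1 mod 2) (t2 mod 2) * E"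
proof -
  have sq: "(kk m * kk m) ^ n * E = of_int ((kap ! m) ^ n) *\<^sub>C E" if "m < 3" for m n
  proof (induction n)
    case (Suc n)
    have "(kk m * kk m) ^ Suc n * E = (kk m * kk m) * ((kk m * kk m) ^ n * E)" by (simp add: mult.assoc)
    then show ?case
      unfolding Suc by (simp add: scaleC_mult_right kk_square[OF that] scaleC_scaleC mult.commute)
  qed (simp add: scaleC_one)
  have r: "kk m ^ t * E = of_int ((kap ! m) ^ (t div 2)) *\<^sub>C (kk m ^ (t mod 2) * E)" if "m < 3" for m t
  proof -
    have "kk m ^ t = kk m ^ (t mod 2 + 2 * (t div 2))" by simp
    then have "kk m ^ t = kk m ^ (t mod 2) * (kk m * kk m) ^ (t div 2)"
      by (simp only: power_add power_mult power2_eq_square)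
    then show ?thesis by (simp add: mult.assoc sq[OF that] scaleC_mult_right)
  qed
  have mult: "X * Y * E = (s * t) *\<^sub>C (A * B * E)"
    if X: "X * E = s *\<^sub>C (A * E)" and Y: "Y * E = t *\<^sub>C (B * E)" for X Y A B s t
  proof -
    have "X * Y * E = X * E * Y" by (simp only: mult.assoc central[of Y])
    also have "\<dots> = s *\<^sub>C (A * (Y * E))" unfolding X by (simp only: scaleC_mult_left mult.assoc central[of Y])
    also have "\<dots> = (s * t) *\<^sub>C (A * B * E)" unfolding Y by (simp only: scaleC_mult_right scaleC_scaleC mult.assoc)
    finally show ?thesis .
  qed
  note mult[OF mult[OF r[of 0 t0] r[of 1 t1]] r[of 2 t2]]
  then show ?thesis
    by (simp add: mono_def scaleC_mult_left scaleC_scaleC mult.assoc del: One_nat_def)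
qed

text \<open>This separates the finite part of an identity, the comparison of local polynomials, from
  the arithmetic part, the comparison of exponents and scalars for general \<open>N\<close>.\<close>

lemma rep_eqI:
  assumes "rep X P c t0 t1 t2" "rep Y R d u0 u1 u2" "poly_eq P R"
    and "even t0 = even u0" "even t1 = even u1" "even t2 = even u2"
    and "c * of_int ((kap ! 0) ^ (t0 div 2) * (kap ! 1) ^ (t1 div 2) * (kap ! 2) ^ (t2 div 2)) =
      d * of_int ((kap ! 0) ^ (u0 div 2) * (kap ! 1) ^ (u1 div 2) * (kap ! 2) ^ (u2 div 2))"
  shows "X * E = Y * E"
proof -
  have "mono c t0 t1 t2 * E = mono d u0 u1 u2 * E"
    unfolding mono_reduce[of c t0] mono_reduce[of d u0] assms(7) using assms(4-6)
    by (simp add: mod2_eq_if)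
  moreover have "ev (x k) P = ev (x k) R" for k by (rule ev_poly_eq[OF assms(3)])
  ultimately show ?thesis using assms(1,2) by (simp add: rep_def mult.assoc)
qed

end

section \<open>The twist in a sector\<close>

definition letter :: "nat \<Rightarrow> cpoly" where
  "letter l = [((1, 0), [l])]"

lemma letter: "parity_poly False (letter l)" "ev x (letter l) = x l"
  by (simp_all add: letter_def parity_poly_def ev_simps gval_def scaleC_one)

text \<open>The arguments \<open>mp\<close>, \<open>pm\<close>, \<open>n1\<close>, \<open>n2\<close>
  represent \<open>fm k * K \<otimes> fp k\<close>, \<open>fp k * K \<otimes> fm k\<close>,
  \<open>fp k * fm k \<otimes> 1\<close> and \<open>1 \<otimes> fp k * fm k\<close>, or their images
  under an algebra map.\<close>

definition zeta_poly :: "int list \<Rightarrow> bool \<Rightarrow> bool \<Rightarrow> cpoly \<Rightarrow> cpoly \<Rightarrow> cpoly \<Rightarrow> cpoly \<Rightarrow> cpoly" where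
  "zeta_poly q a b mp pm n1 n2 =
    (if \<not> a then one_poly
     else if \<not> b then one_poly @ scale_poly (1, - 1) n2 @ scale_poly (1, - 1) mp @
       scale_poly (1, 1) pm @ scale_poly (- 2, 0) (mult_poly q n1 n2)
     else one_poly @ scale_poly (- 1, - 1) n2)"

text \<open>Here \<open>xp\<close>, \<open>xm\<close> stand for \<open>fp k \<otimes> 1\<close>,
  \<open>fm k \<otimes> 1\<close> and \<open>yp\<close>, \<open>ym\<close> for
  \<open>K \<otimes> fp k\<close>, \<open>K \<otimes> fm k\<close>. The sign \<open>sgb a\<close>
  removes the square of \<open>K\<close> that \<open>yp\<close> times \<open>ym\<close> leaves in
  the first tensor factor.\<close>

definition zeta_letters :: "int list \<Rightarrow> bool \<Rightarrow> bool \<Rightarrow> cpoly \<Rightarrow> cpoly \<Rightarrow> cpoly \<Rightarrow> cpoly \<Rightarrow> cpoly" where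
  "zeta_letters q a b xp xm yp ym =
    zeta_poly q a b (mult_poly q xm yp) (mult_poly q xp ym) (mult_poly q xp xm)
      (scale_poly (sgb a, 0) (mult_poly q yp ym))"

text \<open>The power of \<open>K\<close> closing \<open>zeta_10\<close> or \<open>zeta_11\<close>,
  and \<open>0\<close> where the twist acts as \<open>1\<close>.\<close>

definition zeta_exp :: "nat \<Rightarrow> bool \<Rightarrow> bool \<Rightarrow> nat" where
  "zeta_exp n a b = (if \<not> a then 0 else if \<not> b then 1 else n - 1)"

context sector
begin

text \<open>A generator lives at one site and is odd, so \<open>rep_mult\<close> does not apply to
  it. The even factors at the other sites commute with it, and the claim reduces to a check at site
  \<open>i\<close>.\<close>

lemma rep_intertwine:
  assumes X: "rep X P c t0 t1 t2" and Y: "Y * E = ev (x i) y * E" and Z: "Z * E = ev (x i) z * E"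
    and "poly_eq (mult_poly q P (flip_poly (odd t0) (odd t1) (odd t2) y)) (mult_poly q z P)"
  shows "X * Y * E = Z * X * E"
proof -
  let ?P = "oprod (\<lambda>k. ev (x k) P)" and ?M = "mono c t0 t1 t2"
    and ?y = "ev (x i) (flip_poly (odd t0) (odd t1) (odd t2) y)"
  have P: "even_poly P" and X: "X * E = ?P * ?M * E" using X by (simp_all add: rep_def)
  have *: "?P * ?y * E = ev (x i) z * ?P * E"
    using assms(4)[THEN ev_poly_eq, of "x i"]
    by (intro oprod_intertwine[where i = i]) (auto intro: central even_ev[OF P] simp flip: ev_mult)
  have "X * Y * E = ?P * ?M * ev (x i) y * E" by (rule mod_mult[OF X Y])
  also have "\<dots> = ?P * ?y * E * ?M" by (simp only: mono_ev mult.assoc central[of ?M])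
  also have "\<dots> = ev (x i) z * (?P * ?M) * E" unfolding * by (simp only: mult.assoc central[of ?M])
  also have "\<dots> = Z * X * E" by (rule mod_mult[OF Z X, symmetric])
  finally show ?thesis .
qed

text \<open>The map \<open>h\<close> will be the identity, the conjugated flip, or one of the maps
  to the tensor cube. By \<open>hE\<close> the image of exactly one idempotent survives next to
  \<open>E\<close>, which selects the summand of \<open>zeta\<close>.\<close>

lemma rep_zeta:
  fixes h :: "'n sf \<otimes> 'n sf \<Rightarrow> 'a"
  assumes h: "alg_hom h"
    and hE: "\<And>c d. h (eb c \<otimes> eb d) * E = (if c = a \<and> d = b then E else 0)"
    and mp: "\<And>k. h (fm k * K \<otimes> fp k) * E = ev (x k) mp * E"
    and pm: "\<And>k. h (fp k * K \<otimes> fm k) * E = ev (x k) pm * E"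
    and n1: "\<And>k. h (fp k * fm k \<otimes> 1) * E = ev (x k) n1 * E"
    and n2: "\<And>k. h (1 \<otimes> fp k * fm k) * E = ev (x k) n2 * E"
    and even: "even_poly mp" "even_poly pm" "even_poly n1" "even_poly n2"
    and hK: "h (1 \<otimes> K) * E = mono s t0 t1 t2 * E"
    and z: "z = zeta_exp CARD('n) a b"
  shows "rep (h zeta) (zeta_poly q a b mp pm n1 n2) (s ^ z) (z * t0) (z * t1) (z * t2)"
proof -
  note hom = alg_homD[OF h]
  have diff: "h (x - y) = h x - h y" for x y
    using h by (simp add: alg_hom_clinear clinear_diff)
  have e: "e 0 = (eb False :: 'n sf)" "e 1 = (eb True :: 'n sf)" by simp_all
  \<comment> \<open>Splitting the first summand of \<open>zeta\<close> over the second index lets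
    \<open>hE\<close> evaluate it.\<close>
  have "e 0 \<otimes> 1 = eb False \<otimes> eb False + (eb False \<otimes> eb True :: 'n sf \<otimes> 'n sf)"
    by (simp only: e sum_e[symmetric] tensor_add_right)
  then have "h zeta * E = (if \<not> a then E else if \<not> b then h zeta_10 * E else h zeta_11 * E)"
    unfolding zeta_def hom e
    by (cases a; cases b) (simp_all only: hom distrib_right mult.assoc hE if_True if_False simp_thms
        mult_zero_right add_0_left add_0_right)
  moreover have "rep (h zeta_10) (zeta_poly q True False mp pm n1 n2) (1 * s) (0 + t0) (0 + t1) (0 + t2)"
    unfolding zeta_10_def hom alg_hom_oprod[OF h]
  proof (intro rep_mult_mono rep_oprod hK)
    fix k
    have "h (fp k * fm k \<otimes> fp k * fm k) = h (fp k * fm k \<otimes> 1) * h (1 \<otimes> fp k * fm k)"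
      unfolding hom(4)[symmetric] by (simp add: tensor_mult)
    also have "\<dots> * E = ev (x k) (mult_poly q n1 n2) * E"
      unfolding ev_mult by (rule mod_mult[OF n1 n2])
    finally have 4: "h (fp k * fm k \<otimes> fp k * fm k) * E = ev (x k) (mult_poly q n1 n2) * E" .
    show "h (1 + (1 - \<i>) *\<^sub>C (1 \<otimes> fp k * fm k) + (1 - \<i>) *\<^sub>C (fm k * K \<otimes> fp k)
        + (1 + \<i>) *\<^sub>C (fp k * K \<otimes> fm k) - 2 *\<^sub>C (fp k * fm k \<otimes> fp k * fm k)) * E
        = ev (x k) (zeta_poly q True False mp pm n1 n2) * E"
      unfolding diff hom
      by (simp add: zeta_poly_def ev_simps ev_scale_poly one_poly distrib_right left_diff_distrib
          scaleC_mult_left mp pm n2 4 gval_def scaleC_minus_left)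
  qed (use even in \<open>simp add: zeta_poly_def parity_append one_poly parity_scale_poly even_mult_poly\<close>)
  moreover have "rep (h zeta_11) (zeta_poly q True True mp pm n1 n2) (1 * s ^ n)
      (0 + n * t0) (0 + n * t1) (0 + n * t2)" if "n = CARD('n) - 1" for n
    unfolding zeta_11_def hom alg_hom_oprod[OF h]
  proof (intro rep_mult_mono rep_oprod)
    have "1 \<otimes> K ^ (CARD('n) - 1) = (1 \<otimes> K :: 'n sf \<otimes> 'n sf) ^ n"
      by (simp add: tensor_power that)
    then show "h (1 \<otimes> K ^ (CARD('n) - 1)) * E = mono (s ^ n) (n * t0) (n * t1) (n * t2) * E"
      by (simp only: alg_hom_power[OF h] mod_power[OF hK] mono_power)
  next
    fix k
    show "h (1 - (1 + \<i>) *\<^sub>C (1 \<otimes> fp k * fm k)) * E = ev (x k) (zeta_poly q True True mp pm n1 n2) * E"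
      unfolding diff hom
      by (simp add: zeta_poly_def ev_simps ev_scale_poly one_poly distrib_right left_diff_distrib
          scaleC_mult_left n2 gval_def scaleC_minus_left scaleC_diff_left scaleC_add_left)
  qed (use even in \<open>simp add: zeta_poly_def parity_append one_poly parity_scale_poly even_mult_poly\<close>)
  ultimately show ?thesis
    using rep_one[of "h zeta"] rep_cong[of "h zeta" "h zeta_10"] rep_cong[of "h zeta" "h zeta_11"]
    by (cases a; cases b) (simp_all add: z zeta_exp_def zeta_poly_def[of _ False])
qed

text \<open>Each quadratic term of the twist is a product of two letters, up to a square of
  \<open>K\<close>, so the images of the letters determine its image.\<close>

lemma rep_zeta_letters:
  fixes h :: "'n sf \<otimes> 'n sf \<Rightarrow> 'a"
  assumes h: "alg_hom h"
    and hE: "\<And>c d. h (eb c \<otimes> eb d) * E = (if c = a \<and> d = b then E else 0)"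
    and xp: "\<And>k. h (fp k \<otimes> 1) * E = ev (x k) xp * E"
    and xm: "\<And>k. h (fm k \<otimes> 1) * E = ev (x k) xm * E"
    and yp: "\<And>k. h (K \<otimes> fp k) * E = ev (x k) yp * E"
    and ym: "\<And>k. h (K \<otimes> fm k) * E = ev (x k) ym * E"
    and odd: "parity_poly False xp" "parity_poly False xm" "parity_poly False yp" "parity_poly False ym"
    and hK: "h (1 \<otimes> K) * E = mono s t0 t1 t2 * E"
    and z: "z = zeta_exp CARD('n) a b"
  shows "rep (h zeta) (zeta_letters q a b xp xm yp ym) (s ^ z) (z * t0) (z * t1) (z * t2)"
  unfolding zeta_letters_def
proof (rule rep_zeta[OF h hE])
  have split: "h (f * g) * E = ev (x k) (mult_poly q P Q) * E"
    if "h f * E = ev (x k) P * E" "h g * E = ev (x k) Q * E" for f g k P Q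
    unfolding alg_homD(4)[OF h] ev_mult by (rule mod_mult[OF that])
  show "h (fm k * K \<otimes> fp k) * E = ev (x k) (mult_poly q xm yp) * E" for k
    using split[OF xm yp, of k] by (simp add: tensor_mult)
  show "h (fp k * K \<otimes> fm k) * E = ev (x k) (mult_poly q xp ym) * E" for k
    using split[OF xp ym, of k] by (simp add: tensor_mult)
  show "h (fp k * fm k \<otimes> 1) * E = ev (x k) (mult_poly q xp xm) * E" for k
    using split[OF xp xm, of k] by (simp add: tensor_mult)
  show "h (1 \<otimes> fp k * fm k) * E = ev (x k) (scale_poly (sgb a, 0) (mult_poly q yp ym)) * E" for k
  proof -
    let ?F = "1 \<otimes> fp k * fm k" and ?P = "eb a \<otimes> eb b"
    \<comment> \<open>The image of the idempotent acts as \<open>1\<close> on \<open>E\<close>;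
      inserting it makes the square of \<open>K\<close> a sign before \<open>h\<close> is
      applied.\<close>
    have absorb: "h X * E = h (X * ?P) * E" for X
    proof -
      have "h X * E = h X * (h ?P * E)" using hE[of a b] by simp
      then show ?thesis by (simp add: alg_homD[OF h] mult.assoc)
    qed
    have sq: "(K \<otimes> fp k) * (K \<otimes> fm k) * ?P = sgb a *\<^sub>C (?F * ?P)"
      by (simp only: tensor_mult mult.assoc K2_e[unfolded mult.assoc] tensor_scaleC_left mult_1_left)
    have "h ((K \<otimes> fp k) * (K \<otimes> fm k)) * E = h (sgb a *\<^sub>C (?F * ?P)) * E"
      unfolding sq[symmetric] by (rule absorb)
    then have "h ((K \<otimes> fp k) * (K \<otimes> fm k)) * E = sgb a *\<^sub>C (h ?F * E)"
      unfolding alg_homD(2)[OF h] scaleC_mult_left absorb[of ?F, symmetric] .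
    with split[OF yp ym, of k] show ?thesis
      by (cases a) (simp_all add: ev_scale_poly gval_def scaleC_one scaleC_minus_left eq_neg_iff_add_eq_0
          minus_equation_iff)
  qed
qed (use odd hK z in \<open>auto intro!: parity_scale_poly parity_mult_poly[of False _ False, simplified]\<close>)

end

section \<open>The sectors of the tensor square and the tensor cube\<close>

definition ff :: "bool \<Rightarrow> 'n \<Rightarrow> 'n sf" where
  "ff s i = (if s then fm i else fp i)"

lemma ff_rules:
  "ff s i * K = - (K * ff s i)"
  "ff s i * ff t j + ff t j * ff s i = (if i = j \<and> s \<noteq> t then e 1 else 0)"
proof -
  have "fm i * fp j + fp j * fm i = (if i = j then e 1 else 0)"
    using sf_rules(5)[of j i] by (simp only: add.commute eq_commute)
  then show "ff s i * K = - (K * ff s i)"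
    "ff s i * ff t j + ff t j * ff s i = (if i = j \<and> s \<noteq> t then e 1 else 0)"
    by (cases s; cases t; simp add: ff_def sf_rules del: One_nat_def)+
qed

lemma ff_distinct: "i \<noteq> j \<Longrightarrow> ff s i * ff t j = - (ff t j * ff s i)"
  using ff_rules(2)[of s i t j] by (simp add: eq_neg_iff_add_eq_0)

lemma e1_eb: "e 1 * eb a = of_bool a *\<^sub>C eb a"
  using e_mult[of True a] by (cases a) (simp_all add: scaleC_one)

(* The factors K to the left of f make letters in different tensor factors anticommute. *)
definition x2 :: "'n \<Rightarrow> nat \<Rightarrow> 'n sf \<otimes> 'n sf" where
  "x2 k l = (if l div 2 = 0 then ff (odd l) k \<otimes> 1 else if l div 2 = 1 then K \<otimes> ff (odd l) k else 0)"

text \<open>The locale \<open>sector\<close> has three slots; with two tensor factors the third is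
  filled by \<open>1\<close>, whose square is the last entry of the list in
  \<open>sector2\<close>.\<close>

definition kk2 :: "nat \<Rightarrow> 'n sf \<otimes> 'n sf" where
  "kk2 m = (if m = 0 then K \<otimes> 1 else if m = 1 then 1 \<otimes> K else 1)"

text \<open>The letters of the second mode have anticommutator \<open>(K * K) \<otimes> e 1\<close>,
  whence the sign \<open>sgb a\<close>.\<close>

definition q2 :: "bool \<Rightarrow> bool \<Rightarrow> int list" where
  "q2 a b = [of_bool a, sgb a * of_bool b]"

definition x3 :: "'n \<Rightarrow> nat \<Rightarrow> 'n sf \<otimes> 'n sf \<otimes> 'n sf" where
  "x3 k l = (if l div 2 = 0 then ff (odd l) k \<otimes> 1 \<otimes> 1 else if l div 2 = 1 then K \<otimes> ff (odd l) k \<otimes> 1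
     else if l div 2 = 2 then K \<otimes> K \<otimes> ff (odd l) k else 0)"

definition kk3 :: "nat \<Rightarrow> 'n sf \<otimes> 'n sf \<otimes> 'n sf" where
  "kk3 m = (if m = 0 then K \<otimes> 1 \<otimes> 1 else if m = 1 then 1 \<otimes> K \<otimes> 1 else if m = 2 then 1 \<otimes> 1 \<otimes> K else 1)"

definition q3 :: "bool \<Rightarrow> bool \<Rightarrow> bool \<Rightarrow> int list" where
  "q3 a b c = [of_bool a, sgb a * of_bool b, sgb a * sgb b * of_bool c]"

lemma pairing_eq: "pairing q l m = (if l div 2 = m div 2 \<and> odd l \<noteq> odd m then entry q (l div 2) else 0)"
proof -
  have "l = m" if "l div 2 = m div 2" "odd l = odd m"
    by (metis that div_mult_mod_eq parity_cases)
  then show ?thesis by (auto simp: pairing_def)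
qed

lemma anticomm_ff:
  "(ff s k * ff t k + ff t k * ff s k) * eb a = of_int (if s \<noteq> t then of_bool a else 0) *\<^sub>C eb a"
  by (simp only: ff_rules(2)) (simp add: e1_eb del: One_nat_def of_bool_eq)

lemma anticomm_left:
  "((ff s k \<otimes> 1) * (ff t k \<otimes> 1) + (ff t k \<otimes> 1) * (ff s k \<otimes> 1)) * (eb a \<otimes> Z) =
    of_int (if s \<noteq> t then of_bool a else 0) *\<^sub>C (eb a \<otimes> Z)"
proof -
  have *: "(ff s k \<otimes> 1) * (ff t k \<otimes> 1) + (ff t k \<otimes> 1) * (ff s k \<otimes> 1) =
      (ff s k * ff t k + ff t k * ff s k) \<otimes> 1"
    by (simp add: tensor_mult tensor_add_left)
  show ?thesis unfolding * by (simp only: tensor_mult anticomm_ff mult_1_left tensor_scaleC_left)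
qed

text \<open>A further factor \<open>K\<close> on the left multiplies the anticommutator by its
  square, a sign in the sector; iteration reaches the third tensor factor.\<close>

lemma anticomm_right:
  assumes "(X * Y + Y * X) * Z = of_int n *\<^sub>C Z"
  shows "((K \<otimes> X) * (K \<otimes> Y) + (K \<otimes> Y) * (K \<otimes> X)) * (eb a \<otimes> Z) =
    of_int (sgb a * n) *\<^sub>C (eb a \<otimes> Z)"
proof -
  have *: "(K \<otimes> X) * (K \<otimes> Y) + (K \<otimes> Y) * (K \<otimes> X) = (K * K) \<otimes> (X * Y + Y * X)"
    by (simp add: tensor_mult tensor_add_right)
  show ?thesis
    unfolding * unfolding tensor_mult K2_e assms tensor_scaleC_left tensor_scaleC_right scaleC_scaleC
    by simp
qed

lemma div2_cases:
  obtains "l div 2 = (0::nat)" | "l div 2 = 1" | "l div 2 = 2" | "l div 2 \<ge> 3"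
  by linarith

lemma x2_simps:
  "l div 2 = 0 \<Longrightarrow> x2 k l = ff (odd l) k \<otimes> 1" "l div 2 = 1 \<Longrightarrow> x2 k l = K \<otimes> ff (odd l) k"
  by (simp_all add: x2_def)

lemma x3_simps:
  "l div 2 = 0 \<Longrightarrow> x3 k l = ff (odd l) k \<otimes> 1" "l div 2 = 1 \<Longrightarrow> x3 k l = K \<otimes> ff (odd l) k \<otimes> 1"
  "l div 2 = 2 \<Longrightarrow> x3 k l = K \<otimes> K \<otimes> ff (odd l) k"
  by (simp_all add: x3_def one_tensor_def)

lemma sector2:
  "sector (eb a \<otimes> eb b) (q2 a b) [sgb a, sgb b, 1] (x2 :: 'n::{finite,linorder} \<Rightarrow> _) kk2"
proof
  fix X :: "'n sf \<otimes> 'n sf" and j k :: 'n and l m n :: nat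
  let ?E = "eb a \<otimes> eb b :: 'n sf \<otimes> 'n sf"
  show "?E * X = X * ?E" by (intro tensor_central e_central)
  have diag: "(x2 k l * x2 k m + x2 k m * x2 k l) * ?E = of_int (pairing (q2 a b) l m) *\<^sub>C ?E"
    if "l div 2 = m div 2"
  proof (rule div2_cases[of l])
    assume l: "l div 2 = 0"
    then have m: "m div 2 = 0" using that by simp
    show ?thesis
      unfolding x2_simps(1)[OF l] x2_simps(1)[OF m] anticomm_left pairing_eq l m by (simp add: q2_def)
  next
    assume l: "l div 2 = 1"
    then have m: "m div 2 = 1" using that by simp
    show ?thesis
      unfolding x2_simps(2)[OF l] x2_simps(2)[OF m] anticomm_right[OF anticomm_ff] pairing_eq l m by (simp add: q2_def)
  next
    assume l: "l div 2 = 2"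
    then have m: "m div 2 = 2" using that by simp
    show ?thesis
      using l m by (simp add: x2_def pairing_eq q2_def)
  next
    assume l: "l div 2 \<ge> 3"
    then have m: "m div 2 \<ge> 3" using that by simp
    show ?thesis
      using l m by (simp add: x2_def pairing_eq q2_def)
  qed
  \<comment> \<open>In different modes the \<open>K\<close> in front of the later letter produces
    the sign; in the same mode at different sites the defining relations do.\<close>
  have off: "x2 i l * x2 k m = - (x2 k m * x2 i l)" if "l div 2 \<noteq> m div 2 \<or> i \<noteq> k" for i
    using that ff_distinct[of i k "odd l" "odd m"]
    by (auto simp: x2_def tensor_mult ff_rules(1) tensor_minus_left tensor_minus_right)
  show "(x2 k l * x2 k m + x2 k m * x2 k l) * ?E = of_int (pairing (q2 a b) l m) *\<^sub>C ?E"
    using diag off[of k] by (cases "l div 2 = m div 2") (auto simp: pairing_eq)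
  show "j \<noteq> k \<Longrightarrow> x2 j l * x2 k m = - (x2 k m * x2 j l)" using off by blast
  show "kk2 m * x2 k l = (if l div 2 = m then - (x2 k l * kk2 m) else x2 k l * kk2 m)"
    by (auto simp: x2_def kk2_def tensor_mult ff_rules(1) tensor_minus_left tensor_minus_right)
  show "kk2 m * kk2 n = kk2 n * (kk2 m :: 'n sf \<otimes> 'n sf)"
    by (auto simp: kk2_def tensor_mult)
  show "m < 3 \<Longrightarrow> kk2 m * kk2 m * ?E = of_int ([sgb a, sgb b, 1] ! m) *\<^sub>C ?E"
    by (auto simp: kk2_def tensor_mult K2_e[unfolded mult.assoc] mult.assoc tensor_scaleC_left tensor_scaleC_right scaleC_one
        scaleC_minus_left less_Suc_eq numeral_3_eq_3 simp del: of_bool_eq)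
qed

lemma sector3:
  "sector (eb a \<otimes> eb b \<otimes> eb c) (q3 a b c) [sgb a, sgb b, sgb c] (x3 :: 'n::{finite,linorder} \<Rightarrow> _) kk3"
proof
  fix X :: "'n sf \<otimes> 'n sf \<otimes> 'n sf" and j k :: 'n and l m n :: nat
  let ?E = "eb a \<otimes> eb b \<otimes> eb c :: 'n sf \<otimes> 'n sf \<otimes> 'n sf"
  show "?E * X = X * ?E" by (intro tensor_central e_central)
  have diag: "(x3 k l * x3 k m + x3 k m * x3 k l) * ?E = of_int (pairing (q3 a b c) l m) *\<^sub>C ?E"
    if "l div 2 = m div 2"
  proof (rule div2_cases[of l])
    assume l: "l div 2 = 0"
    then have m: "m div 2 = 0" using that by simp
    show ?thesis
      unfolding x3_simps(1)[OF l] x3_simps(1)[OF m] anticomm_left pairing_eq l m by (simp add: q3_def)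
  next
    assume l: "l div 2 = 1"
    then have m: "m div 2 = 1" using that by simp
    show ?thesis
      unfolding x3_simps(2)[OF l] x3_simps(2)[OF m] anticomm_right[OF anticomm_left] pairing_eq l m by (simp add: q3_def)
  next
    assume l: "l div 2 = 2"
    then have m: "m div 2 = 2" using that by simp
    show ?thesis
      unfolding x3_simps(3)[OF l] x3_simps(3)[OF m] anticomm_right[OF anticomm_right[OF anticomm_ff]] pairing_eq l m by (simp add: q3_def)
  next
    assume l: "l div 2 \<ge> 3"
    then have m: "m div 2 \<ge> 3" using that by simp
    show ?thesis
      using l m by (simp add: x3_def pairing_eq q3_def)
  qed
  have off: "x3 i l * x3 k m = - (x3 k m * x3 i l)" if "l div 2 \<noteq> m div 2 \<or> i \<noteq> k" for i
    using that ff_distinct[of i k "odd l" "odd m"]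
    by (auto simp: x3_def tensor_mult ff_rules(1) tensor_minus_left tensor_minus_right)
  show "(x3 k l * x3 k m + x3 k m * x3 k l) * ?E = of_int (pairing (q3 a b c) l m) *\<^sub>C ?E"
    using diag off[of k] by (cases "l div 2 = m div 2") (auto simp: pairing_eq)
  show "j \<noteq> k \<Longrightarrow> x3 j l * x3 k m = - (x3 k m * x3 j l)" using off by blast
  show "kk3 m * x3 k l = (if l div 2 = m then - (x3 k l * kk3 m) else x3 k l * kk3 m)"
    by (auto simp: x3_def kk3_def tensor_mult ff_rules(1) tensor_minus_left tensor_minus_right)
  show "kk3 m * kk3 n = kk3 n * (kk3 m :: 'n sf \<otimes> 'n sf \<otimes> 'n sf)"
    by (auto simp: kk3_def tensor_mult)
  show "m < 3 \<Longrightarrow> kk3 m * kk3 m * ?E = of_int ([sgb a, sgb b, sgb c] ! m) *\<^sub>C ?E"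
    by (auto simp: kk3_def tensor_mult K2_e[unfolded mult.assoc] mult.assoc tensor_scaleC_left tensor_scaleC_right scaleC_one
        scaleC_minus_left less_Suc_eq numeral_3_eq_3 simp del: of_bool_eq)
qed

section \<open>Twisting the coproduct\<close>

(* Here and below s stands for the parity of N; in the sector (a, b), the coproducts of K and of f
   act as mu K \<otimes> K and as f \<otimes> 1 + tau K \<otimes> f (for Delta_hat) or f \<otimes> 1 + om K \<otimes> f (for Delta). *)
definition mu :: "bool \<Rightarrow> bool \<Rightarrow> bool \<Rightarrow> int" where
  "mu s a b = (if a \<and> b then - sgb s else 1)"

definition tau :: "bool \<Rightarrow> bool \<Rightarrow> bool \<Rightarrow> int" where
  "tau s a b = (if a \<and> b then sgb s else sgb a)"

definition zpar :: "bool \<Rightarrow> bool \<Rightarrow> bool \<Rightarrow> bool" where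
  "zpar s a b \<longleftrightarrow> a \<and> \<not> (b \<and> s)"

text \<open>The exponent \<open>N - 1\<close> has the parity opposite to \<open>N\<close> because
  \<open>N > 0\<close>.\<close>

lemma odd_zeta_exp: "odd (zeta_exp CARD('n::finite) a b) = zpar (odd CARD('n)) a b"
proof -
  have "CARD('n) > 0" by (rule zero_less_card_finite)
  then show ?thesis by (auto simp: zeta_exp_def zpar_def)
qed

lemma minus_one_pow: "(- 1) ^ n = (sgb (odd n) :: complex)"
  by simp

lemma e1_absorb: "e 1 * (X * eb a) = of_bool a *\<^sub>C (X * eb a)"
proof -
  have "e 1 * (X * eb a) = X * (e 1 * eb a)"
    by (subst e_central) (simp only: mult.assoc e_central[of 1 "eb a"])
  then show ?thesis by (simp only: e1_eb scaleC_mult_right)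
qed

lemma e1_tensor_absorb: "(e 1 \<otimes> e 1) * (X \<otimes> Y) * (eb a \<otimes> eb b) =
    of_bool (a \<and> b) *\<^sub>C ((X \<otimes> Y) * (eb a \<otimes> eb b))"
  by (simp only: tensor_mult mult.assoc e1_absorb tensor_scaleC_left tensor_scaleC_right
      scaleC_scaleC of_bool_conj mult.commute[of "of_bool b"])

lemma Delta_K_sector:
  "Delta_K * (eb a \<otimes> eb b) = of_int (mu (odd CARD('n)) a b) *\<^sub>C ((K \<otimes> K) * (eb a \<otimes> eb b) :: 'n sf \<otimes> 'n sf)"
proof -
  have "Delta_K * (eb a \<otimes> eb b) = (1 - (1 + sgb (odd CARD('n))) * of_bool (a \<and> b)) *\<^sub>C
      ((K \<otimes> K) * (eb a \<otimes> eb b) :: 'n sf \<otimes> 'n sf)"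
    unfolding Delta_K_def minus_one_pow left_diff_distrib scaleC_mult_left e1_tensor_absorb
      scaleC_scaleC by (simp only: scaleC_diff_left scaleC_one)
  also have "1 - (1 + sgb (odd CARD('n))) * of_bool (a \<and> b) = (of_int (mu (odd CARD('n)) a b) :: complex)"
    by (simp add: mu_def)
  finally show ?thesis .
qed

lemma Delta_hat_ff_def: "Delta_hat (ff t i) =
  ff t i \<otimes> 1 + Kinv \<otimes> ff t i - (1 + (- 1) ^ CARD('n)) *\<^sub>C ((e 1 \<otimes> e 1) * (Kinv \<otimes> ff t i))"
  for i :: 'n
  by (simp add: ff_def Delta_hat_generators Delta_hat_fp_def Delta_hat_fm_def)

lemma Kinv_eb: "Kinv * eb a = sgb a *\<^sub>C (K * eb a)"
  by (simp only: power3_eq_cube mult.assoc K2_e[unfolded mult.assoc] scaleC_mult_right)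

lemma Delta_hat_sector:
  fixes i :: 'n
  shows "Delta_hat (ff t i) * (eb a \<otimes> eb b) =
    (ff t i \<otimes> 1 + of_int (tau (odd CARD('n)) a b) *\<^sub>C (K \<otimes> ff t i)) * (eb a \<otimes> eb b)"
proof -
  have 1: "(Kinv \<otimes> ff t i) * (eb a \<otimes> eb b) = sgb a *\<^sub>C ((K \<otimes> ff t i) * (eb a \<otimes> eb b))"
    by (simp only: tensor_mult Kinv_eb tensor_scaleC_left)
  have 2: "(e 1 \<otimes> e 1) * (Kinv \<otimes> ff t i) * (eb a \<otimes> eb b) =
      (of_bool (a \<and> b) * sgb a) *\<^sub>C ((K \<otimes> ff t i) * (eb a \<otimes> eb b))"
    unfolding e1_tensor_absorb 1 scaleC_scaleC ..
  have "Delta_hat (ff t i) * (eb a \<otimes> eb b) = (ff t i \<otimes> 1) * (eb a \<otimes> eb b) +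
      (sgb a - (1 + sgb (odd CARD('n))) * (of_bool (a \<and> b) * sgb a)) *\<^sub>C
      ((K \<otimes> ff t i) * (eb a \<otimes> eb b))"
    unfolding Delta_hat_ff_def minus_one_pow left_diff_distrib distrib_right scaleC_mult_left 1 2
      scaleC_scaleC by (simp only: scaleC_diff_left add_diff_eq)
  also have "sgb a - (1 + sgb (odd CARD('n))) * (of_bool (a \<and> b) * sgb a) =
      (of_int (tau (odd CARD('n)) a b) :: complex)"
    by (simp add: tau_def)
  finally show ?thesis by (simp only: distrib_right scaleC_mult_left)
qed

definition om :: "bool \<Rightarrow> bool \<Rightarrow> gauss" where
  "om t a = (if a then (0, sgb t) else (1, 0))"

lemma omega_eb:
  "omega_p * eb a = gval (om False a) *\<^sub>C (K * eb a)" "omega_m * eb a = gval (om True a) *\<^sub>C (K * eb a)"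
proof -
  have *: "(1 - c *\<^sub>C e 1) * K * eb a = (1 - c * of_bool a) *\<^sub>C (K * eb a)" for c
    by (simp only: left_diff_distrib mult_1_left scaleC_mult_left mult.assoc e1_absorb scaleC_scaleC
        scaleC_diff_left scaleC_one)
  show "omega_p * eb a = gval (om False a) *\<^sub>C (K * eb a)" "omega_m * eb a = gval (om True a) *\<^sub>C (K * eb a)"
    unfolding omega_alt * by (simp_all add: om_def gval_def)
qed

lemma Delta_sector:
  "Delta (ff t i) * (eb a \<otimes> eb b) = (ff t i \<otimes> 1 + gval (om t a) *\<^sub>C (K \<otimes> ff t i)) * (eb a \<otimes> eb b)"
  by (cases t)
    (simp_all only: ff_def if_True if_False Delta_generators Delta_fp_def Delta_fm_def distrib_right
      tensor_mult omega_eb tensor_scaleC_left scaleC_mult_left)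

definition pair_poly :: "gauss \<Rightarrow> nat \<Rightarrow> nat \<Rightarrow> cpoly" where
  "pair_poly c l m = letter l @ scale_poly c (letter m)"

lemma pair_poly: "parity_poly False (pair_poly c l m)" "ev x (pair_poly c l m) = x l + gval c *\<^sub>C x m"
  by (simp_all add: pair_poly_def parity_append parity_scale_poly letter ev_simps ev_scale_poly)

lemma gval_int: "gval (n, 0) = of_int n"
  by (simp add: gval_def)

definition zeta2 :: "bool \<Rightarrow> bool \<Rightarrow> cpoly" where
  "zeta2 a b = zeta_letters (q2 a b) a b (letter 0) (letter 1) (letter 2) (letter 3)"

lemma x2_letter: "x2 k (of_bool t) = ff t k \<otimes> 1" "x2 k (2 + of_bool t) = K \<otimes> ff t k"
  "x2 k 0 = fp k \<otimes> 1" "x2 k 1 = fm k \<otimes> 1" "x2 k 2 = K \<otimes> fp k" "x2 k 3 = K \<otimes> fm k"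
  by (cases t; simp add: x2_def ff_def)+

lemma E2_mult: "(eb c \<otimes> eb d) * (eb a \<otimes> eb b) = (if c = a \<and> d = b then eb a \<otimes> eb b else 0)"
  by (simp add: tensor_mult e_mult del: of_bool_eq)

lemma rep_zeta2:
  fixes a b :: bool
  defines "z \<equiv> zeta_exp CARD('n::{finite,linorder}) a b"
  shows "sector.rep (eb a \<otimes> eb b) (x2 :: 'n \<Rightarrow> _) kk2 zeta (zeta2 a b) 1 0 z 0"
proof -
  interpret sector "eb a \<otimes> eb b" "q2 a b" "[sgb a, sgb b, 1]" "x2 :: 'n \<Rightarrow> _" kk2 by (rule sector2)
  have "rep (id zeta) (zeta2 a b) (1 ^ z) (z * 0) (z * 1) (z * 0)"
    unfolding zeta2_def
    by (rule rep_zeta_letters[OF alg_hom_id])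
      (simp_all add: E2_mult x2_letter letter z_def mono_def kk2_def scaleC_one x2_letter(4)[simplified]
        del: of_bool_eq)
  then show ?thesis by simp
qed

text \<open>The Booleans are the sector, the parity of \<open>N\<close> and the choice between
  \<open>fp\<close> and \<open>fm\<close>: sixteen evaluations settle the intertwining of these
  generators for every \<open>N\<close>.\<close>

lemma twist_letters_check:
  "\<forall>a b s t. poly_eq
     (mult_poly (q2 a b) (zeta2 a b) (flip_poly False (zpar s a b) False
       (pair_poly (tau s a b, 0) (of_bool t) (2 + of_bool t))))
     (mult_poly (q2 a b) (pair_poly (om t a) (of_bool t) (2 + of_bool t)) (zeta2 a b))"
  by code_simp

text \<open>The coproduct of \<open>K\<close> is a monomial with \<open>K\<close> in both factors;
  it flips every letter and therefore fixes the even polynomial \<open>zeta2 a b\<close>.\<close>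

lemma twist_K_check:
  "\<forall>a b s. poly_eq (mult_poly (q2 a b) (zeta2 a b) (flip_poly False (zpar s a b) False one_poly))
     (mult_poly (q2 a b) one_poly (flip_poly True True False (zeta2 a b)))"
  by code_simp

text \<open>Both coproducts are algebra maps, so it suffices to intertwine generators: across a
  product the twist moves past one factor at a time.\<close>

lemma zeta_Delta_hat: "zeta * Delta_hat x = Delta x * (zeta :: 'n::{finite,linorder} sf \<otimes> 'n sf)"
proof (induction x rule: sf_induct)
  have gen: "zeta * Delta_hat (ff t i) = Delta (ff t i) * zeta" for t and i :: 'n
  proof (rule tensor_sector_eqI)
    fix a b
    interpret sector "eb a \<otimes> eb b" "q2 a b" "[sgb a, sgb b, 1]" "x2 :: 'n \<Rightarrow> _" kk2 by (rule sector2)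
    show "zeta * Delta_hat (ff t i) * (eb a \<otimes> eb b) = Delta (ff t i) * zeta * (eb a \<otimes> eb b)"
    proof (rule rep_intertwine[OF rep_zeta2])
      show "Delta_hat (ff t i) * (eb a \<otimes> eb b) = ev (x2 i) (pair_poly (tau (odd CARD('n)) a b, 0)
          (of_bool t) (2 + of_bool t)) * (eb a \<otimes> eb b)"
        by (simp only: Delta_hat_sector pair_poly x2_letter gval_int)
      show "Delta (ff t i) * (eb a \<otimes> eb b) =
          ev (x2 i) (pair_poly (om t a) (of_bool t) (2 + of_bool t)) * (eb a \<otimes> eb b)"
        by (simp only: Delta_sector pair_poly x2_letter)
    qed (use twist_letters_check in \<open>simp only: odd_zeta_exp even_zero simp_thms\<close>)
  qed
  show "zeta * Delta_hat (fp i) = Delta (fp i) * zeta" "zeta * Delta_hat (fm i) = Delta (fm i) * zeta" for i :: 'n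
    using gen[of False i] gen[of True i] by (simp_all add: ff_def)
  show "zeta * Delta_hat K = Delta K * (zeta :: 'n sf \<otimes> 'n sf)"
    unfolding Delta_generators Delta_hat_generators
  proof (rule tensor_sector_eqI)
    fix a b
    interpret sector "eb a \<otimes> eb b" "q2 a b" "[sgb a, sgb b, 1]" "x2 :: 'n \<Rightarrow> _" kk2 by (rule sector2)
    have K: "rep (Delta_K :: 'n sf \<otimes> 'n sf) one_poly (of_int (mu (odd CARD('n)) a b)) 1 1 0"
      by (rule rep_mono) (simp add: Delta_K_sector mono_def kk2_def tensor_mult scaleC_mult_left
          del: of_bool_eq)
    show "zeta * Delta_K * (eb a \<otimes> eb b) = Delta_K * zeta * (eb a \<otimes> eb b :: 'n sf \<otimes> 'n sf)"
      by (rule rep_eqI[OF rep_mult[OF rep_zeta2 K] rep_mult[OF K rep_zeta2]])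
        (use twist_K_check in \<open>simp_all add: odd_zeta_exp del: of_bool_eq\<close>)
  qed
next
  case (mult x y)
  have "zeta * (Delta_hat x * Delta_hat y) = Delta x * (zeta * Delta_hat y)"
    by (simp only: mult.assoc[symmetric] mult.IH(1))
  then show ?case
    by (simp only: alg_homD(4)[OF alg_hom_Delta] alg_homD(4)[OF alg_hom_Delta_hat] mult.IH(2) mult.assoc)
qed (simp_all add: alg_homD[OF alg_hom_Delta] alg_homD[OF alg_hom_Delta_hat] scaleC_mult_left
    scaleC_mult_right distrib_left distrib_right)

section \<open>Invertibility and normalisation of the twist\<close>

(* The local factor of zeta_10 is 1 + x with x ^ 3 = 0, and the one of zeta_11 is 1 - (1 + \<i>) n
   with n idempotent, whose inverse is 1 + (\<i> - 1) n. *)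
definition inv_poly :: "bool \<Rightarrow> bool \<Rightarrow> cpoly" where
  "inv_poly a b = (if \<not> a then one_poly else if \<not> b then
     [((1, 0), []), ((- 1, - 1), [2, 3]), ((- 1, 1), [1, 2]), ((- 1, - 1), [0, 3]), ((2, 0), [0, 1, 2, 3])]
     else [((1, 0), []), ((1, - 1), [2, 3])])"

lemma even_inv_poly: "even_poly (inv_poly a b)"
  by (simp add: inv_poly_def one_poly) (simp add: parity_poly_def)

text \<open>The exponent \<open>3 * z\<close> inverts \<open>K ^ z\<close> because
  \<open>K ^ 4 = 1\<close>. The monomial stands on the left since inversion reverses the order of
  product and monomial.\<close>

definition zeta_inv :: "'n::{finite,linorder} sf \<otimes> 'n sf" where
  "zeta_inv = (\<Sum>a\<in>UNIV. \<Sum>b\<in>UNIV.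
     (1 \<otimes> K ^ (3 * zeta_exp CARD('n) a b)) * oprod (\<lambda>k. ev (x2 k) (inv_poly a b)) * (eb a \<otimes> eb b))"

lemma rep_zeta_inv:
  fixes a b :: bool
  defines "z \<equiv> zeta_exp CARD('n::{finite,linorder}) a b"
  shows "sector.rep (eb a \<otimes> eb b) (x2 :: 'n \<Rightarrow> _) kk2 zeta_inv
    (mult_poly (q2 a b) one_poly (flip_poly False (odd z) False (inv_poly a b))) 1 0 (3 * z) 0"
proof -
  interpret sector "eb a \<otimes> eb b" "q2 a b" "[sgb a, sgb b, 1]" "x2 :: 'n \<Rightarrow> _" kk2 by (rule sector2)
  have "zeta_inv * (eb a \<otimes> eb b) =
      (1 \<otimes> K ^ (3 * z)) * oprod (\<lambda>k. ev (x2 k) (inv_poly a b)) * (eb a \<otimes> eb b :: 'n sf \<otimes> 'n sf)"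
    unfolding zeta_inv_def z_def
    by (cases a; cases b) (simp_all add: UNIV_bool distrib_right mult.assoc E2_mult del: of_bool_eq)
  note 1 = rep_cong[THEN iffD2, OF this]
  have 2: "rep (1 \<otimes> K ^ (3 * z) :: 'n sf \<otimes> 'n sf) one_poly 1 0 (3 * z) 0"
    by (rule rep_mono) (simp add: mono_def kk2_def tensor_power scaleC_one)
  have 3: "rep (oprod (\<lambda>k. ev (x2 k) (inv_poly a b))) (inv_poly a b) 1 0 0 0"
    by (rule rep_oprod[OF refl even_inv_poly])
  show ?thesis using 1[OF rep_mult[OF 2 3]] by simp
qed

lemma inverse_check:
  "\<forall>a b s. poly_eq (mult_poly (q2 a b) (zeta2 a b) (flip_poly False (zpar s a b) False
       (mult_poly (q2 a b) one_poly (flip_poly False (zpar s a b) False (inv_poly a b))))) one_poly \<and>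
     poly_eq (mult_poly (q2 a b) (mult_poly (q2 a b) one_poly (flip_poly False (zpar s a b) False (inv_poly a b)))
       (flip_poly False (zpar s a b) False (zeta2 a b))) one_poly"
  by code_simp

lemma zeta_inverse: "is_inverse zeta (zeta_inv :: 'n::{finite,linorder} sf \<otimes> 'n sf)"
  unfolding is_inverse_def
proof (intro conjI; rule tensor_sector_eqI)
  fix a b
  interpret sector "eb a \<otimes> eb b" "q2 a b" "[sgb a, sgb b, 1]" "x2 :: 'n \<Rightarrow> _" kk2 by (rule sector2)
  define z where "z = zeta_exp CARD('n) a b"
  have 1: "rep 1 one_poly 1 0 0 0" by (rule rep_one) simp
  \<comment> \<open>The exponents of \<open>K\<close> add up to \<open>4 * z\<close>, so the sign
    occurs \<open>2 * z\<close> times.\<close>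
  have sq: "(sgb b :: int) ^ ((z + 3 * z) div 2) = 1" "(sgb b :: int) ^ ((3 * z + z) div 2) = 1"
    by auto
  have z: "odd z = zpar (odd CARD('n)) a b" "odd (3 * z) = zpar (odd CARD('n)) a b"
    unfolding even_mult_iff z_def by (simp_all add: odd_zeta_exp)
  note r = rep_zeta2[where 'n = 'n, of a b, folded z_def] rep_zeta_inv[where 'n = 'n, of a b, folded z_def]
  show "zeta * zeta_inv * (eb a \<otimes> eb b) = 1 * (eb a \<otimes> eb b :: 'n sf \<otimes> 'n sf)"
    by (rule rep_eqI[OF rep_mult[OF r(1) r(2)] 1]) (use inverse_check sq in \<open>simp_all add: z\<close>)
  show "zeta_inv * zeta * (eb a \<otimes> eb b) = 1 * (eb a \<otimes> eb b :: 'n sf \<otimes> 'n sf)"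
    by (rule rep_eqI[OF rep_mult[OF r(2) r(1)] 1]) (use inverse_check sq in \<open>simp_all add: z\<close>)
qed

lemma unit_inv_zeta: "unit_inv zeta = zeta_inv"
  by (rule unit_inv_eq[OF zeta_inverse])

section \<open>The counit conditions\<close>

lemma
  fixes a b :: "'n sf"
  shows alg_hom_counit_id: "alg_hom (counit_id :: 'n sf \<otimes> 'n sf \<Rightarrow> _)"
    and counit_id_pure: "counit_id (a \<otimes> b) = counit a *\<^sub>C b"
proof -
  note c = alg_homD[OF alg_hom_counit]
  have b: "bilinear_balanced (\<lambda>a b. counit a *\<^sub>C b :: 'n sf)"
    by (simp add: bilinear_balanced_def c scaleC_add_left scaleC_add_right scaleC_scaleC
        scaleC_complex_def mult.commute)
  show pure: "counit_id (a \<otimes> b) = counit a *\<^sub>C b" for a b :: "'n sf"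
    by (simp add: counit_id_def tensor_lift_pure b)
  show "alg_hom (counit_id :: 'n sf \<otimes> 'n sf \<Rightarrow> _)"
  proof (rule alg_hom_tensorI)
    show "counit_id (x + y) = counit_id x + counit_id y" for x y :: "'n sf \<otimes> 'n sf"
      by (simp add: counit_id_def tensor_lift_add b)
  qed (simp_all add: pure tensor_mult c scaleC_one scaleC_mult_left scaleC_mult_right scaleC_scaleC
      scaleC_complex_def mult.commute flip: tensor_scaleC_left)
qed

lemma
  fixes a b :: "'n sf"
  shows alg_hom_id_counit: "alg_hom (id_counit :: 'n sf \<otimes> 'n sf \<Rightarrow> _)"
    and id_counit_pure: "id_counit (a \<otimes> b) = counit b *\<^sub>C a"
proof -
  note c = alg_homD[OF alg_hom_counit]
  have b: "bilinear_balanced (\<lambda>a b. counit b *\<^sub>C a :: 'n sf)"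
    by (simp add: bilinear_balanced_def c scaleC_add_left scaleC_add_right scaleC_scaleC
        scaleC_complex_def mult.commute)
  show pure: "id_counit (a \<otimes> b) = counit b *\<^sub>C a" for a b :: "'n sf"
    by (simp add: id_counit_def tensor_lift_pure b)
  show "alg_hom (id_counit :: 'n sf \<otimes> 'n sf \<Rightarrow> _)"
  proof (rule alg_hom_tensorI)
    show "id_counit (x + y) = id_counit x + id_counit y" for x y :: "'n sf \<otimes> 'n sf"
      by (simp add: id_counit_def tensor_lift_add b)
  qed (simp_all add: pure tensor_mult c scaleC_one scaleC_mult_left scaleC_mult_right scaleC_scaleC
      scaleC_complex_def mult.commute flip: tensor_scaleC_left)
qed

lemma counit_e: "counit (e 0) = 1" "counit (e 1) = 0"
proof -
  have "counit (K\<^sup>2 :: 'n sf) = 1"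
    by (simp add: power2_eq_square alg_homD[OF alg_hom_counit] counit_generators)
  then show "counit (e 0 :: 'n sf) = 1" "counit (e 1 :: 'n sf) = 0"
    by (simp_all add: e_def alg_homD[OF alg_hom_counit] clinear_diff[OF alg_hom_clinear[OF alg_hom_counit]]
        scaleC_complex_def)
qed

text \<open>The counit kills \<open>e 1\<close> and all \<open>fp i\<close>, \<open>fm i\<close>.
  Applied to the first factor it leaves only \<open>e 0 \<otimes> 1\<close>; applied to the second
  it turns \<open>zeta_10\<close> into \<open>1\<close> and leaves \<open>e 0 + e 1\<close>.\<close>

lemma is_twist_zeta: "is_twist (zeta :: 'n::{finite,linorder} sf \<otimes> 'n sf)"
proof -
  have "counit_id zeta = (1 :: 'n sf)"
    unfolding zeta_def
    by (simp add: alg_homD[OF alg_hom_counit_id] counit_id_pure counit_e scaleC_one del: One_nat_def)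
  moreover have "id_counit zeta = (1 :: 'n sf)"
  proof -
    have "id_counit zeta_10 = (1 :: 'n sf)"
      unfolding zeta_10_def
      by (simp add: alg_homD[OF alg_hom_id_counit] alg_hom_oprod[OF alg_hom_id_counit]
          clinear_diff[OF alg_hom_clinear[OF alg_hom_id_counit]] alg_homD[OF alg_hom_counit]
          id_counit_pure counit_generators oprod_one scaleC_one)
    then show ?thesis
      unfolding zeta_def
      by (simp add: alg_homD[OF alg_hom_id_counit] alg_homD[OF alg_hom_counit] id_counit_pure counit_e
          scaleC_one del: One_nat_def) (simp add: sf_e0)
  qed
  ultimately show ?thesis using zeta_inverse by (auto simp: is_twist_def)
qed

section \<open>Twisting the R-matrix\<close>

lemma quadruple: "x + x + x + x = 4 *\<^sub>C x" for x :: "'a::complex_algebra"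
proof -
  have "(1 + 1 + 1 + 1) *\<^sub>C x = x + x + x + x" by (simp only: scaleC_add_left scaleC_one)
  then show ?thesis by simp
qed

text \<open>For commuting involutions, half of \<open>1 + u + v - u * v\<close> is
  \<open>- 1\<close> where both are \<open>- 1\<close> and \<open>1\<close> elsewhere. Replacing
  \<open>u\<close> by \<open>- u\<close> thus multiplies it by \<open>v\<close>, and vice
  versa.\<close>

lemma involutions:
  fixes u v :: "'a::complex_algebra"
  assumes "u * u = 1" "v * v = 1" "v * u = u * v"
  shows "(1 + u + v - u * v) * (1 - u + v + u * v) = 4 *\<^sub>C v"
    "(1 + u + v - u * v) * (1 + u - v + u * v) = 4 *\<^sub>C u"
    "(1 + u + v - u * v) * (1 + u + v - u * v) = 4 *\<^sub>C 1"
proof -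
  have *: "u * (u * X) = X" "v * (v * X) = X" "v * (u * X) = u * (v * X)" for X
    by (simp_all add: assms flip: mult.assoc)
  show "(1 + u + v - u * v) * (1 - u + v + u * v) = 4 *\<^sub>C v"
    "(1 + u + v - u * v) * (1 + u - v + u * v) = 4 *\<^sub>C u"
    "(1 + u + v - u * v) * (1 + u + v - u * v) = 4 *\<^sub>C 1"
    by (simp_all add: quadruple[symmetric] ring_distribs assms * mult.assoc algebra_simps)
qed

lemma sf_sector_eqI: "(\<And>a. X * eb a = Y * eb a) \<Longrightarrow> X = (Y :: 'n sf)"
  by (metis distrib_left mult.right_neutral sum_e)

lemma gval_om_square: "gval (om t a) * gval (om t a) = sgb a"
  by (cases a; cases t) (simp_all add: om_def gval_def)

text \<open>In a sector, the coefficient of \<open>K\<close> in \<open>omega_m\<close> and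
  \<open>K\<close> itself square to the same sign \<open>sgb a\<close>.\<close>

lemma omega_square: "omega_m * omega_m = (1 :: 'n sf)"
proof (rule sf_sector_eqI)
  fix a
  have "omega_m * omega_m * eb a = gval (om True a) *\<^sub>C (omega_m * K * eb a :: 'n sf)"
    by (simp only: mult.assoc omega_eb scaleC_mult_right)
  also have "omega_m * K * eb a = gval (om True a) *\<^sub>C (K * K * eb a :: 'n sf)"
    unfolding omega_comm by (simp only: mult.assoc omega_eb scaleC_mult_right)
  finally show "omega_m * omega_m * eb a = 1 * (eb a :: 'n sf)"
    unfolding K2_e scaleC_scaleC gval_om_square[unfolded mult.assoc] by (cases a) (simp_all add: scaleC_one gval_def om_def)
qed

lemma ff_omega: "ff s i * omega_m = - (omega_m * ff s i)"
  by (simp add: ff_def omega_comm)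

text \<open>\<open>rho_K\<close> is the element of \<open>involutions\<close> for
  \<open>omega_m\<close> placed in the first and in the second factor. A generator anticommutes with
  the one in its own factor, and conjugation attaches the other.\<close>

lemma rho_K_conj:
  fixes k :: 'n
  shows "rho_K * rho_K = (1 :: 'n sf \<otimes> 'n sf)"
    "rho_K * (ff s k \<otimes> 1) * rho_K = ff s k \<otimes> omega_m"
    "rho_K * (1 \<otimes> ff s k) * rho_K = omega_m \<otimes> ff s k"
    "(K \<otimes> 1) * rho_K = rho_K * (K \<otimes> 1 :: 'n sf \<otimes> 'n sf)"
    "(1 \<otimes> K) * rho_K = rho_K * (1 \<otimes> K :: 'n sf \<otimes> 'n sf)"
proof -
  let ?u = "omega_m \<otimes> 1 :: 'n sf \<otimes> 'n sf" and ?v = "1 \<otimes> omega_m :: 'n sf \<otimes> 'n sf"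
  have u: "?u * ?u = 1" "?v * ?v = 1" "?v * ?u = ?u * ?v"
    by (simp_all add: tensor_mult omega_square one_tensor_def)
  have rho: "rho_K = (1 / 2) *\<^sub>C (1 + ?u + ?v - ?u * ?v)"
    by (simp add: rho_K_def tensor_mult one_tensor_def)
  show "rho_K * rho_K = (1 :: 'n sf \<otimes> 'n sf)"
    unfolding rho by (simp add: scaleC_mult_left scaleC_mult_right scaleC_scaleC involutions[OF u] scaleC_one)
  have 1: "(ff s k \<otimes> 1) * (1 + ?u + ?v - ?u * ?v) = (1 - ?u + ?v + ?u * ?v) * (ff s k \<otimes> 1)"
    by (simp add: ring_distribs tensor_mult ff_omega tensor_minus_left)
  have 2: "(1 \<otimes> ff s k) * (1 + ?u + ?v - ?u * ?v) = (1 + ?u - ?v + ?u * ?v) * (1 \<otimes> ff s k)"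
    by (simp add: ring_distribs tensor_mult ff_omega tensor_minus_right)
  have "rho_K * (ff s k \<otimes> 1) * rho_K = (1 / 4) *\<^sub>C ((1 + ?u + ?v - ?u * ?v) *
      ((ff s k \<otimes> 1) * (1 + ?u + ?v - ?u * ?v)))"
    unfolding rho by (simp only: scaleC_mult_left scaleC_mult_right scaleC_scaleC mult.assoc) simp
  also have "\<dots> = (1 / 4) *\<^sub>C ((4 *\<^sub>C ?v) * (ff s k \<otimes> 1))"
    unfolding 1 by (simp only: mult.assoc[symmetric] involutions[OF u])
  finally show "rho_K * (ff s k \<otimes> 1) * rho_K = ff s k \<otimes> omega_m"
    by (simp add: scaleC_mult_left scaleC_scaleC tensor_mult scaleC_one)
  have "rho_K * (1 \<otimes> ff s k) * rho_K = (1 / 4) *\<^sub>C ((1 + ?u + ?v - ?u * ?v) *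
      ((1 \<otimes> ff s k) * (1 + ?u + ?v - ?u * ?v)))"
    unfolding rho by (simp only: scaleC_mult_left scaleC_mult_right scaleC_scaleC mult.assoc) simp
  also have "\<dots> = (1 / 4) *\<^sub>C ((4 *\<^sub>C ?u) * (1 \<otimes> ff s k))"
    unfolding 2 by (simp only: mult.assoc[symmetric] involutions[OF u])
  finally show "rho_K * (1 \<otimes> ff s k) * rho_K = omega_m \<otimes> ff s k"
    by (simp add: scaleC_mult_left scaleC_scaleC tensor_mult scaleC_one)
  show "(K \<otimes> 1) * rho_K = rho_K * (K \<otimes> 1 :: 'n sf \<otimes> 'n sf)"
    "(1 \<otimes> K) * rho_K = rho_K * (1 \<otimes> K :: 'n sf \<otimes> 'n sf)"
    unfolding rho by (simp_all add: ring_distribs scaleC_mult_left scaleC_mult_right tensor_mult omega_comm)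
qed

lemma e_eb: "e 0 = eb False" "e 1 = eb True"
  by simp_all

(* The flip turns the letters f \<otimes> 1 and K \<otimes> f into 1 \<otimes> f and f \<otimes> K; conjugation by the involution
   rho_K turns these back into multiples of letters, by rho_K_conj. *)
definition flip_hom :: "'n sf \<otimes> 'n sf \<Rightarrow> 'n sf \<otimes> 'n sf" where
  "flip_hom X = rho_K * tensor_flip X * rho_K"

lemma rho_K_cancel: "rho_K * (rho_K * X) = (X :: 'n sf \<otimes> 'n sf)"
  by (simp add: rho_K_conj(1) flip: mult.assoc)

lemma alg_hom_flip_hom: "alg_hom flip_hom"
proof -
  have mult: "rho_K * (X * Y) * rho_K = rho_K * X * rho_K * (rho_K * Y * rho_K)" for X Y :: "'a sf \<otimes> 'a sf"
    by (simp only: mult.assoc rho_K_cancel)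
  show ?thesis
    by (simp add: alg_hom_def clinear_def flip_hom_def alg_homD[OF alg_hom_tensor_flip] mult
        distrib_left distrib_right scaleC_mult_left scaleC_mult_right rho_K_conj(1))
qed

lemma tensor_flip_rho_K: "tensor_flip X * rho_K = rho_K * flip_hom X"
  by (simp only: flip_hom_def mult.assoc rho_K_cancel)

text \<open>The flip exchanges the sector indices. The image of \<open>f \<otimes> 1\<close> is
  \<open>omega_m \<otimes> f\<close>, and that of \<open>K \<otimes> f\<close> is
  \<open>f \<otimes> (omega_m * K)\<close>; the square of \<open>K\<close> in the latter turns
  \<open>om True b\<close> into \<open>om False b\<close>.\<close>

definition flipped_zeta :: "bool \<Rightarrow> bool \<Rightarrow> cpoly" where
  "flipped_zeta a b = zeta_letters (q2 a b) b a
     (scale_poly (om True a) (letter 2)) (scale_poly (om True a) (letter 3))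
     (scale_poly (om False b) (letter 0)) (scale_poly (om False b) (letter 1))"

lemma flip_hom_letters:
  fixes k :: 'n
  shows "flip_hom (ff s k \<otimes> 1) * (eb a \<otimes> eb b) = gval (om True a) *\<^sub>C ((K \<otimes> ff s k) * (eb a \<otimes> eb b))"
    "flip_hom (K \<otimes> ff s k) * (eb a \<otimes> eb b) = gval (om False b) *\<^sub>C ((ff s k \<otimes> 1) * (eb a \<otimes> eb b))"
    "flip_hom (1 \<otimes> K) = (K \<otimes> 1 :: 'n sf \<otimes> 'n sf)"
proof -
  show "flip_hom (ff s k \<otimes> 1) * (eb a \<otimes> eb b) = gval (om True a) *\<^sub>C ((K \<otimes> ff s k) * (eb a \<otimes> eb b))"
    unfolding flip_hom_def tensor_flip_pure rho_K_conj
    by (simp only: tensor_mult omega_eb tensor_scaleC_left)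
  have "flip_hom (K \<otimes> ff s k) = rho_K * ((ff s k \<otimes> 1) * ((1 \<otimes> K) * rho_K))"
    by (simp add: flip_hom_def tensor_flip_pure tensor_mult flip: mult.assoc)
  also have "\<dots> = (ff s k \<otimes> omega_m) * (1 \<otimes> K)"
    unfolding rho_K_conj(5) rho_K_conj(2)[symmetric] by (simp only: mult.assoc)
  finally have "flip_hom (K \<otimes> ff s k) * (eb a \<otimes> eb b) = (ff s k * eb a) \<otimes> (omega_m * K * eb b)"
    by (simp add: tensor_mult)
  also have "omega_m * K * eb b = (gval (om True b) * sgb b) *\<^sub>C (eb b :: 'n sf)"
    unfolding omega_comm by (simp only: mult.assoc omega_eb scaleC_mult_right K2_e[unfolded mult.assoc] scaleC_scaleC)
  also have "gval (om True b) * sgb b = gval (om False b)"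
    by (simp add: om_def gval_def)
  finally show "flip_hom (K \<otimes> ff s k) * (eb a \<otimes> eb b) = gval (om False b) *\<^sub>C ((ff s k \<otimes> 1) * (eb a \<otimes> eb b))"
    by (simp add: tensor_mult tensor_scaleC_right)
  show "flip_hom (1 \<otimes> K) = (K \<otimes> 1 :: 'n sf \<otimes> 'n sf)"
    unfolding flip_hom_def tensor_flip_pure rho_K_conj(4)[symmetric] mult.assoc rho_K_conj(1)[unfolded mult.assoc]
    by simp
qed

lemma rep_flipped_zeta:
  fixes a b :: bool
  defines "z \<equiv> zeta_exp CARD('n::{finite,linorder}) b a"
  shows "sector.rep (eb a \<otimes> eb b) (x2 :: 'n \<Rightarrow> _) kk2 (flip_hom zeta) (flipped_zeta a b) 1 z 0 0"
proof -
  interpret sector "eb a \<otimes> eb b" "q2 a b" "[sgb a, sgb b, 1]" "x2 :: 'n \<Rightarrow> _" kk2 by (rule sector2)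
  have f: "fp k = ff False k" "fm k = ff True k" for k :: 'n by (simp_all add: ff_def)
  have "rep (flip_hom zeta) (flipped_zeta a b) (1 ^ z) (z * 1) (z * 0) (z * 0)"
    unfolding flipped_zeta_def
  proof (rule rep_zeta_letters[OF alg_hom_flip_hom])
    fix c d
    have "(eb d \<otimes> eb c) * rho_K = rho_K * (eb d \<otimes> eb c :: 'n sf \<otimes> 'n sf)"
      by (intro tensor_central e_central)
    then have "flip_hom (eb c \<otimes> eb d) = (eb d \<otimes> eb c :: 'n sf \<otimes> 'n sf)"
      by (simp only: flip_hom_def tensor_flip_pure mult.assoc rho_K_cancel)
    then show "flip_hom (eb c \<otimes> eb d) * (eb a \<otimes> eb b) = (if c = b \<and> d = a then eb a \<otimes> eb b else 0 :: 'n sf \<otimes> 'n sf)"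
      by (auto simp only: E2_mult split: if_split)
  qed (simp_all only: f flip_hom_letters ev_scale_poly letter x2_letter parity_scale_poly scaleC_mult_left
      z_def, simp_all add: mono_def kk2_def scaleC_one)
  then show ?thesis by simp
qed

section \<open>The R-matrices in a sector\<close>

definition R_poly :: "bool \<Rightarrow> bool \<Rightarrow> cpoly" where
  "R_poly a b =
    (let q = q2 a b; mp = mult_poly q (letter 1) (letter 2); pm = mult_poly q (letter 0) (letter 3);
       na = mult_poly q (letter 1) (letter 0); nb = scale_poly (sgb a, 0) (mult_poly q (letter 3) (letter 2));
       nn = mult_poly q na nb
     in one_poly @ (if \<not> a \<and> \<not> b then scale_poly (- 2, 0) mp
       else if \<not> a then scale_poly (- 1, - 1) mp @ scale_poly (- 1, - 1) pm @ scale_poly (1, - 1) na @ scale_poly (0, 2) nn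
       else if \<not> b then scale_poly (1, 1) mp @ scale_poly (1, 1) pm @ scale_poly (1, 1) nb @ scale_poly (0, - 2) nn
       else scale_poly (0, - 2) mp @ scale_poly (- 1, 1) nb @ scale_poly (- 1, - 1) na @ scale_poly (2, 0) nn))"

text \<open>In the sector \<open>(1, 1)\<close> the power \<open>K ^ (N - 1)\<close> stands left of
  the product; moving it to the right flips the second mode when \<open>N\<close> is even. The
  factor \<open>one_poly\<close> reproduces the form that \<open>rep_mult\<close> yields.\<close>

definition R_hat_poly :: "bool \<Rightarrow> bool \<Rightarrow> bool \<Rightarrow> cpoly" where
  "R_hat_poly s a b = (if a \<and> b then mult_poly (q2 a b) one_poly (flip_poly False (\<not> s) False (R_poly a b))
     else R_poly a b)"

lemma even_R_poly: "even_poly (R_poly a b)"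
proof -
  note odd = parity_mult_poly[OF letter(1) letter(1), simplified]
  show ?thesis
    unfolding R_poly_def Let_def
    by (auto simp: parity_append one_poly intro!: parity_scale_poly even_mult_poly odd)
qed

lemma R_mat_check:
  "\<forall>a b s. poly_eq
    (mult_poly (q2 a b) (flipped_zeta a b) (flip_poly (zpar s b a) False False (R_hat_poly s a b)))
    (mult_poly (q2 a b) (mult_poly (q2 a b) one_poly (flip_poly b False False
        (one_poly @ scale_poly (- 2, 0) (scale_poly (om True a) (mult_poly (q2 a b) (letter 1) (letter 2))))))
      (flip_poly b False False (zeta2 a b)))"
  by code_simp

text \<open>The factor \<open>rho_K\<close> does not have the form \<open>rep\<close>, so it stays
  outside on the left and only the cofactor \<open>Y\<close> is represented.\<close>

lemma rep_R_hat:
  fixes \<beta> :: complex and a b :: bool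
  defines "n \<equiv> CARD('n::{finite,linorder})"
  obtains Y where "R_hat \<beta> * (eb a \<otimes> eb b) = rho_K * Y * (eb a \<otimes> eb b :: 'n sf \<otimes> 'n sf)"
    "sector.rep (eb a \<otimes> eb b) (x2 :: 'n \<Rightarrow> _) kk2 Y (R_hat_poly (odd n) a b)
       (if a \<and> b then (- 1) ^ n * \<i> * \<beta> else 1) (if a \<and> b then n else 0) (zeta_exp n a b) 0"
proof -
  let ?E = "eb a \<otimes> eb b :: 'n sf \<otimes> 'n sf"
  interpret sector ?E "q2 a b" "[sgb a, sgb b, 1]" "x2 :: 'n \<Rightarrow> _" kk2 by (rule sector2)
  have n: "n > 0" "odd (n - 1) = (\<not> odd n)" by (simp_all add: n_def)
  have R: "R_hat \<beta> * ?E = (if a then (if b then R_hat_11 \<beta> else R_hat_10) else (if b then R_hat_01 else R_hat_00)) * ?E"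
    unfolding R_hat_def e_eb distrib_right mult.assoc E2_mult by simp
  have R00: "R_hat \<beta> * ?E = R_hat_00 * ?E" if "\<not> a" "\<not> b" using R that by simp
  have R01: "R_hat \<beta> * ?E = R_hat_01 * ?E" if "\<not> a" "b" using R that by simp
  have R10: "R_hat \<beta> * ?E = R_hat_10 * ?E" if "a" "\<not> b" using R that by simp
  have R11: "R_hat \<beta> * ?E = R_hat_11 \<beta> * ?E" if "a" "b" using R that by simp
  define mp pm na nb where "mp = mult_poly (q2 a b) (letter 1) (letter 2)"
    and "pm = mult_poly (q2 a b) (letter 0) (letter 3)"
    and "na = mult_poly (q2 a b) (letter 1) (letter 0)"
    and "nb = scale_poly (sgb a, 0) (mult_poly (q2 a b) (letter 3) (letter 2))"
  define nn where "nn = mult_poly (q2 a b) na nb"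
  have mp: "ev (x2 k) mp * ?E = (fm k * K \<otimes> fp k) * ?E" for k
    unfolding mp_def ev_mult letter x2_letter by (simp add: tensor_mult)
  have pm: "ev (x2 k) pm * ?E = (fp k * K \<otimes> fm k) * ?E" for k
    unfolding pm_def ev_mult letter x2_letter by (simp add: tensor_mult)
  have na: "ev (x2 k) na * ?E = (fm k * fp k \<otimes> 1) * ?E" for k
    unfolding na_def ev_mult letter x2_letter by (simp add: tensor_mult)
  have nb: "ev (x2 k) nb * ?E = (1 \<otimes> fm k * fp k) * ?E" for k
  proof -
    have sq: "(K \<otimes> fm k) * (K \<otimes> fp k) * ?E = sgb a *\<^sub>C ((1 \<otimes> fm k * fp k) * ?E)"
      by (simp only: tensor_mult mult.assoc K2_e[unfolded mult.assoc] tensor_scaleC_left mult_1_left)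
    have "ev (x2 k) nb * ?E = (gval (sgb a, 0) * sgb a) *\<^sub>C ((1 \<otimes> fm k * fp k) * ?E)"
      unfolding nb_def ev_scale_poly scaleC_mult_left ev_mult letter x2_letter sq scaleC_scaleC ..
    also have "gval (sgb a, 0) * sgb a = 1" by (simp add: gval_def)
    finally show ?thesis by (simp only: scaleC_one)
  qed
  have nn: "ev (x2 k) nn * ?E = (fm k * fp k \<otimes> fm k * fp k) * ?E" for k
    unfolding nn_def ev_mult using mod_mult[OF na nb, of k] by (simp add: tensor_mult)
  note loc = ev_simps ev_scale_poly one_poly distrib_right left_diff_distrib scaleC_mult_left
    mp pm na nb nn gval_def mult.commute[of \<i> 2] scaleC_minus_left scaleC_diff_left scaleC_add_left
  have O: "rep (oprod g) (R_poly a b) 1 0 0 0" if "\<And>k. g k * ?E = ev (x2 k) P * ?E" "R_poly a b = P" for g P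
    using rep_oprod[OF that(1)] that(2) even_R_poly by blast
  note poly = R_poly_def Let_def mp_def pm_def na_def nb_def nn_def
  show thesis
  proof (cases a; cases b)
    assume ab: "\<not> a" "\<not> b"
    let ?g = "\<lambda>k. 1 - 2 *\<^sub>C (fm k * K \<otimes> fp k)"
    have "rep (oprod ?g) (R_poly a b) 1 0 0 0"
    proof (rule O)
      show "?g k * ?E = ev (x2 k) (one_poly @ scale_poly (- 2, 0) mp) * ?E" for k by (simp add: loc del: of_bool_eq)
    qed (use ab in \<open>simp add: poly\<close>)
    note r = this
    show thesis
    proof (rule that[of "oprod ?g"])
      show "R_hat \<beta> * ?E = rho_K * (oprod ?g) * ?E"
        unfolding R00[OF ab] R_hat_00_def ..
    qed (use r ab in \<open>simp_all add: R_hat_poly_def zeta_exp_def\<close>)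
  next
    assume ab: "\<not> a" "b"
    let ?g = "\<lambda>k. 1 - (1 + \<i>) *\<^sub>C (fm k * K \<otimes> fp k) - (1 + \<i>) *\<^sub>C (fp k * K \<otimes> fm k)
       + (1 - \<i>) *\<^sub>C (fm k * fp k \<otimes> 1) + (2 * \<i>) *\<^sub>C (fm k * fp k \<otimes> fm k * fp k)"
    have "rep (oprod ?g) (R_poly a b) 1 0 0 0"
    proof (rule O)
      show "?g k * ?E = ev (x2 k) (one_poly @ scale_poly (- 1, - 1) mp @ scale_poly (- 1, - 1) pm @
        scale_poly (1, - 1) na @ scale_poly (0, 2) nn) * ?E" for k by (simp add: loc del: of_bool_eq)
    qed (use ab in \<open>simp add: poly\<close>)
    note r = this
    show thesis
    proof (rule that[of "oprod ?g"])
      show "R_hat \<beta> * ?E = rho_K * (oprod ?g) * ?E"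
        unfolding R01[OF ab] R_hat_01_def ..
    qed (use r ab in \<open>simp_all add: R_hat_poly_def zeta_exp_def\<close>)
  next
    assume ab: "a" "\<not> b"
    let ?g = "\<lambda>k. 1 + (1 + \<i>) *\<^sub>C (fm k * K \<otimes> fp k) + (1 + \<i>) *\<^sub>C (fp k * K \<otimes> fm k)
       + (1 + \<i>) *\<^sub>C (1 \<otimes> fm k * fp k) - (2 * \<i>) *\<^sub>C (fm k * fp k \<otimes> fm k * fp k)"
    have g: "rep (oprod ?g) (R_poly a b) 1 0 0 0"
    proof (rule O)
      show "?g k * ?E = ev (x2 k) (one_poly @ scale_poly (1, 1) mp @ scale_poly (1, 1) pm @
        scale_poly (1, 1) nb @ scale_poly (0, - 2) nn) * ?E" for k by (simp add: loc del: of_bool_eq)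
    qed (use ab in \<open>simp add: poly\<close>)
    have K: "(1 \<otimes> K) * ?E = mono 1 0 1 0 * ?E" by (simp add: mono_def kk2_def scaleC_one)
    have "rep (oprod ?g * (1 \<otimes> K)) (R_poly a b) 1 0 1 0"
      using rep_mult_mono[OF g K] by simp
    note r = this
    show thesis
    proof (rule that[of "oprod ?g * (1 \<otimes> K)"])
      show "R_hat \<beta> * ?E = rho_K * (oprod ?g * (1 \<otimes> K)) * ?E"
        unfolding R10[OF ab] R_hat_10_def by (simp only: mult.assoc)
    qed (use r ab in \<open>simp_all add: R_hat_poly_def zeta_exp_def\<close>)
  next
    assume ab: "a" "b"
    let ?g = "\<lambda>k. 1 - (2 * \<i>) *\<^sub>C (fm k * K \<otimes> fp k) + (\<i> - 1) *\<^sub>C (1 \<otimes> fm k * fp k)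
         - (1 + \<i>) *\<^sub>C (fm k * fp k \<otimes> 1) + 2 *\<^sub>C (fm k * fp k \<otimes> fm k * fp k)"
    let ?c = "(- 1) ^ n * \<i> * \<beta>"
    have g: "rep (oprod ?g) (R_poly a b) 1 0 0 0"
    proof (rule O)
      show "?g k * ?E = ev (x2 k) (one_poly @ scale_poly (0, - 2) mp @ scale_poly (- 1, 1) nb @
        scale_poly (- 1, - 1) na @ scale_poly (2, 0) nn) * ?E" for k by (simp add: loc del: of_bool_eq)
    qed (use ab in \<open>simp add: poly\<close>)
    have K1: "rep (1 \<otimes> K ^ (n - 1)) one_poly 1 0 (n - 1) 0"
      by (rule rep_mono) (simp add: mono_def kk2_def scaleC_one tensor_power)
    have K2: "(K ^ n \<otimes> 1) * ?E = mono 1 n 0 0 * ?E"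
      by (simp add: mono_def kk2_def scaleC_one tensor_power)
    have "rep (?c *\<^sub>C ((1 \<otimes> K ^ (n - 1)) * oprod ?g * (K ^ n \<otimes> 1))) (R_hat_poly (odd n) a b) ?c n (n - 1) 0"
      using rep_scale[OF rep_mult_mono[OF rep_mult[OF K1 g] K2], of ?c] n ab
      by (simp add: R_hat_poly_def)
    note r = this
    show thesis
    proof (rule that[of "?c *\<^sub>C ((1 \<otimes> K ^ (n - 1)) * oprod ?g * (K ^ n \<otimes> 1))"])
      show "R_hat \<beta> * ?E = rho_K * (?c *\<^sub>C ((1 \<otimes> K ^ (n - 1)) * oprod ?g * (K ^ n \<otimes> 1))) * ?E"
        unfolding R11[OF ab] R_hat_11_def by (simp only: mult.assoc scaleC_mult_left scaleC_mult_right n_def)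
    qed (use r ab in \<open>simp_all add: R_hat_poly_def zeta_exp_def\<close>)
  qed
qed

text \<open>For \<open>b\<close> the phase of \<open>K\<close> in the second factor of
  \<open>rho\<close> is opposite to that in \<open>omega_m\<close>. Reversing the second involution
  in \<open>rho_K\<close> multiplies it by the first, \<open>omega_m \<otimes> 1\<close>, which is a
  multiple of \<open>K \<otimes> 1\<close> here.\<close>

lemma rho_sector:
  fixes a b :: bool
  shows "rho (of_bool a) (of_bool b) * (eb a \<otimes> eb b) =
    rho_K * (if b then gval (om True a) *\<^sub>C (K \<otimes> 1) else 1) * (eb a \<otimes> eb b :: 'n sf \<otimes> 'n sf)"
proof -
  let ?E = "eb a \<otimes> eb b :: 'n sf \<otimes> 'n sf" and ?A = "K \<otimes> 1 :: 'n sf \<otimes> 'n sf"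
    and ?B = "1 \<otimes> K :: 'n sf \<otimes> 'n sf" and ?C = "K \<otimes> K :: 'n sf \<otimes> 'n sf"
  let ?l = "gval (om True a)" and ?m = "gval (om True b)"
  define x where "x = (if b then - ?m else ?m)"
  define y where "y = (if b then - (?l * ?m) else ?l * ?m)"
  have "rho (of_bool a) (of_bool b) = (1 / 2) *\<^sub>C (1 + x *\<^sub>C ?B + ?l *\<^sub>C ?A - y *\<^sub>C ?C)"
    unfolding rho_def x_def y_def
    by (cases a; cases b) (simp_all add: om_def gval_def one_tensor_def scaleC_one scaleC_minus_left
        power_int_minus algebra_simps)
  then have rho: "rho (of_bool a) (of_bool b) * ?E =
      (1 / 2) *\<^sub>C (?E + x *\<^sub>C (?B * ?E) + ?l *\<^sub>C (?A * ?E) - y *\<^sub>C (?C * ?E))"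
    by (simp only: scaleC_mult_left distrib_right left_diff_distrib mult_1_left)
  have omega: "(omega_m \<otimes> 1) * ?E = ?l *\<^sub>C (?A * ?E)" "(1 \<otimes> omega_m) * ?E = ?m *\<^sub>C (?B * ?E)"
    "(omega_m \<otimes> omega_m) * ?E = (?l * ?m) *\<^sub>C (?C * ?E)"
    by (simp_all only: tensor_mult omega_eb tensor_scaleC_left tensor_scaleC_right scaleC_scaleC mult.commute)
  have rho_K: "rho_K * ?E = (1 / 2) *\<^sub>C (?E + ?l *\<^sub>C (?A * ?E) + ?m *\<^sub>C (?B * ?E) - (?l * ?m) *\<^sub>C (?C * ?E))"
    unfolding rho_K_def one_tensor_def[symmetric] scaleC_mult_left distrib_right left_diff_distrib omega mult_1_left ..
  show ?thesis
  proof (cases b)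
    case False
    then show ?thesis unfolding rho using rho_K by (simp add: x_def y_def add_ac)
  next
    case True
    have A: "?A * (?A * ?E) = sgb a *\<^sub>C ?E" "?A * (?B * ?E) = ?C * ?E" "?A * (?C * ?E) = sgb a *\<^sub>C (?B * ?E)"
      by (simp_all only: tensor_mult mult.assoc K2_e[unfolded mult.assoc] tensor_scaleC_left mult_1_left)
    have l: "?l * ?l * sgb a = 1" by (simp add: gval_om_square)
    have "rho_K * (?l *\<^sub>C ?A) * ?E = ?l *\<^sub>C (?A * (rho_K * ?E))"
      by (simp only: scaleC_mult_left scaleC_mult_right mult.assoc[symmetric] rho_K_conj(4))
    also have "\<dots> = (1 / 2) *\<^sub>C (?l *\<^sub>C (?A * ?E) + (?l * ?l * sgb a) *\<^sub>C ?E + (?l * ?m) *\<^sub>C (?C * ?E)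
        - (?l * ?l * sgb a * ?m) *\<^sub>C (?B * ?E))"
      unfolding rho_K
      by (simp only: scaleC_mult_right distrib_left right_diff_distrib A scaleC_scaleC scaleC_add_right
          scaleC_diff_right mult_ac)
    finally show ?thesis
      unfolding rho l using True by (simp add: x_def y_def scaleC_minus_left scaleC_one algebra_simps del: of_bool_eq)
  qed
qed

lemma even_zeta_exp: "even (zeta_exp CARD('n::finite) a b) = (\<not> zpar (odd CARD('n)) a b)"
  using odd_zeta_exp by blast

lemma twist_R:
  fixes \<beta> :: complex
  shows "tensor_flip zeta * R_hat \<beta> = R_mat \<beta> * (zeta :: 'n::{finite,linorder} sf \<otimes> 'n sf)"
proof (rule tensor_sector_eqI)
  fix a b
  let ?E = "eb a \<otimes> eb b :: 'n sf \<otimes> 'n sf"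
  interpret sector ?E "q2 a b" "[sgb a, sgb b, 1]" "x2 :: 'n \<Rightarrow> _" kk2 by (rule sector2)
  let ?n = "CARD('n)"
  \<comment> \<open>What remains of the sum over \<open>rho\<close> in \<open>R_mat\<close> once
    \<open>rho_K\<close> is split off: a monomial in \<open>K\<close>.\<close>
  let ?U = "\<beta> ^ of_bool (a \<and> b) *\<^sub>C (if b then gval (om True a) *\<^sub>C (K \<otimes> 1) else 1) :: 'n sf \<otimes> 'n sf"
  let ?O = "oprod (\<lambda>k. 1 - 2 *\<^sub>C (fm k * omega_m \<otimes> fp k)) :: 'n sf \<otimes> 'n sf"
  let ?P = "one_poly @ scale_poly (- 2, 0) (scale_poly (om True a) (mult_poly (q2 a b) (letter 1) (letter 2)))"
  let ?d = "\<beta> ^ of_bool (a \<and> b) * (if b then gval (om True a) else 1)"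
  obtain Y where Y: "R_hat \<beta> * ?E = rho_K * Y * ?E" "rep Y (R_hat_poly (odd ?n) a b)
       (if a \<and> b then (- 1) ^ ?n * \<i> * \<beta> else 1) (if a \<and> b then ?n else 0) (zeta_exp ?n a b) 0"
    by (rule rep_R_hat)
  have "rep ?U one_poly ?d (of_bool b) 0 0"
    by (rule rep_mono) (auto simp: mono_def kk2_def scaleC_one scaleC_mult_left scaleC_scaleC)
  moreover have "rep ?O ?P 1 0 0 0"
  proof (rule rep_oprod)
    fix k
    have "(fm k * omega_m \<otimes> fp k) * ?E = gval (om True a) *\<^sub>C ((fm k \<otimes> 1) * (K \<otimes> fp k) * ?E)"
      by (simp only: tensor_mult mult.assoc omega_eb scaleC_mult_right tensor_scaleC_left mult_1_left)
    also have "(fm k \<otimes> 1) * (K \<otimes> fp k) * ?E = ev (x2 k) (mult_poly (q2 a b) (letter 1) (letter 2)) * ?E"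
      unfolding ev_mult letter x2_letter ..
    finally show "(1 - 2 *\<^sub>C (fm k * omega_m \<otimes> fp k)) * ?E = ev (x2 k) ?P * ?E"
      by (simp add: ev_simps ev_scale_poly one_poly distrib_right left_diff_distrib scaleC_mult_left
          scaleC_minus_left gval_int del: of_bool_eq)
  next
    show "even_poly ?P"
      using parity_mult_poly[OF letter(1) letter(1)] by (simp add: parity_append one_poly parity_scale_poly)
  qed
  ultimately have UO: "rep (?U * ?O) (mult_poly (q2 a b) one_poly (flip_poly b False False ?P)) ?d (of_bool b) 0 0"
    using rep_mult[of ?U one_poly ?d "of_bool b" 0 0 ?O ?P 1 0 0 0] by simp
  have e: "(e n \<otimes> e m) * ?E = (if n = of_bool a \<and> m = of_bool b then ?E else 0)" if "n < 2" "m < 2" for n m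
    using that by (simp add: tensor_mult e_mult_nat del: of_bool_eq)
  have "(\<Sum>n\<in>{0,1}. \<Sum>m\<in>{0,1}. \<beta> ^ (n * m) *\<^sub>C (rho n m * (e n \<otimes> e m))) * ?E =
      \<beta> ^ (of_bool a * of_bool b) *\<^sub>C (rho (of_bool a) (of_bool b) * ?E)"
    by (simp add: distrib_right scaleC_mult_left mult.assoc e del: One_nat_def of_bool_eq)
  also have "\<dots> = rho_K * ?U * ?E"
    unfolding rho_sector by (simp only: scaleC_mult_left scaleC_mult_right of_bool_conj)
  finally have R: "R_mat \<beta> * ?E = rho_K * (?U * ?O) * ?E"
    unfolding R_mat_def using mod_mult[OF _ refl, of _ "rho_K * ?U" ?O] by (simp only: mult.assoc)
  \<comment> \<open>If both \<open>a\<close> and \<open>b\<close> hold, the powers of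
    \<open>K\<close> in the first factor add up to \<open>2 * N - 1\<close> and contribute
    \<open>(- 1) ^ (N - 1)\<close>, which turns the prefactor of \<open>R_hat_11\<close> into
    \<open>- \<i> * \<beta>\<close>.\<close>
  have scal: "(if a \<and> b then (- 1) ^ ?n * \<i> * \<beta> else 1) *
      of_int ((sgb a) ^ ((zeta_exp ?n b a + (if a \<and> b then ?n else 0)) div 2)) = ?d"
  proof -
    obtain m where "?n = Suc m" using not0_implies_Suc[of ?n] by auto
    then show ?thesis
      by (cases a; cases b) (simp_all add: zeta_exp_def om_def gval_def flip: power_mult_distrib)
  qed
  \<comment> \<open>With \<open>rho_K\<close> moved to the far left on both sides, everything that
    is left has the form \<open>rep\<close>.\<close>
  have core: "flip_hom zeta * Y * ?E = ?U * ?O * zeta * ?E"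
  proof (rule rep_eqI[OF rep_mult[OF rep_flipped_zeta Y(2)] rep_mult[OF UO rep_zeta2]])
  qed (use R_mat_check scal in \<open>simp_all add: odd_zeta_exp even_zeta_exp del: of_bool_eq\<close>,
      auto simp: zpar_def)
  have "tensor_flip zeta * R_hat \<beta> * ?E = tensor_flip zeta * (rho_K * Y) * ?E"
    by (simp only: mult.assoc Y(1))
  also have "\<dots> = rho_K * (flip_hom zeta * Y * ?E)"
    by (simp only: mult.assoc[symmetric] tensor_flip_rho_K)
  also have "\<dots> = rho_K * (?U * ?O) * zeta * ?E"
    unfolding core by (simp only: mult.assoc)
  also have "\<dots> = R_mat \<beta> * zeta * ?E"
    by (rule mod_mult[OF R[symmetric] refl])
  finally show "tensor_flip zeta * R_hat \<beta> * ?E = R_mat \<beta> * zeta * ?E" .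
qed

section \<open>Twisting the coassociator\<close>

abbreviation E3 :: "bool \<Rightarrow> bool \<Rightarrow> bool \<Rightarrow> 'n sf \<otimes> 'n sf \<otimes> 'n sf" where
  "E3 a b c \<equiv> eb a \<otimes> eb b \<otimes> eb c"

lemma eb_tensor_E3:
  "(eb a' \<otimes> eb b' \<otimes> 1) * E3 a b c = (if a' = a \<and> b' = b then E3 a b c else 0)"
  "(1 \<otimes> eb b' \<otimes> eb c') * E3 a b c = (if b' = b \<and> c' = c then E3 a b c else 0)"
  by (simp_all add: tensor_mult e_mult del: of_bool_eq)

text \<open>Sector formulas from the tensor square can thus be applied inside the first two factors
  of the cube.\<close>

lemma assoc_E3:
  assumes "X * (eb a \<otimes> eb b) = Y * (eb a \<otimes> eb b)"
  shows "tensor_assoc (X \<otimes> z) * E3 a b c = tensor_assoc (Y \<otimes> z) * E3 a b c"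
proof -
  have "tensor_assoc (X \<otimes> z) * E3 a b c = tensor_assoc ((X * (eb a \<otimes> eb b)) \<otimes> (z * eb c))" for X
    unfolding tensor_assoc_pure[symmetric] alg_homD(4)[OF alg_hom_tensor_assoc, symmetric] tensor_mult ..
  then show ?thesis using assms by simp
qed

lemma right_E3:
  assumes "X * (eb b \<otimes> eb c) = Y * (eb b \<otimes> eb c)"
  shows "(w \<otimes> X) * E3 a b c = (w \<otimes> Y) * E3 a b c"
  by (simp only: tensor_mult assms)

text \<open>The square of \<open>Delta_K\<close> acts as \<open>sgb a * sgb b\<close>, so the
  coproduct adds idempotent indices modulo 2. Hence a doubled factor contributes the index
  \<open>a \<noteq> b\<close> to the twist.\<close>

lemma Delta_hat_eb: "Delta_hat (eb c) * (eb a \<otimes> eb b) = (if c = (a \<noteq> b) then eb a \<otimes> eb b else 0 :: 'n::{finite,linorder} sf \<otimes> 'n sf)"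
proof -
  let ?E = "eb a \<otimes> eb b :: 'n sf \<otimes> 'n sf"
  interpret sector ?E "q2 a b" "[sgb a, sgb b, 1]" "x2 :: 'n \<Rightarrow> _" kk2 by (rule sector2)
  let ?m = "of_int (mu (odd CARD('n)) a b) :: complex"
  have K: "Delta_K * ?E = (?m *\<^sub>C (K \<otimes> K)) * ?E"
    by (simp only: Delta_K_sector scaleC_mult_left)
  have "Delta_K * Delta_K * ?E = (?m * ?m) *\<^sub>C ((K \<otimes> K) * (K \<otimes> K) * ?E)"
    unfolding mod_mult[OF K K] scaleC_mult_left scaleC_mult_right scaleC_scaleC ..
  also have "?m * ?m = 1" by (simp add: mu_def)
  also have "(K \<otimes> K) * (K \<otimes> K) * ?E = (sgb b * sgb a) *\<^sub>C ?E"
    by (simp only: tensor_mult K2_e tensor_scaleC_left tensor_scaleC_right scaleC_scaleC)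
  finally have sq: "Delta_K * Delta_K * ?E = (sgb b * sgb a) *\<^sub>C ?E" by (simp only: scaleC_one)
  have "Delta_hat (eb c) = (1 / 2) *\<^sub>C (1 + sgb c *\<^sub>C (Delta_K * Delta_K) :: 'n sf \<otimes> 'n sf)"
    by (cases c) (simp_all add: e_def power2_eq_square alg_homD[OF alg_hom_Delta_hat] Delta_hat_generators
        clinear_diff[OF alg_hom_clinear[OF alg_hom_Delta_hat]])
  then have "Delta_hat (eb c) * ?E = (1 / 2 + sgb c * sgb b * sgb a / 2) *\<^sub>C ?E"
    by (simp only: scaleC_mult_left distrib_right sq mult_1_left scaleC_add_right scaleC_scaleC
        scaleC_add_left scaleC_one) (simp add: scaleC_add_left)
  also have "1 / 2 + sgb c * sgb b * sgb a / 2 = (if c = (a \<noteq> b) then 1 else 0 :: complex)" by simp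
  finally show ?thesis by (simp add: scaleC_one del: of_bool_eq)
qed

lemma x3_letter:
  "x3 k 0 = fp k \<otimes> 1 \<otimes> 1" "x3 k 1 = fm k \<otimes> 1 \<otimes> 1" "x3 k 2 = K \<otimes> fp k \<otimes> 1" "x3 k 3 = K \<otimes> fm k \<otimes> 1"
  "x3 k 4 = K \<otimes> K \<otimes> fp k" "x3 k 5 = K \<otimes> K \<otimes> fm k"
  by (simp_all add: x3_def ff_def)

section \<open>Images of the twist in the tensor cube\<close>

lemma alg_hom_legs:
  "alg_hom (\<lambda>X :: 'n sf \<otimes> 'n sf. tensor_assoc (X \<otimes> (1 :: 'n sf)))"
  "alg_hom (\<lambda>X :: 'n sf \<otimes> 'n sf. tensor_assoc (tensor_map Delta_hat id X))"
  "alg_hom (tensor_map id Delta_hat :: 'n sf \<otimes> 'n sf \<Rightarrow> _)"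
  by (rule alg_hom_comp[OF alg_hom_tensor_assoc alg_hom_tensor_left]
      alg_hom_comp[OF alg_hom_tensor_assoc alg_hom_tensor_map] alg_hom_tensor_map alg_hom_Delta_hat alg_hom_id)+

lemma legs_pure:
  "tensor_assoc (tensor_map Delta_hat id (f \<otimes> g)) = tensor_assoc (Delta_hat f \<otimes> g)"
  "tensor_map id Delta_hat (f \<otimes> g) = f \<otimes> Delta_hat g"
  by (simp_all add: tensor_map_pure alg_hom_clinear alg_hom_Delta_hat alg_hom_id)

definition leg1_poly :: "bool \<Rightarrow> bool \<Rightarrow> bool \<Rightarrow> cpoly" where
  "leg1_poly a b c = zeta_letters (q3 a b c) a b (letter 0) (letter 1) (letter 2) (letter 3)"

text \<open>In a sector \<open>Delta_hat\<close> sends a generator to a sum of two letters with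
  relative coefficient \<open>tau\<close>, and \<open>K\<close> to \<open>mu\<close> times
  \<open>K \<otimes> K\<close>; the latter scales the letters of the third mode.\<close>

definition leg2_poly :: "bool \<Rightarrow> bool \<Rightarrow> bool \<Rightarrow> bool \<Rightarrow> cpoly" where
  "leg2_poly s a b c = zeta_letters (q3 a b c) (a \<noteq> b) c
     (pair_poly (tau s a b, 0) 0 2) (pair_poly (tau s a b, 0) 1 3)
     (scale_poly (mu s a b, 0) (letter 4)) (scale_poly (mu s a b, 0) (letter 5))"

definition leg3_poly :: "bool \<Rightarrow> bool \<Rightarrow> bool \<Rightarrow> bool \<Rightarrow> cpoly" where
  "leg3_poly s a b c = zeta_letters (q3 a b c) a (b \<noteq> c) (letter 0) (letter 1)
     (pair_poly (tau s b c, 0) 2 4) (pair_poly (tau s b c, 0) 3 5)"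

(* 1 \<otimes> f \<otimes> 1 and 1 \<otimes> 1 \<otimes> f are not multiples of letters, but their products are multiples of products
   of two letters, since K ^ 2 is a sign in each sector. *)
definition leg4_poly :: "bool \<Rightarrow> bool \<Rightarrow> bool \<Rightarrow> cpoly" where
  "leg4_poly a b c = (let q = q3 a b c in zeta_poly q b c
     (scale_poly (sgb a, 0) (mult_poly q (letter 3) (letter 4)))
     (scale_poly (sgb a, 0) (mult_poly q (letter 2) (letter 5)))
     (scale_poly (sgb a, 0) (mult_poly q (letter 2) (letter 3)))
     (scale_poly (sgb a * sgb b, 0) (mult_poly q (letter 4) (letter 5))))"

text \<open>In the third statement the closing power of \<open>K\<close> in the twist goes through
  \<open>Delta_hat\<close>, which spreads it over two factors and produces the power of
  \<open>mu\<close>.\<close>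

lemma rep_legs:
  fixes a b c :: bool
  defines "n \<equiv> CARD('n::{finite,linorder})"
  defines "r \<equiv> sector.rep (E3 a b c) (x3 :: 'n \<Rightarrow> _) kk3"
  shows "r (tensor_assoc (zeta \<otimes> 1)) (leg1_poly a b c) 1 0 (zeta_exp n a b) 0"
    and "r (tensor_assoc (tensor_map Delta_hat id zeta)) (leg2_poly (odd n) a b c) 1 0 0 (zeta_exp n (a \<noteq> b) c)"
    and "r (tensor_map id Delta_hat zeta) (leg3_poly (odd n) a b c)
      (of_int (mu (odd n) b c) ^ zeta_exp n a (b \<noteq> c)) 0 (zeta_exp n a (b \<noteq> c)) (zeta_exp n a (b \<noteq> c))"
    and "r (1 \<otimes> zeta) (leg4_poly a b c) 1 0 0 (zeta_exp n b c)"
proof -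
  let ?E = "E3 a b c :: 'n sf \<otimes> 'n sf \<otimes> 'n sf"
  interpret sector ?E "q3 a b c" "[sgb a, sgb b, sgb c]" "x3 :: 'n \<Rightarrow> _" kk3 by (rule sector3)
  note mono = mono_def kk3_def scaleC_one
  have "rep (tensor_assoc (zeta \<otimes> 1)) (leg1_poly a b c) (1 ^ zeta_exp n a b) (zeta_exp n a b * 0) (zeta_exp n a b * 1) (zeta_exp n a b * 0)"
    unfolding leg1_poly_def
  proof (rule rep_zeta_letters[OF alg_hom_legs(1)])
    show "tensor_assoc ((eb c' \<otimes> eb d) \<otimes> 1) * ?E = (if c' = a \<and> d = b then ?E else 0)" for c' d
      unfolding tensor_assoc_pure eb_tensor_E3 ..
  qed (simp_all only: tensor_assoc_pure letter x3_letter n_def, simp_all add: mono)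
  then show "r (tensor_assoc (zeta \<otimes> 1)) (leg1_poly a b c) 1 0 (zeta_exp n a b) 0"
    unfolding r_def by simp
  have D: "Delta_hat (fp k) * (eb a \<otimes> eb b) = (fp k \<otimes> 1 + of_int (tau (odd n) a b) *\<^sub>C (K \<otimes> fp k)) * (eb a \<otimes> eb b)"
    "Delta_hat (fm k) * (eb a \<otimes> eb b) = (fm k \<otimes> 1 + of_int (tau (odd n) a b) *\<^sub>C (K \<otimes> fm k)) * (eb a \<otimes> eb b)"
    "Delta_hat K * (eb a \<otimes> eb b) = (of_int (mu (odd n) a b) *\<^sub>C (K \<otimes> K)) * (eb a \<otimes> eb b :: 'n sf \<otimes> 'n sf)" for a b and k :: 'n
    using Delta_hat_sector[of False k a b] Delta_hat_sector[of True k a b] Delta_K_sector[where 'n = 'n, of a b]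
    by (simp_all only: ff_def if_True if_False n_def Delta_hat_generators(1) scaleC_mult_left)
  note assoc = clinear_assoc_pure[unfolded clinear_def, THEN conjunct1, rule_format]
    clinear_assoc_pure[unfolded clinear_def, THEN conjunct2, rule_format] tensor_assoc_pure
  have "rep (tensor_assoc (tensor_map Delta_hat id zeta)) (leg2_poly (odd n) a b c) (1 ^ zeta_exp n (a \<noteq> b) c)
      (zeta_exp n (a \<noteq> b) c * 0) (zeta_exp n (a \<noteq> b) c * 0) (zeta_exp n (a \<noteq> b) c * 1)"
    unfolding leg2_poly_def
  proof (rule rep_zeta_letters[OF alg_hom_legs(2)])
    show "tensor_assoc (tensor_map Delta_hat id (eb c' \<otimes> eb d)) * ?E = (if c' = (a \<noteq> b) \<and> d = c then ?E else 0)" for c' d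
    proof -
      have "tensor_assoc (tensor_map Delta_hat id (eb c' \<otimes> eb d)) * ?E =
          tensor_assoc ((if c' = (a \<noteq> b) then 1 else 0) \<otimes> eb d) * ?E"
        unfolding legs_pure by (rule assoc_E3) (simp add: Delta_hat_eb del: of_bool_eq)
      then show ?thesis
        by (auto simp: clinear_0[OF alg_hom_clinear[OF alg_hom_tensor_assoc]] one_tensor_def tensor_assoc_pure tensor_mult e_mult simp del: of_bool_eq split: if_splits)
    qed
    show "tensor_assoc (tensor_map Delta_hat id (fp k \<otimes> 1)) * ?E = ev (x3 k) (pair_poly (tau (odd n) a b, 0) 0 2) * ?E" for k
      unfolding legs_pure assoc_E3[OF D(1)] assoc pair_poly x3_letter gval_int ..
    show "tensor_assoc (tensor_map Delta_hat id (fm k \<otimes> 1)) * ?E = ev (x3 k) (pair_poly (tau (odd n) a b, 0) 1 3) * ?E" for k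
      unfolding legs_pure assoc_E3[OF D(2)] assoc pair_poly x3_letter gval_int ..
    show "tensor_assoc (tensor_map Delta_hat id (K \<otimes> fp k)) * ?E = ev (x3 k) (scale_poly (mu (odd n) a b, 0) (letter 4)) * ?E" for k
      unfolding legs_pure assoc_E3[OF D(3)] assoc ev_scale_poly letter x3_letter gval_int ..
    show "tensor_assoc (tensor_map Delta_hat id (K \<otimes> fm k)) * ?E = ev (x3 k) (scale_poly (mu (odd n) a b, 0) (letter 5)) * ?E" for k
      unfolding legs_pure assoc_E3[OF D(3)] assoc ev_scale_poly letter x3_letter gval_int ..
    show "tensor_assoc (tensor_map Delta_hat id (1 \<otimes> K)) * ?E = mono 1 0 0 1 * ?E"
      by (simp add: legs_pure alg_homD[OF alg_hom_Delta_hat] one_tensor_def tensor_assoc_pure mono tensor_mult del: of_bool_eq)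
  qed (simp_all add: pair_poly letter parity_scale_poly n_def)
  then show "r (tensor_assoc (tensor_map Delta_hat id zeta)) (leg2_poly (odd n) a b c) 1 0 0 (zeta_exp n (a \<noteq> b) c)"
    unfolding r_def by simp
  have "rep (tensor_map id Delta_hat zeta) (leg3_poly (odd n) a b c)
      (of_int (mu (odd n) b c) ^ zeta_exp n a (b \<noteq> c)) (zeta_exp n a (b \<noteq> c) * 0) (zeta_exp n a (b \<noteq> c) * 1) (zeta_exp n a (b \<noteq> c) * 1)"
    unfolding leg3_poly_def
  proof (rule rep_zeta_letters[OF alg_hom_legs(3)])
    show "tensor_map id Delta_hat (eb c' \<otimes> eb d) * ?E = (if c' = a \<and> d = (b \<noteq> c) then ?E else 0)" for c' d
    proof -
      have "tensor_map id Delta_hat (eb c' \<otimes> eb d) * ?E = (eb c' \<otimes> (if d = (b \<noteq> c) then 1 else 0)) * ?E"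
        unfolding legs_pure by (rule right_E3) (simp add: Delta_hat_eb del: of_bool_eq)
      then show ?thesis by (auto simp: tensor_mult e_mult simp del: of_bool_eq)
    qed
    show "tensor_map id Delta_hat (fp k \<otimes> 1) * ?E = ev (x3 k) (letter 0) * ?E" for k
      by (simp add: legs_pure alg_homD[OF alg_hom_Delta_hat] letter x3_letter one_tensor_def)
    show "tensor_map id Delta_hat (fm k \<otimes> 1) * ?E = ev (x3 k) (letter 1) * ?E" for k
      unfolding letter x3_letter legs_pure alg_homD[OF alg_hom_Delta_hat] one_tensor_def ..
    show "tensor_map id Delta_hat (K \<otimes> fp k) * ?E = ev (x3 k) (pair_poly (tau (odd n) b c, 0) 2 4) * ?E" for k
      unfolding legs_pure right_E3[OF D(1)] tensor_add_right tensor_scaleC_right pair_poly x3_letter gval_int ..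
    show "tensor_map id Delta_hat (K \<otimes> fm k) * ?E = ev (x3 k) (pair_poly (tau (odd n) b c, 0) 3 5) * ?E" for k
      unfolding legs_pure right_E3[OF D(2)] tensor_add_right tensor_scaleC_right pair_poly x3_letter gval_int ..
    show "tensor_map id Delta_hat (1 \<otimes> K) * ?E = mono (of_int (mu (odd n) b c)) 0 1 1 * ?E"
      unfolding legs_pure right_E3[OF D(3)] tensor_scaleC_right by (simp add: mono tensor_mult)
  qed (simp_all add: pair_poly letter n_def)
  then show "r (tensor_map id Delta_hat zeta) (leg3_poly (odd n) a b c)
      (of_int (mu (odd n) b c) ^ zeta_exp n a (b \<noteq> c)) 0 (zeta_exp n a (b \<noteq> c)) (zeta_exp n a (b \<noteq> c))"
    unfolding r_def by simp
  have s: "sgb a *\<^sub>C sgb a *\<^sub>C X = X" "(sgb a * sgb b) *\<^sub>C sgb a *\<^sub>C sgb b *\<^sub>C X = X" for X :: "'n sf \<otimes> 'n sf \<otimes> 'n sf"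
    by (simp_all add: scaleC_scaleC scaleC_one)
  note ev4 = ev_scale_poly scaleC_mult_left ev_mult letter x3_letter gval_int tensor_mult mult.assoc
    K2_e[unfolded mult.assoc] tensor_scaleC_left tensor_scaleC_right mult_1_left mult_1_right
  have "rep (1 \<otimes> zeta) (leg4_poly a b c) (1 ^ zeta_exp n b c) (zeta_exp n b c * 0) (zeta_exp n b c * 0) (zeta_exp n b c * 1)"
    unfolding leg4_poly_def Let_def
  proof (rule rep_zeta[OF alg_hom_tensor_right])
    show "(1 \<otimes> eb c' \<otimes> eb d) * ?E = (if c' = b \<and> d = c then ?E else 0)" for c' d
      by (rule eb_tensor_E3)
  qed (simp_all add: ev4 scaleC_minus_left scaleC_one letter parity_scale_poly n_def mono
      parity_mult_poly[of False _ False, simplified] del: of_bool_eq)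
  then show "r (1 \<otimes> zeta) (leg4_poly a b c) 1 0 0 (zeta_exp n b c)"
    unfolding r_def by simp
qed

section \<open>The coassociators in a sector\<close>

definition Phi_local_poly :: "bool \<Rightarrow> bool \<Rightarrow> bool \<Rightarrow> cpoly" where
  "Phi_local_poly a b c =
    (let q = q3 a b c; m = (\<lambda>i j. mult_poly q (letter i) (letter j));
       bc = scale_poly (sgb a, 0) (m 2 5); bc' = scale_poly (sgb a, 0) (m 3 4);
       nb = scale_poly (sgb a, 0) (m 3 2)
     in if \<not> a \<and> b \<and> \<not> c then
          mult_poly q (one_poly @ scale_poly (1, 1) (m 0 5)) (one_poly @ scale_poly (1, - 1) (m 1 4))
        else if a \<and> \<not> b \<and> c then
          mult_poly q (one_poly @ scale_poly (1, 1) bc @ scale_poly (1, - 1) (m 1 2))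
            (one_poly @ scale_poly (1, 1) (m 0 3) @ scale_poly (1, - 1) bc')
        else if a \<and> b \<and> c then
          mult_poly q (mult_poly q
            (one_poly @ scale_poly (- 1, 1) (bc @ m 0 5 @ scale_poly (- 1, 0) (m 0 3) @ nb))
            (one_poly @ scale_poly (1, - 1) (bc' @ m 1 4 @ scale_poly (- 1, 0) (m 1 2) @ scale_poly (- 1, 0) nb)))
            (one_poly @ scale_poly (- 2, 0) nb)
        else one_poly)"

text \<open>The monomial left of the product is \<open>K ^ (N - 1)\<close> in the first factor and,
  if \<open>b\<close> fails, also in the second; moving it to the right flips these modes when
  \<open>N\<close> is even.\<close>

definition Phi_hat_poly :: "bool \<Rightarrow> bool \<Rightarrow> bool \<Rightarrow> bool \<Rightarrow> cpoly" where
  "Phi_hat_poly s a b c = (if a \<and> c then mult_poly (q3 a b c) one_poly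
     (flip_poly (\<not> s) (\<not> b \<and> \<not> s) False (Phi_local_poly a b c)) else Phi_local_poly a b c)"

lemma even_letter_pair: "even_poly (mult_poly q (letter i) (letter j))"
  using parity_mult_poly[OF letter(1) letter(1)] by simp

lemma even_Phi_local_poly: "even_poly (Phi_local_poly a b c)"
  unfolding Phi_local_poly_def Let_def
  by (simp add: parity_append one_poly parity_scale_poly even_mult_poly even_letter_pair)

text \<open>On the right \<open>Phi\<close> has no letters; it is a monomial in the third factor and
  flips the third mode exactly when \<open>a\<close>, \<open>b\<close> hold and \<open>N\<close> is
  odd. The Booleans are the sector and this parity.\<close>

lemma Phi_check:
  "\<forall>a b c s. poly_eq
     (mult_poly (q3 a b c) (mult_poly (q3 a b c) (leg1_poly a b c)
       (flip_poly False (zpar s a b) False (leg2_poly s a b c)))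
       (flip_poly False (zpar s a b) (zpar s (a \<noteq> b) c) (Phi_hat_poly s a b c)))
     (mult_poly (q3 a b c) (mult_poly (q3 a b c) one_poly
       (flip_poly False False (a \<and> b \<and> s) (leg4_poly a b c)))
       (flip_poly False False ((a \<and> b \<and> s) \<noteq> zpar s b c) (leg3_poly s a b c)))"
  by code_simp

lemma e_E3: "n < 2 \<Longrightarrow> m < 2 \<Longrightarrow> l < 2 \<Longrightarrow>
    (e n \<otimes> e m \<otimes> e l) * E3 a b c = (if n = of_bool a \<and> m = of_bool b \<and> l = of_bool c then E3 a b c else 0)"
  by (simp add: tensor_mult e_mult_nat del: of_bool_eq)

lemma Phi_hat_E3:
  "Phi_hat \<beta> * E3 a b c = Phi_hat_comp \<beta> (of_bool a) (of_bool b) (of_bool c) * E3 a b c"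
  unfolding Phi_hat_def
  by (simp add: distrib_right mult.assoc e_E3 del: One_nat_def of_bool_eq Phi_hat_comp_def)

lemma rep_Phi_hat:
  fixes \<beta> :: complex and a b c :: bool
  defines "n \<equiv> CARD('n::{finite,linorder})"
  shows "sector.rep (E3 a b c) (x3 :: 'n \<Rightarrow> _) kk3 (Phi_hat \<beta>) (Phi_hat_poly (odd n) a b c)
    (if a \<and> c then if b then - (\<i> ^ n) * \<beta>\<^sup>2 else (- 1) ^ (n - 1) else 1)
    (if a \<and> c then 2 * (n - 1) else 0) (if a \<and> c then n else 0) 0"
proof -
  let ?E = "E3 a b c :: 'n sf \<otimes> 'n sf \<otimes> 'n sf"
  interpret sector ?E "q3 a b c" "[sgb a, sgb b, sgb c]" "x3 :: 'n \<Rightarrow> _" kk3 by (rule sector3)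
  have n: "n > 0" "odd (n - 1) = (\<not> odd n)" by (simp_all add: n_def)
  define m where "m i j = mult_poly (q3 a b c) (letter i) (letter j)" for i j
  define bc where "bc = scale_poly (sgb a, 0) (m 2 5)"
  define bc' where "bc' = scale_poly (sgb a, 0) (m 3 4)"
  define nb where "nb = scale_poly (sgb a, 0) (m 3 2)"
  have s: "gval (sgb a, 0) * sgb a = 1" by (simp add: gval_def)
  have m: "ev (x3 k) (m 0 5) * ?E = (fp k * K \<otimes> K \<otimes> fm k) * ?E"
    "ev (x3 k) (m 1 4) * ?E = (fm k * K \<otimes> K \<otimes> fp k) * ?E"
    "ev (x3 k) (m 0 3) * ?E = (fp k * K \<otimes> fm k \<otimes> 1) * ?E"
    "ev (x3 k) (m 1 2) * ?E = (fm k * K \<otimes> fp k \<otimes> 1) * ?E" for k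
    unfolding m_def ev_mult letter x3_letter by (simp_all add: tensor_mult)
  have bc: "ev (x3 k) bc * ?E = (1 \<otimes> fp k * K \<otimes> fm k) * ?E"
    "ev (x3 k) bc' * ?E = (1 \<otimes> fm k * K \<otimes> fp k) * ?E"
    "ev (x3 k) nb * ?E = (1 \<otimes> fm k * fp k \<otimes> 1) * ?E" for k
    unfolding bc_def bc'_def nb_def m_def ev_scale_poly scaleC_mult_left ev_mult letter x3_letter
      tensor_mult mult.assoc K2_e[unfolded mult.assoc] tensor_scaleC_left scaleC_scaleC s scaleC_one
    by (simp_all only: mult_1_left mult_1_right mult.assoc)
  note loc = ev_simps ev_scale_poly one_poly distrib_right left_diff_distrib scaleC_mult_left scaleC_scaleC
    m bc gval_def scaleC_minus_left scaleC_diff_left scaleC_add_left scaleC_add_right scaleC_diff_right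
    scaleC_minus_right scaleC_one
  note poly = Phi_local_poly_def Let_def m_def bc_def bc'_def nb_def
  have O: "rep (oprod g) (Phi_local_poly a b c) 1 0 0 0"
    if "\<And>k. g k * ?E = ev (x3 k) P * ?E" "Phi_local_poly a b c = P" for g P
    using rep_oprod[OF that(1)] that(2) even_Phi_local_poly by blast
  consider "\<not> a" "b" "\<not> c" | "a" "\<not> b" "c" | "a" "b" "c" | "\<not> (\<not> a \<and> b \<and> \<not> c)" "\<not> (a \<and> c)"
    by blast
  then show ?thesis
  proof cases
    case 1
    let ?P = "mult_poly (q3 a b c) (one_poly @ scale_poly (1, 1) (m 0 5)) (one_poly @ scale_poly (1, - 1) (m 1 4))"
    have r: "rep Phi_hat_010 (Phi_local_poly a b c) 1 0 0 0"
      unfolding Phi_hat_010_def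
    proof (rule O)
      show "(1 + (1 + \<i>) *\<^sub>C (fp k * K \<otimes> K \<otimes> fm k)) * (1 + (1 - \<i>) *\<^sub>C (fm k * K \<otimes> K \<otimes> fp k)) * ?E =
          ev (x3 k) ?P * ?E" for k
        unfolding ev_mult by (rule mod_mult) (simp_all add: loc del: of_bool_eq One_nat_def)
    qed (use 1 in \<open>simp add: poly\<close>)
    have eq: "Phi_hat \<beta> * ?E = Phi_hat_010 * ?E"
      unfolding Phi_hat_E3 using 1 by (simp add: Phi_hat_comp_def)
    from rep_cong[THEN iffD2, OF eq r] 1 show ?thesis by (simp add: Phi_hat_poly_def)
  next
    case 2
    let ?g = "\<lambda>k. (1 + (1 + \<i>) *\<^sub>C (1 \<otimes> fp k * K \<otimes> fm k) + (1 - \<i>) *\<^sub>C (fm k * K \<otimes> fp k \<otimes> 1)) *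
       (1 + (1 + \<i>) *\<^sub>C (fp k * K \<otimes> fm k \<otimes> 1) + (1 - \<i>) *\<^sub>C (1 \<otimes> fm k * K \<otimes> fp k))"
    let ?P = "mult_poly (q3 a b c) (one_poly @ scale_poly (1, 1) bc @ scale_poly (1, - 1) (m 1 2))
            (one_poly @ scale_poly (1, 1) (m 0 3) @ scale_poly (1, - 1) bc')"
    have g: "rep (oprod ?g) (Phi_local_poly a b c) 1 0 0 0"
    proof (rule O)
      show "?g k * ?E = ev (x3 k) ?P * ?E" for k
        unfolding ev_mult by (rule mod_mult) (simp_all add: loc del: of_bool_eq One_nat_def)
    qed (use 2 in \<open>simp add: poly\<close>)
    \<comment> \<open>The resulting sign is undone later by \<open>K ^ (2 * (N - 1))\<close> in the
      first factor, which equals the same sign because \<open>a\<close> holds.\<close>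
    have "(- K) ^ (n - 1) = (- 1) ^ (n - 1) *\<^sub>C (K ^ (n - 1) :: 'n sf)"
      using scaleC_power[of "- 1" "K :: 'n sf" "n - 1"] by (simp add: scaleC_minus_left scaleC_one)
    then have K1: "rep ((- K) ^ (n - 1) \<otimes> K ^ (n - 1) \<otimes> 1) one_poly ((- 1) ^ (n - 1)) (n - 1) (n - 1) 0"
      by (intro rep_mono) (simp add: mono_def kk3_def tensor_power tensor_mult tensor_scaleC_left del: of_bool_eq)
    have K2: "(K ^ (n - 1) \<otimes> K \<otimes> 1) * ?E = mono 1 (n - 1) 1 0 * ?E"
      by (simp add: mono_def kk3_def tensor_power tensor_mult scaleC_one del: of_bool_eq)
    have eq: "Phi_hat \<beta> * ?E = Phi_hat_101 * ?E"
      unfolding Phi_hat_E3 using 2 by (simp add: Phi_hat_comp_def)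
    have r: "rep Phi_hat_101 (mult_poly (q3 a b c) one_poly (flip_poly (odd (n - 1)) (odd (n - 1)) (odd (0 :: nat)) (Phi_local_poly a b c)))
        ((- 1) ^ (n - 1) * 1 * 1) (n - 1 + 0 + (n - 1)) (n - 1 + 0 + 1) (0 + 0 + 0)"
      unfolding Phi_hat_101_def n_def[symmetric]
      by (rule rep_mult_mono[OF rep_mult[OF K1 g] K2])
    from rep_cong[THEN iffD2, OF eq r] 2 n show ?thesis by (simp add: Phi_hat_poly_def mult_2)
  next
    case 3
    let ?p = "\<lambda>k. 1 + (\<i> - 1) *\<^sub>C (1 \<otimes> fp k * K \<otimes> fm k + fp k * K \<otimes> K \<otimes> fm k
                         - fp k * K \<otimes> fm k \<otimes> 1 + 1 \<otimes> fm k * fp k \<otimes> 1)"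
    let ?r = "\<lambda>k. 1 - (\<i> - 1) *\<^sub>C (1 \<otimes> fm k * K \<otimes> fp k + fm k * K \<otimes> K \<otimes> fp k
                         - fm k * K \<otimes> fp k \<otimes> 1 - 1 \<otimes> fm k * fp k \<otimes> 1)"
    let ?t = "\<lambda>k. 1 - 2 *\<^sub>C (1 \<otimes> fm k * fp k \<otimes> 1)"
    let ?P = "mult_poly (q3 a b c) (mult_poly (q3 a b c)
            (one_poly @ scale_poly (- 1, 1) (bc @ m 0 5 @ scale_poly (- 1, 0) (m 0 3) @ nb))
            (one_poly @ scale_poly (1, - 1) (bc' @ m 1 4 @ scale_poly (- 1, 0) (m 1 2) @ scale_poly (- 1, 0) nb)))
            (one_poly @ scale_poly (- 2, 0) nb)"
    have g: "rep (oprod (\<lambda>k. ?p k * ?r k * ?t k)) (Phi_local_poly a b c) 1 0 0 0"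
    proof (rule O)
      show "?p k * ?r k * ?t k * ?E = ev (x3 k) ?P * ?E" for k
        unfolding ev_mult
      proof (rule mod_mult)
        show "?p k * ?r k * ?E = ev (x3 k) (mult_poly (q3 a b c)
            (one_poly @ scale_poly (- 1, 1) (bc @ m 0 5 @ scale_poly (- 1, 0) (m 0 3) @ nb))
            (one_poly @ scale_poly (1, - 1) (bc' @ m 1 4 @ scale_poly (- 1, 0) (m 1 2) @ scale_poly (- 1, 0) nb))) * ?E"
          unfolding ev_mult by (rule mod_mult) (simp_all add: loc algebra_simps del: of_bool_eq One_nat_def)
      qed (simp add: loc del: of_bool_eq One_nat_def)
    qed (use 3 in \<open>simp add: poly\<close>)
    have K1: "rep (K ^ (n - 1) \<otimes> 1 \<otimes> 1) one_poly 1 (n - 1) 0 0"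
      by (rule rep_mono) (simp add: mono_def kk3_def tensor_power scaleC_one del: of_bool_eq)
    have K2: "(K ^ (n - 1) \<otimes> K ^ n \<otimes> 1) * ?E = mono 1 (n - 1) n 0 * ?E"
      by (simp add: mono_def kk3_def tensor_power tensor_mult scaleC_one del: of_bool_eq)
    have eq: "Phi_hat \<beta> * ?E = Phi_hat_111 \<beta> * ?E"
      unfolding Phi_hat_E3 using 3 by (simp add: Phi_hat_comp_def)
    have r: "rep (Phi_hat_111 \<beta>) (mult_poly (q3 a b c) one_poly (flip_poly (odd (n - 1)) (odd (0 :: nat)) (odd (0 :: nat)) (Phi_local_poly a b c)))
        (- (\<i> ^ n) * \<beta>\<^sup>2 * (1 * 1 * 1)) (n - 1 + 0 + (n - 1)) (0 + 0 + n) (0 + 0 + 0)"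
      unfolding Phi_hat_111_def n_def[symmetric]
      by (rule rep_scale[OF rep_mult_mono[OF rep_mult[OF K1 g] K2]])
    from rep_cong[THEN iffD2, OF eq r] 3 n show ?thesis by (simp add: Phi_hat_poly_def mult_2)
  next
    case 4
    then have "Phi_hat \<beta> * ?E = ?E"
      unfolding Phi_hat_E3 by (auto simp: Phi_hat_comp_def)
    from rep_one[OF this] 4 show ?thesis
      by (auto simp: Phi_hat_poly_def Phi_local_poly_def)
  qed
qed

text \<open>Where \<open>a\<close> and \<open>b\<close> hold, the summands \<open>- 1\<close> inside
  \<open>Phi\<close> cancel its leading \<open>1\<close>; a monomial in \<open>K\<close> without
  letters remains.\<close>

lemma rep_Phi:
  fixes \<beta> :: complex and a b c :: bool
  defines "n \<equiv> CARD('n::{finite,linorder})"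
  shows "sector.rep (E3 a b c) (x3 :: 'n \<Rightarrow> _) kk3 (Phi \<beta>) one_poly
    (if a \<and> b \<and> c then \<beta>\<^sup>2 * \<i> ^ n else 1) 0 0 (if a \<and> b then n else 0)"
proof -
  let ?E = "E3 a b c :: 'n sf \<otimes> 'n sf \<otimes> 'n sf"
  interpret sector ?E "q3 a b c" "[sgb a, sgb b, sgb c]" "x3 :: 'n \<Rightarrow> _" kk3 by (rule sector3)
  let ?X = "(if c then \<beta>\<^sup>2 * \<i> ^ n else 1) *\<^sub>C K ^ n :: 'n sf"
  have X: "((K ^ n - 1) * e 0 + (\<beta>\<^sup>2 *\<^sub>C (\<i> *\<^sub>C K) ^ n - 1) * e 1) * eb c = (?X - 1) * (eb c :: 'n sf)"
    by (simp add: distrib_right mult.assoc e_mult_nat scaleC_power scaleC_scaleC scaleC_one del: of_bool_eq One_nat_def)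
  have "Phi \<beta> * ?E = ?E + (e 1 * eb a) \<otimes> (e 1 * eb b) \<otimes> ((?X - 1) * eb c)"
    unfolding Phi_def n_def[symmetric] by (subst distrib_right) (simp only: tensor_mult X mult_1_left)
  also have "\<dots> = ?E + of_bool (a \<and> b) *\<^sub>C ((1 \<otimes> 1 \<otimes> (?X - 1)) * ?E)"
    unfolding e1_eb by (cases a; cases b) (simp_all add: tensor_mult tensor_scaleC_left tensor_scaleC_right scaleC_one)
  also have "\<dots> = mono (if a \<and> b \<and> c then \<beta>\<^sup>2 * \<i> ^ n else 1) 0 0 (if a \<and> b then n else 0) * ?E"
    by (simp add: mono_def kk3_def tensor_power tensor_diff_right left_diff_distrib scaleC_one
        tensor_scaleC_right one_tensor_def[symmetric] del: of_bool_eq(2))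
  finally show ?thesis by (rule rep_mono)
qed

lemma twist_Phi:
  fixes \<beta> :: complex
  shows "tensor_assoc (zeta \<otimes> 1) * tensor_assoc (tensor_map Delta_hat id zeta) * Phi_hat \<beta> =
    Phi \<beta> * (1 \<otimes> zeta) * tensor_map id Delta_hat (zeta :: 'n::{finite,linorder} sf \<otimes> 'n sf)"
proof (rule tensor3_sector_eqI)
  fix a b c
  let ?E = "E3 a b c :: 'n sf \<otimes> 'n sf \<otimes> 'n sf"
  let ?n = "CARD('n)"
  interpret sector ?E "q3 a b c" "[sgb a, sgb b, sgb c]" "x3 :: 'n \<Rightarrow> _" kk3 by (rule sector3)
  note legs = rep_legs[where 'n = 'n, of a b c]
  have scal: "(if a \<and> c then if b then - (\<i> ^ ?n) * \<beta>\<^sup>2 else (- 1) ^ (?n - 1) else 1) *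
      of_int (sgb a ^ ((if a \<and> c then 2 * (?n - 1) else 0) div 2) *
        sgb b ^ ((zeta_exp ?n a b + (if a \<and> c then ?n else 0)) div 2) * sgb c ^ (zeta_exp ?n (a \<noteq> b) c div 2)) =
      (if a \<and> b \<and> c then \<beta>\<^sup>2 * \<i> ^ ?n else 1) * of_int (mu (odd ?n) b c) ^ zeta_exp ?n a (b \<noteq> c) *
      of_int (sgb b ^ (zeta_exp ?n a (b \<noteq> c) div 2) *
        sgb c ^ (((if a \<and> b then ?n else 0) + zeta_exp ?n b c + zeta_exp ?n a (b \<noteq> c)) div 2))"
  proof -
    \<comment> \<open>Writing \<open>N\<close> as a successor removes the truncated subtraction in
      \<open>N - 1\<close>; the parity of \<open>m\<close> decides the remaining signs.\<close>
    obtain m where "?n = Suc m" using not0_implies_Suc[of ?n] by auto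
    then show ?thesis
      by (cases a; cases b; cases c; cases "even m") (simp_all add: zeta_exp_def mu_def flip: mult_2)
  qed
  show "tensor_assoc (zeta \<otimes> 1) * tensor_assoc (tensor_map Delta_hat id zeta) * Phi_hat \<beta> * ?E =
      Phi \<beta> * (1 \<otimes> zeta) * tensor_map id Delta_hat zeta * ?E"
  proof (rule rep_eqI[OF rep_mult[OF rep_mult[OF legs(1,2)] rep_Phi_hat]
        rep_mult[OF rep_mult[OF rep_Phi legs(4)] legs(3)]], goal_cases)
    case 1
    have "odd (if P then n else 0) = (P \<and> odd n)" for P and n :: nat by simp
    then show ?case
      using Phi_check by (simp only: add_0_left add_0_right odd_zeta_exp odd_add even_zero not_True_eq_False conj_assoc)
  qed (use scal in \<open>simp_all add: even_zeta_exp del: of_bool_eq\<close>, auto simp: zpar_def)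
qed

section \<open>From intertwining relations to the twisted structure\<close>

lemma alg_hom_inverse: "alg_hom h \<Longrightarrow> is_inverse x y \<Longrightarrow> h x * h y = 1"
  by (simp add: is_inverse_def alg_homD(3) flip: alg_homD(4))

theorem propositionB9:
  fixes \<beta> :: complex
  assumes "\<beta> ^ 4 = (- 1) ^ CARD('n::{finite,linorder})"
  shows "is_twist (zeta :: 'n sf \<otimes> 'n sf) \<and>
    (\<forall>x :: 'n sf. zeta * Delta_hat x * unit_inv zeta = Delta x) \<and>
    tensor_flip zeta * R_hat \<beta> * unit_inv zeta = (R_mat \<beta> :: 'n sf \<otimes> 'n sf) \<and>
    tensor_assoc (zeta \<otimes> 1) * tensor_assoc (tensor_map Delta_hat id zeta) * Phi_hat \<beta> *
      tensor_map id Delta_hat (unit_inv zeta) * (1 \<otimes> unit_inv zeta)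
      = (Phi \<beta> :: 'n sf \<otimes> 'n sf \<otimes> 'n sf)"
proof (intro conjI allI)
  have inv: "zeta * zeta_inv = (1 :: 'n sf \<otimes> 'n sf)"
    using zeta_inverse[where 'n = 'n] by (simp add: is_inverse_def)
  show "is_twist (zeta :: 'n sf \<otimes> 'n sf)" by (rule is_twist_zeta)
  show "zeta * Delta_hat x * unit_inv zeta = Delta x" for x :: "'n sf"
    unfolding unit_inv_zeta zeta_Delta_hat by (simp add: mult.assoc inv)
  show "tensor_flip zeta * R_hat \<beta> * unit_inv zeta = (R_mat \<beta> :: 'n sf \<otimes> 'n sf)"
    unfolding unit_inv_zeta twist_R by (simp add: mult.assoc inv)
  \<comment> \<open>Algebra maps preserve inverses, so the images of the inverse twist cancel those
    of the twist in the cube.\<close>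
  have legs: "tensor_map id Delta_hat zeta * tensor_map id Delta_hat zeta_inv = (1 :: 'n sf \<otimes> 'n sf \<otimes> 'n sf)"
    "(1 \<otimes> zeta) * (1 \<otimes> zeta_inv) = (1 :: 'n sf \<otimes> 'n sf \<otimes> 'n sf)"
    by (rule alg_hom_inverse[OF _ zeta_inverse] alg_hom_legs(3) alg_hom_tensor_right)+
  have "Phi \<beta> * (1 \<otimes> zeta) * tensor_map id Delta_hat zeta * tensor_map id Delta_hat zeta_inv * (1 \<otimes> zeta_inv) =
      Phi \<beta> * ((1 \<otimes> zeta) * (tensor_map id Delta_hat zeta * tensor_map id Delta_hat zeta_inv) *
        (1 \<otimes> zeta_inv :: 'n sf \<otimes> 'n sf \<otimes> 'n sf))"
    by (simp only: mult.assoc)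
  also have "\<dots> = Phi \<beta>"
    by (simp only: legs mult_1_right)
  finally show "tensor_assoc (zeta \<otimes> 1) * tensor_assoc (tensor_map Delta_hat id zeta) * Phi_hat \<beta> *
      tensor_map id Delta_hat (unit_inv zeta) * (1 \<otimes> unit_inv zeta)
      = (Phi \<beta> :: 'n sf \<otimes> 'n sf \<otimes> 'n sf)"
    unfolding unit_inv_zeta twist_Phi .
qed

end
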